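(* Let $p$ be a prime, $m,n\in\mathbb N$, and $\psi$ a real, positive, decreasing function. Let $$W_p(m,n;\psi):=\{X\in\mathbb Z_p^{mn}:|\mathbf qX+\mathbf p|_p<\psi(\max(|\mathbf p|,|\mathbf q|))\text{ for infinitely many }(\mathbf p,\mathbf q)\in\mathbb Z^n\times\mathbb Z^m\}.$$ Let $f$ be a dimension function such that $r^{-mn}f(r)\to\infty$ as $r\to0$ and $r^{-mn}f(r)$ is decreasing, and suppose $r^{-(m-1)n}f(r)$ is increasing. Then $$\mathcal H^f(W_p(m,n;\psi))=\begin{cases}0&\text{if }\sum_{r=1}^\infty f(\psi(r))\,\psi(r)^{-(m-1)n}\,r^{m+n-1}<\infty,\\ \infty&\text{if }\sum_{r=1}^\infty f(\psi(r))\,\psi(r)^{-(m-1)n}\,r^{m+n-1}=\infty.\end{cases}$$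
   Context: $|\cdot|_p$ is the $p$-adic absolute value, $\mathbb Z_p$ the ring of $p$-adic integers; for a vector $\mathbf x$ in $\mathbb Q_p^k$, $|\mathbf x|_p=\max_i|x_i|_p$, and for $\mathbf x\in\mathbb Z^k$, $|\mathbf x|=\max_i|x_i|$ (real absolute values). $X\in\mathbb Z_p^{mn}$ is regarded as an $m\times n$ matrix with columns $X^{(j)}$, $\mathbf qX$ is the vector $(\mathbf q\cdot X^{(j)})_{j=1}^n$, and $|\mathbf qX+\mathbf p|_p=\max_j|\mathbf q\cdot X^{(j)}+p_j|_p$. The metric on $\mathbb Z_p^{mn}$ is $d(X,Y)=|X-Y|_p$ (max of $p$-adic absolute values of entries). A dimension function is an increasing continuous $f$ with $f(r)\to0$ as $r\to0$; $\mathcal H^f(F)=\lim_{\rho\to0}\inf\sum_if(r_i)$ over countable covers of $F$ by balls of radii $r_i\le\rho$. *)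

theory Defs
  imports "HOL-Analysis.Analysis" "HOL-Algebra.Multiplicative_Group"
begin

section \<open>The ring of \<open>p\<close>-adic integers\<close>

text \<open>
  A \<open>p\<close>-adic integer is represented by its compatible system of residues: \<open>x n\<close> is the residue
  of \<open>x\<close> modulo \<open>p ^ n\<close>, normalised to lie in \<open>{0..<p ^ n}\<close>. In other words the ring below is the
  inverse limit of the rings of integers modulo \<open>p ^ n\<close>.
\<close>

definition padic_ring :: "nat \<Rightarrow> (nat \<Rightarrow> int) ring" where
  "padic_ring p = \<lparr>
     carrier = {x. \<forall>n. x n = x (Suc n) mod int p ^ n},
     mult = (\<lambda>x y n. (x n * y n) mod int p ^ n),
     one = (\<lambda>n. 1 mod int p ^ n),
     zero = (\<lambda>n. 0),
     add = (\<lambda>x y n. (x n + y n) mod int p ^ n)\<rparr>"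

definition padic_of_int :: "nat \<Rightarrow> int \<Rightarrow> nat \<Rightarrow> int" where
  "padic_of_int p k = (\<lambda>n. k mod int p ^ n)"

text \<open>
  Since \<open>x 0 = 0\<close> always holds, the exponent is the largest \<open>n\<close> with \<open>x n = 0\<close>, that is, the
  \<open>p\<close>-adic valuation of \<open>x\<close>.
\<close>

definition padic_abs :: "nat \<Rightarrow> (nat \<Rightarrow> int) \<Rightarrow> real" where
  "padic_abs p x =
     (if x = \<zero>\<^bsub>padic_ring p\<^esub> then 0 else (1 / real p) ^ (LEAST n. x (Suc n) \<noteq> 0))"

lemma padic_mod_Suc: "x mod int p ^ Suc n mod int p ^ n = x mod int p ^ n"
  by (rule mod_mod_cancel) (rule le_imp_power_dvd, simp)

lemma padic_carrier_iff:
  "x \<in> carrier (padic_ring p) \<longleftrightarrow> (\<forall>n. x n = x (Suc n) mod int p ^ n)"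
  by (simp add: padic_ring_def)

lemma padic_carrierD:
  "x \<in> carrier (padic_ring p) \<Longrightarrow> x n = x (Suc n) mod int p ^ n"
  unfolding padic_carrier_iff by (erule spec)

lemma padic_carrier_mod:
  assumes "x \<in> carrier (padic_ring p)"
  shows "x n mod int p ^ n = x n"
  by (subst (1 2) padic_carrierD[OF assms]) (rule mod_mod_trivial)

lemma padic_of_int_carrier [simp]: "padic_of_int p k \<in> carrier (padic_ring p)"
  unfolding padic_carrier_iff padic_of_int_def padic_mod_Suc by simp

lemma padic_residues_eq:
  assumes "x \<in> carrier (padic_ring p)" "n \<le> k"
  shows "x n = x k mod int p ^ n"
  using assms(2)
proof (induction k rule: dec_induct)
  case base
  then show ?case using padic_carrier_mod[OF assms(1)] by simp
next
  case (step k)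
  have "x k = x (Suc k) mod int p ^ k"
    using assms(1) by (rule padic_carrierD)
  then have "x n = x (Suc k) mod int p ^ k mod int p ^ n"
    using step.IH by simp
  then show ?case
    using step.hyps(1) mod_mod_cancel[OF le_imp_power_dvd[of n k "int p"]] by metis
qed

lemma padic_binop_closed:
  assumes "x \<in> carrier (padic_ring p)" "y \<in> carrier (padic_ring p)"
  shows "(\<lambda>n. (x n + y n) mod int p ^ n) \<in> carrier (padic_ring p)"
    and "(\<lambda>n. (x n * y n) mod int p ^ n) \<in> carrier (padic_ring p)"
proof -
  have x: "x n = x (Suc n) mod int p ^ n" and y: "y n = y (Suc n) mod int p ^ n" for n
    by (rule padic_carrierD[OF assms(1)], rule padic_carrierD[OF assms(2)])
  show "(\<lambda>n. (x n + y n) mod int p ^ n) \<in> carrier (padic_ring p)"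
    unfolding padic_carrier_iff padic_mod_Suc
    by (intro allI, subst x, subst y) (rule mod_add_eq)
  show "(\<lambda>n. (x n * y n) mod int p ^ n) \<in> carrier (padic_ring p)"
    unfolding padic_carrier_iff padic_mod_Suc
    by (intro allI, subst x, subst y) (rule mod_mult_eq)
qed

lemma padic_neg_closed:
  assumes "x \<in> carrier (padic_ring p)"
  shows "(\<lambda>n. (- x n) mod int p ^ n) \<in> carrier (padic_ring p)"
proof -
  have x: "x n = x (Suc n) mod int p ^ n" for n
    using assms by (rule padic_carrierD)
  show ?thesis
    unfolding padic_carrier_iff padic_mod_Suc
    by (intro allI, subst x) (rule mod_minus_eq)
qed

lemma padic_cring: "cring (padic_ring p)"
proof (rule cringI)
  have add: "x \<oplus>\<^bsub>padic_ring p\<^esub> y = (\<lambda>n. (x n + y n) mod int p ^ n)"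
    and mult: "x \<otimes>\<^bsub>padic_ring p\<^esub> y = (\<lambda>n. (x n * y n) mod int p ^ n)"
    and zero: "\<zero>\<^bsub>padic_ring p\<^esub> = (\<lambda>n. 0)"
    and one: "\<one>\<^bsub>padic_ring p\<^esub> = (\<lambda>n. 1 mod int p ^ n)" for x y
    by (simp_all add: padic_ring_def)
  show "abelian_group (padic_ring p)"
  proof (rule abelian_groupI)
    fix x assume x: "x \<in> carrier (padic_ring p)"
    show "\<zero>\<^bsub>padic_ring p\<^esub> \<oplus>\<^bsub>padic_ring p\<^esub> x = x"
      by (simp add: add zero padic_carrier_mod[OF x])
    show "\<exists>y\<in>carrier (padic_ring p). y \<oplus>\<^bsub>padic_ring p\<^esub> x = \<zero>\<^bsub>padic_ring p\<^esub>"
      by (rule bexI[OF _ padic_neg_closed[OF x]]) (simp add: add zero mod_simps)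
  next
    fix x y assume "x \<in> carrier (padic_ring p)" "y \<in> carrier (padic_ring p)"
    then show "x \<oplus>\<^bsub>padic_ring p\<^esub> y \<in> carrier (padic_ring p)"
      unfolding add by (rule padic_binop_closed)
    show "x \<oplus>\<^bsub>padic_ring p\<^esub> y = y \<oplus>\<^bsub>padic_ring p\<^esub> x"
      by (simp add: add add.commute)
  next
    show "\<zero>\<^bsub>padic_ring p\<^esub> \<in> carrier (padic_ring p)"
      by (simp add: padic_carrier_iff zero)
  next
    fix x y z
    show "x \<oplus>\<^bsub>padic_ring p\<^esub> y \<oplus>\<^bsub>padic_ring p\<^esub> z = x \<oplus>\<^bsub>padic_ring p\<^esub> (y \<oplus>\<^bsub>padic_ring p\<^esub> z)"
      by (simp add: add mod_simps add.assoc)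
  qed
  show "comm_monoid (padic_ring p)"
  proof (rule comm_monoidI)
    show "\<one>\<^bsub>padic_ring p\<^esub> \<in> carrier (padic_ring p)"
      using padic_of_int_carrier[of p 1] by (simp add: one padic_of_int_def)
  next
    fix x assume x: "x \<in> carrier (padic_ring p)"
    show "\<one>\<^bsub>padic_ring p\<^esub> \<otimes>\<^bsub>padic_ring p\<^esub> x = x"
      by (simp add: mult one mod_simps padic_carrier_mod[OF x])
  next
    fix x y assume "x \<in> carrier (padic_ring p)" "y \<in> carrier (padic_ring p)"
    then show "x \<otimes>\<^bsub>padic_ring p\<^esub> y \<in> carrier (padic_ring p)"
      unfolding mult by (rule padic_binop_closed)
    show "x \<otimes>\<^bsub>padic_ring p\<^esub> y = y \<otimes>\<^bsub>padic_ring p\<^esub> x"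
      by (simp add: mult mult.commute)
  next
    fix x y z
    show "x \<otimes>\<^bsub>padic_ring p\<^esub> y \<otimes>\<^bsub>padic_ring p\<^esub> z = x \<otimes>\<^bsub>padic_ring p\<^esub> (y \<otimes>\<^bsub>padic_ring p\<^esub> z)"
      by (simp add: mult mod_simps mult.assoc)
  qed
  fix x y z
  show "(x \<oplus>\<^bsub>padic_ring p\<^esub> y) \<otimes>\<^bsub>padic_ring p\<^esub> z
      = x \<otimes>\<^bsub>padic_ring p\<^esub> z \<oplus>\<^bsub>padic_ring p\<^esub> y \<otimes>\<^bsub>padic_ring p\<^esub> z"
    by (simp add: add mult mod_simps distrib_right)
qed

lemma padic_of_int_add:
  "padic_of_int p (k + l) = padic_of_int p k \<oplus>\<^bsub>padic_ring p\<^esub> padic_of_int p l"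
  by (simp add: padic_of_int_def padic_ring_def mod_simps)

lemma padic_of_int_mult:
  "padic_of_int p (k * l) = padic_of_int p k \<otimes>\<^bsub>padic_ring p\<^esub> padic_of_int p l"
  by (simp add: padic_of_int_def padic_ring_def mod_simps)

lemma padic_of_int_one: "padic_of_int p 1 = \<one>\<^bsub>padic_ring p\<^esub>"
  by (simp add: padic_of_int_def padic_ring_def)

lemma padic_abs_nonneg: "0 \<le> padic_abs p x"
  by (simp add: padic_abs_def)

lemma padic_abs_le_iff:
  assumes x: "x \<in> carrier (padic_ring p)" and p: "1 < p"
  shows "padic_abs p x \<le> (1 / real p) ^ n \<longleftrightarrow> x n = 0"
proof (cases "x = (\<lambda>n. 0)")
  case True
  then have "padic_abs p x = 0" unfolding padic_abs_def by (simp add: padic_ring_def)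
  with True show ?thesis by simp
next
  case False
  have x0: "x 0 = 0"
    using padic_carrier_mod[OF x, of 0] by (simp only: power_0 mod_by_1)
  define N where "N = (LEAST n. x (Suc n) \<noteq> 0)"
  have "\<exists>n. x (Suc n) \<noteq> 0"
  proof (rule ccontr)
    assume "\<nexists>n. x (Suc n) \<noteq> 0"
    then have "x k = 0" for k
      using x0 by (cases k) auto
    then show False using False by (simp add: fun_eq_iff)
  qed
  hence N: "x (Suc N) \<noteq> 0"
    unfolding N_def by (rule LeastI_ex)
  have below: "x n = 0" if "n \<le> N" for n
  proof (cases n)
    case (Suc k)
    then have "k < N" using that by simp
    then show ?thesis using not_less_Least Suc unfolding N_def by blast
  qed (use x0 in simp)
  have above: "x n \<noteq> 0" if "N < n" for n
  proof
    assume "x n = 0"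
    moreover have "x (Suc N) = x n mod int p ^ Suc N"
      using padic_residues_eq[OF x] that by (simp only: Suc_le_eq)
    ultimately show False using N by (simp only: mod_0)
  qed
  have "x n = 0 \<longleftrightarrow> n \<le> N"
    using below above by (metis not_le)
  moreover have "padic_abs p x = (1 / real p) ^ N"
    using False unfolding padic_abs_def N_def by (simp add: padic_ring_def)
  moreover have "(1 / real p) ^ N \<le> (1 / real p) ^ n \<longleftrightarrow> n \<le> N"
    using p by (intro power_decreasing_iff) auto
  ultimately show ?thesis by simp
qed

lemma padic_abs_eq_0_iff:
  assumes "1 < p"
  shows "padic_abs p x = 0 \<longleftrightarrow> x = \<zero>\<^bsub>padic_ring p\<^esub>"
  using assms by (simp add: padic_abs_def)

lemma padic_abs_cases:
  obtains "x = \<zero>\<^bsub>padic_ring p\<^esub>" "padic_abs p x = 0" | n where "padic_abs p x = (1 / real p) ^ n"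
  by (cases "x = \<zero>\<^bsub>padic_ring p\<^esub>") (simp_all add: padic_abs_def)

lemma padic_abs_of_int:
  assumes p: "prime p"
  shows "padic_abs p (padic_of_int p k) =
    (if k = 0 then 0 else (1 / real p) ^ multiplicity (int p) k)"
proof (cases "k = 0")
  case True
  then show ?thesis by (simp add: padic_abs_def padic_of_int_def padic_ring_def)
next
  case False
  have p1: "1 < p" using p by (rule prime_gt_1_nat)
  have ge: "padic_abs p (padic_of_int p k) \<le> (1 / real p) ^ n \<longleftrightarrow> n \<le> multiplicity (int p) k" for n
  proof -
    have "padic_abs p (padic_of_int p k) \<le> (1 / real p) ^ n \<longleftrightarrow> k mod int p ^ n = 0"
      using padic_abs_le_iff[OF padic_of_int_carrier p1] by (simp add: padic_of_int_def)
    also have "\<dots> \<longleftrightarrow> int p ^ n dvd k"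
      by (rule mod_eq_0_iff_dvd)
    also have "\<dots> \<longleftrightarrow> n \<le> multiplicity (int p) k"
      using False p1 by (intro power_dvd_iff_le_multiplicity) auto
    finally show ?thesis .
  qed
  let ?N = "multiplicity (int p) k"
  have nz: "\<not> padic_abs p (padic_of_int p k) \<le> (1 / real p) ^ Suc ?N"
    using ge[of "Suc ?N"] by simp
  consider "padic_abs p (padic_of_int p k) = 0"
    | n where "padic_abs p (padic_of_int p k) = (1 / real p) ^ n"
    by (rule padic_abs_cases)
  then show ?thesis
  proof cases
    case 1
    then show ?thesis using nz by simp
  next
    case (2 n)
    have "n \<le> ?N" using ge[of n] 2 by simp
    moreover have "?N \<le> n"
    proof -
      have "(1 / real p) ^ n \<le> (1 / real p) ^ ?N" using ge[of ?N] 2 by simp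
      then show ?thesis using p1 by (subst (asm) power_decreasing_iff) auto
    qed
    ultimately show ?thesis using 2 False by simp
  qed
qed

lemma padic_minus_nth:
  assumes x: "x \<in> carrier (padic_ring p)" and y: "y \<in> carrier (padic_ring p)"
  shows "(x \<ominus>\<^bsub>padic_ring p\<^esub> y) n = (x n - y n) mod int p ^ n"
proof -
  interpret cring "padic_ring p" by (rule padic_cring)
  have "\<ominus>\<^bsub>padic_ring p\<^esub> y = (\<lambda>n. (- y n) mod int p ^ n)"
    by (rule minus_equality[OF _ y padic_neg_closed[OF y]])
      (simp add: padic_ring_def fun_eq_iff mod_simps)
  then show ?thesis
    by (simp add: a_minus_def padic_ring_def mod_simps)
qed

section \<open>Vectors and matrices\<close>

definition padic_max_abs :: "nat \<Rightarrow> 'i set \<Rightarrow> ('i \<Rightarrow> nat \<Rightarrow> int) \<Rightarrow> real" where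
  "padic_max_abs p I x = Max ((\<lambda>i. padic_abs p (x i)) ` I)"

definition int_vectors :: "nat \<Rightarrow> (nat \<Rightarrow> int) set" where
  "int_vectors k = {..<k} \<rightarrow>\<^sub>E UNIV"

definition int_max_abs :: "nat \<Rightarrow> (nat \<Rightarrow> int) \<Rightarrow> nat" where
  "int_max_abs k x = Max ((\<lambda>i. nat \<bar>x i\<bar>) ` {..<k})"

definition padic_matrices :: "nat \<Rightarrow> nat \<Rightarrow> nat \<Rightarrow> (nat \<times> nat \<Rightarrow> nat \<Rightarrow> int) set" where
  "padic_matrices p m n = {..<m} \<times> {..<n} \<rightarrow>\<^sub>E carrier (padic_ring p)"

definition padic_vec_mat_mult ::
    "nat \<Rightarrow> nat \<Rightarrow> (nat \<Rightarrow> int) \<Rightarrow> (nat \<times> nat \<Rightarrow> nat \<Rightarrow> int) \<Rightarrow> nat \<Rightarrow> nat \<Rightarrow> int" where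
  "padic_vec_mat_mult p m q X j =
     (\<Oplus>\<^bsub>padic_ring p\<^esub>i\<in>{..<m}. padic_of_int p (q i) \<otimes>\<^bsub>padic_ring p\<^esub> X (i, j))"

text \<open>
  The value \<open>0\<close> outside the carrier is immaterial; the locale \<open>Metric_space\<close> demands symmetry
  and nonnegativity of the distance on the whole type.
\<close>

definition padic_matrix_dist ::
    "nat \<Rightarrow> nat \<Rightarrow> nat \<Rightarrow> (nat \<times> nat \<Rightarrow> nat \<Rightarrow> int) \<Rightarrow> (nat \<times> nat \<Rightarrow> nat \<Rightarrow> int) \<Rightarrow> real" where
  "padic_matrix_dist p m n X Y =
     (if X \<in> padic_matrices p m n \<and> Y \<in> padic_matrices p m n
      then padic_max_abs p ({..<m} \<times> {..<n}) (\<lambda>ij. X ij \<ominus>\<^bsub>padic_ring p\<^esub> Y ij)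
      else 0)"

definition padic_matrix_metric ::
    "nat \<Rightarrow> nat \<Rightarrow> nat \<Rightarrow> (nat \<times> nat \<Rightarrow> nat \<Rightarrow> int) metric" where
  "padic_matrix_metric p m n = metric (padic_matrices p m n, padic_matrix_dist p m n)"

lemma padic_abs_minus_commute:
  assumes "1 < p" "x \<in> carrier (padic_ring p)" "y \<in> carrier (padic_ring p)"
  shows "padic_abs p (x \<ominus>\<^bsub>padic_ring p\<^esub> y) = padic_abs p (y \<ominus>\<^bsub>padic_ring p\<^esub> x)"
proof -
  have "(x \<ominus>\<^bsub>padic_ring p\<^esub> y) n = 0 \<longleftrightarrow> (y \<ominus>\<^bsub>padic_ring p\<^esub> x) n = 0" for n
    using assms by (simp add: padic_minus_nth mod_eq_0_iff_dvd dvd_diff_commute)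
  moreover have "\<zero>\<^bsub>padic_ring p\<^esub> = (\<lambda>n. 0)"
    by (simp add: padic_ring_def)
  ultimately show ?thesis
    unfolding padic_abs_def by (simp add: fun_eq_iff)
qed

lemma padic_abs_minus_ultrametric:
  assumes p: "1 < p" and x: "x \<in> carrier (padic_ring p)" and y: "y \<in> carrier (padic_ring p)"
    and z: "z \<in> carrier (padic_ring p)"
  shows "padic_abs p (x \<ominus>\<^bsub>padic_ring p\<^esub> z) \<le>
    max (padic_abs p (x \<ominus>\<^bsub>padic_ring p\<^esub> y)) (padic_abs p (y \<ominus>\<^bsub>padic_ring p\<^esub> z))"
proof -
  interpret cring "padic_ring p" by (rule padic_cring)
  have key: "padic_abs p (x \<ominus>\<^bsub>padic_ring p\<^esub> z) \<le> (1 / real p) ^ n"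
    if "padic_abs p (x \<ominus>\<^bsub>padic_ring p\<^esub> y) \<le> (1 / real p) ^ n"
       "padic_abs p (y \<ominus>\<^bsub>padic_ring p\<^esub> z) \<le> (1 / real p) ^ n" for n
  proof -
    have "int p ^ n dvd x n - y n" "int p ^ n dvd y n - z n"
      using that x y z p by (simp_all add: padic_abs_le_iff padic_minus_nth mod_eq_0_iff_dvd)
    then have "int p ^ n dvd (x n - y n) + (y n - z n)"
      by (rule dvd_add)
    then show ?thesis
      using x z p by (simp add: padic_abs_le_iff padic_minus_nth mod_eq_0_iff_dvd)
  qed
  let ?M = "max (padic_abs p (x \<ominus>\<^bsub>padic_ring p\<^esub> y)) (padic_abs p (y \<ominus>\<^bsub>padic_ring p\<^esub> z))"
  consider "padic_abs p (x \<ominus>\<^bsub>padic_ring p\<^esub> y) = 0" "padic_abs p (y \<ominus>\<^bsub>padic_ring p\<^esub> z) = 0"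
    | n where "?M = (1 / real p) ^ n"
  proof -
    have powers: "padic_abs p w = 0 \<or> (\<exists>n. padic_abs p w = (1 / real p) ^ n)" for w
      by (rule padic_abs_cases[of w p]) blast+
    have "(a = 0 \<and> b = 0) \<or> (\<exists>n. max a b = c ^ n)"
      if "a = 0 \<or> (\<exists>n. a = c ^ n)" "b = 0 \<or> (\<exists>n. b = c ^ n)" "0 \<le> a" "0 \<le> b" for a b c :: real
    proof (cases "a \<le> b")
      case True
      then have "max a b = b" by simp
      with that True show ?thesis by (metis order_antisym)
    next
      case False
      then have "max a b = a" by simp
      with that False show ?thesis by (metis order_refl)
    qed
    from this[OF powers powers padic_abs_nonneg padic_abs_nonneg]
    show thesis using that by blast
  qed
  then show ?thesis
  proof cases
    case 1
    have "x = y" "y = z"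
      using 1 x y z p by (auto simp: padic_abs_eq_0_iff r_right_minus_eq)
    then show ?thesis by simp
  next
    case (2 n)
    then show ?thesis using key[of n] by (metis max.cobounded1 max.cobounded2)
  qed
qed

lemma Metric_space_padic_matrices:
  assumes p: "prime p" and "0 < m" "0 < n"
  shows "Metric_space (padic_matrices p m n) (padic_matrix_dist p m n)"
proof -
  interpret cring "padic_ring p" by (rule padic_cring)
  have p1: "1 < p" using p by (rule prime_gt_1_nat)
  let ?I = "{..<m} \<times> {..<n}"
  have fin: "finite ?I" and ne: "?I \<noteq> {}" using assms by auto
  have entry: "X ij \<in> carrier (padic_ring p)" if "X \<in> padic_matrices p m n" "ij \<in> ?I" for X ij
    using that unfolding padic_matrices_def by (rule PiE_mem)
  have le: "padic_max_abs p ?I x \<le> c \<longleftrightarrow> (\<forall>ij\<in>?I. padic_abs p (x ij) \<le> c)" for x c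
    unfolding padic_max_abs_def using fin ne by (subst Max_le_iff) auto
  have ge: "padic_abs p (x ij) \<le> padic_max_abs p ?I x" if "ij \<in> ?I" for x ij
    using le[of x "padic_max_abs p ?I x"] that by blast
  have nonneg: "0 \<le> padic_max_abs p ?I x" for x
    using ne ge[of _ x] padic_abs_nonneg by (meson ex_in_conv order_trans)
  have dist: "padic_matrix_dist p m n X Y =
      padic_max_abs p ?I (\<lambda>ij. X ij \<ominus>\<^bsub>padic_ring p\<^esub> Y ij)"
    if "X \<in> padic_matrices p m n" "Y \<in> padic_matrices p m n" for X Y
    using that unfolding padic_matrix_dist_def by (simp only: simp_thms if_True)
  show ?thesis
  proof
    fix X Y
    show "0 \<le> padic_matrix_dist p m n X Y"
      using nonneg unfolding padic_matrix_dist_def by (simp only: order_refl split: if_split) blast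
    show "padic_matrix_dist p m n X Y = padic_matrix_dist p m n Y X"
    proof (cases "X \<in> padic_matrices p m n \<and> Y \<in> padic_matrices p m n")
      case True
      then have X: "X \<in> padic_matrices p m n" and Y: "Y \<in> padic_matrices p m n" by blast+
      show ?thesis
        unfolding dist[OF X Y] dist[OF Y X] padic_max_abs_def
        by (intro arg_cong[where f = Max] image_cong refl
              padic_abs_minus_commute[OF p1 entry[OF X] entry[OF Y]])
    next
      case False
      then show ?thesis unfolding padic_matrix_dist_def by argo
    qed
  next
    fix X Y assume X: "X \<in> padic_matrices p m n" and Y: "Y \<in> padic_matrices p m n"
    have "padic_matrix_dist p m n X Y = 0 \<longleftrightarrow>
        padic_max_abs p ?I (\<lambda>ij. X ij \<ominus>\<^bsub>padic_ring p\<^esub> Y ij) \<le> 0"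
      unfolding dist[OF X Y] by (rule order_antisym_conv[OF nonneg, symmetric])
    also have "\<dots> \<longleftrightarrow> (\<forall>ij\<in>?I. padic_abs p (X ij \<ominus>\<^bsub>padic_ring p\<^esub> Y ij) = 0)"
      unfolding le by (intro ball_cong refl order_antisym_conv padic_abs_nonneg)
    also have "\<dots> \<longleftrightarrow> (\<forall>ij\<in>?I. X ij = Y ij)"
      by (intro ball_cong refl)
        (simp only: padic_abs_eq_0_iff[OF p1] r_right_minus_eq[OF entry[OF X] entry[OF Y]])
    also have "\<dots> \<longleftrightarrow> X = Y"
      using PiE_ext[OF X[unfolded padic_matrices_def] Y[unfolded padic_matrices_def]] by blast
    finally show "padic_matrix_dist p m n X Y = 0 \<longleftrightarrow> X = Y" .
  next
    fix X Y Z
    assume X: "X \<in> padic_matrices p m n" and Y: "Y \<in> padic_matrices p m n"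
      and Z: "Z \<in> padic_matrices p m n"
    have "padic_abs p (X ij \<ominus>\<^bsub>padic_ring p\<^esub> Z ij) \<le>
        padic_matrix_dist p m n X Y + padic_matrix_dist p m n Y Z" if ij: "ij \<in> ?I" for ij
    proof -
      let ?XY = "padic_abs p (X ij \<ominus>\<^bsub>padic_ring p\<^esub> Y ij)"
      let ?YZ = "padic_abs p (Y ij \<ominus>\<^bsub>padic_ring p\<^esub> Z ij)"
      have "padic_abs p (X ij \<ominus>\<^bsub>padic_ring p\<^esub> Z ij) \<le> max ?XY ?YZ"
        by (rule padic_abs_minus_ultrametric[OF p1 entry[OF X ij] entry[OF Y ij] entry[OF Z ij]])
      also have "\<dots> \<le> ?XY + ?YZ"
        by (rule max.boundedI) (simp_all only: le_add_same_cancel1 le_add_same_cancel2 padic_abs_nonneg)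
      also have "\<dots> \<le> padic_matrix_dist p m n X Y + padic_matrix_dist p m n Y Z"
        unfolding dist[OF X Y] dist[OF Y Z] by (intro add_mono ge ij)
      finally show ?thesis .
    qed
    then show "padic_matrix_dist p m n X Z \<le>
        padic_matrix_dist p m n X Y + padic_matrix_dist p m n Y Z"
      unfolding dist[OF X Z] le by blast
  qed
qed

lemma mspace_padic_matrix_metric:
  assumes "prime p" "0 < m" "0 < n"
  shows "mspace (padic_matrix_metric p m n) = padic_matrices p m n"
  unfolding padic_matrix_metric_def
  using Metric_space_padic_matrices[OF assms] by (rule Metric_space.mspace_metric)

lemma mdist_padic_matrix_metric:
  assumes "prime p" "0 < m" "0 < n"
  shows "mdist (padic_matrix_metric p m n) = padic_matrix_dist p m n"
  unfolding padic_matrix_metric_def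
  using Metric_space_padic_matrices[OF assms] by (rule Metric_space.mdist_metric)

definition padic_approximable ::
    "nat \<Rightarrow> nat \<Rightarrow> nat \<Rightarrow> (nat \<Rightarrow> real) \<Rightarrow> (nat \<times> nat \<Rightarrow> nat \<Rightarrow> int) set" where
  "padic_approximable p m n \<psi> =
     {X \<in> padic_matrices p m n.
        infinite {(a, q). a \<in> int_vectors n \<and> q \<in> int_vectors m \<and>
          padic_max_abs p {..<n}
            (\<lambda>j. padic_vec_mat_mult p m q X j \<oplus>\<^bsub>padic_ring p\<^esub> padic_of_int p (a j))
          < \<psi> (max (int_max_abs n a) (int_max_abs m q))}}"

section \<open>Hausdorff measures\<close>

definition dimension_function :: "(real \<Rightarrow> real) \<Rightarrow> bool" where
  "dimension_function f \<longleftrightarrow>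
     mono_on {0<..} f \<and> continuous_on {0<..} f \<and> (f \<longlongrightarrow> 0) (at_right 0)"

text \<open>
  Countable covers are indexed by an arbitrary set \<open>I\<close> of natural numbers, so finite covers are
  allowed. A radius belongs to the cover and is not read off from the ball as a set, because in an
  ultrametric space a ball does not determine its radius.
\<close>

definition hausdorff_premeasure ::
    "'a metric \<Rightarrow> (real \<Rightarrow> real) \<Rightarrow> real \<Rightarrow> 'a set \<Rightarrow> ennreal" where
  "hausdorff_premeasure M f \<rho> F =
     Inf {(\<Sum>\<^sub>\<infinity>i\<in>I. ennreal (f (r i))) | (I :: nat set) c r.
            (\<forall>i\<in>I. c i \<in> mspace M \<and> 0 < r i \<and> r i \<le> \<rho>) \<and>
            F \<subseteq> (\<Union>i\<in>I. mball_of M (c i) (r i))}"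

definition hausdorff_measure :: "'a metric \<Rightarrow> (real \<Rightarrow> real) \<Rightarrow> 'a set \<Rightarrow> ennreal" where
  "hausdorff_measure M f F = Lim (at_right 0) (\<lambda>\<rho>. hausdorff_premeasure M f \<rho> F)"

lemma hausdorff_premeasure_antimono:
  assumes "\<rho> \<le> \<rho>'"
  shows "hausdorff_premeasure M f \<rho>' F \<le> hausdorff_premeasure M f \<rho> F"
  unfolding hausdorff_premeasure_def
proof (rule Inf_superset_mono, rule subsetI, elim CollectE exE conjE)
  fix s and I :: "nat set" and c :: "nat \<Rightarrow> 'a" and r :: "nat \<Rightarrow> real"
  assume s: "s = (\<Sum>\<^sub>\<infinity>i\<in>I. ennreal (f (r i)))"
    and r: "\<forall>i\<in>I. c i \<in> mspace M \<and> 0 < r i \<and> r i \<le> \<rho>"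
    and F: "F \<subseteq> (\<Union>i\<in>I. mball_of M (c i) (r i))"
  from r assms have "\<forall>i\<in>I. c i \<in> mspace M \<and> 0 < r i \<and> r i \<le> \<rho>'"
    by (meson order_trans)
  with s F show "s \<in> {(\<Sum>\<^sub>\<infinity>i\<in>I. ennreal (f (r i))) | (I :: nat set) c r.
            (\<forall>i\<in>I. c i \<in> mspace M \<and> 0 < r i \<and> r i \<le> \<rho>') \<and>
            F \<subseteq> (\<Union>i\<in>I. mball_of M (c i) (r i))}"
    by (intro CollectI exI conjI)
qed

lemma hausdorff_premeasure_tendsto_SUP:
  "((\<lambda>\<rho>. hausdorff_premeasure M f \<rho> F) \<longlongrightarrow>
     (SUP \<rho>\<in>{0<..}. hausdorff_premeasure M f \<rho> F)) (at_right 0)"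
proof (rule order_tendstoI)
  fix a assume "a < (SUP \<rho>\<in>{0<..}. hausdorff_premeasure M f \<rho> F)"
  then obtain \<rho> where \<rho>: "0 < \<rho>" "a < hausdorff_premeasure M f \<rho> F"
    unfolding less_SUP_iff by blast
  show "\<forall>\<^sub>F \<rho> in at_right 0. a < hausdorff_premeasure M f \<rho> F"
    unfolding eventually_at_right_field
  proof (intro exI[of _ \<rho>] conjI allI impI)
    fix \<sigma> assume "\<sigma> < \<rho>"
    then have "hausdorff_premeasure M f \<rho> F \<le> hausdorff_premeasure M f \<sigma> F"
      by (intro hausdorff_premeasure_antimono less_imp_le)
    with \<rho>(2) show "a < hausdorff_premeasure M f \<sigma> F"
      by (rule less_le_trans)
  qed (rule \<rho>(1))
next
  fix a assume a: "(SUP \<rho>\<in>{0<..}. hausdorff_premeasure M f \<rho> F) < a"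
  show "\<forall>\<^sub>F \<rho> in at_right 0. hausdorff_premeasure M f \<rho> F < a"
    unfolding eventually_at_right_field
  proof (intro exI[of _ 1] conjI allI impI)
    fix \<sigma> :: real assume "0 < \<sigma>"
    then have "hausdorff_premeasure M f \<sigma> F \<le> (SUP \<rho>\<in>{0<..}. hausdorff_premeasure M f \<rho> F)"
      by (intro SUP_upper) (simp only: greaterThan_iff)
    then show "hausdorff_premeasure M f \<sigma> F < a"
      using a by (rule le_less_trans)
  qed (rule zero_less_one)
qed

lemma hausdorff_measure_eq_SUP:
  "hausdorff_measure M f F = (SUP \<rho>\<in>{0<..}. hausdorff_premeasure M f \<rho> F)"
  unfolding hausdorff_measure_def
  by (rule tendsto_Lim[OF trivial_limit_at_right_real hausdorff_premeasure_tendsto_SUP])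

end

theory Submission
  imports Defs "HOL-Number_Theory.Cong"
begin

text \<open>
  Put \<open>g r = f r / r ^ ((m - 1) * n)\<close>. By monotonicity the series converges if and only if
  \<open>\<Sum>t. 16 ^ (t * (m + n)) * g (\<psi> (16 ^ t))\<close> does.

  Convergence: dividing \<open>(q, a)\<close> by the largest power \<open>p ^ k\<close> dividing \<open>q\<close> (it also divides \<open>a\<close>, since
  \<open>\<psi> r = o(1 / r)\<close>), the neighbourhood of the resonant subspace \<open>q X + a = 0\<close> is covered by about
  \<open>1 / \<delta> ^ ((m - 1) * n)\<close> balls of radius \<open>\<delta> = p ^ k * \<psi> r\<close>. These covers cost as much as the tails of the series.

  Divergence: thicken each neighbourhood, of width \<open>\<psi>\<close>, to width \<open>\<Theta>\<close> with \<open>\<Theta> ^ n = g \<psi> / K\<close>. The thick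
  neighbourhoods are quasi-independent on average, so by a second moment argument they cover a fixed
  proportion of every ball, for every constant \<open>K\<close>. Pushing Haar measure on a thick neighbourhood
  onto the thin one inside it produces a mass that is at most \<open>f r / K\<close> on every ball of radius \<open>r\<close>
  below the scale \<open>\<Theta>\<close>, and comparable to Haar measure above it. Iterating, and spreading the mass
  uniformly between two steps until \<open>f r / r ^ (m * n)\<close> has absorbed the constants, gives masses on
  nested compact sets inside the approximable matrices that are bounded by \<open>\<epsilon> * f r\<close> on balls of radius \<open>r\<close>,
  for any \<open>\<epsilon> > 0\<close>.
\<close>

section \<open>Residue boxes and strips\<close>

text \<open>Why these widths: mass of density \<open>(\<Theta> / \<psi>) ^ n\<close> on the thin
  strip gives a ball of radius \<open>r\<close> between \<open>\<psi>\<close> and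
  \<open>\<Theta>\<close> about \<open>r ^ ((m - 1) * n) * \<Theta> ^ n\<close>, that is
  \<open>r ^ ((m - 1) * n) * g \<psi> / K\<close>, which is at most \<open>f r / K\<close> because
  \<open>g\<close> increases. Below \<open>\<psi>\<close> the mass of a ball is proportional to
  \<open>r ^ (m * n)\<close>, and the bound survives because \<open>f r / r ^ (m * n)\<close>
  decreases. At \<open>r = \<psi>\<close> there is no room left, so the divergent series is exactly
  what allows strips of width \<open>\<Theta>\<close> to cover, and the covered proportion must not
  depend on \<open>K\<close>. The obstacle to that covering is a pair \<open>q\<close>,
  \<open>q'\<close> that is nearly proportional modulo a power of \<open>p\<close>: the strips are
  then far from independent, and only an average over \<open>a\<close>, \<open>a'\<close> repairs
  this. No Haar measure and no limit measure is formed. Balls of radius \<open>p ^ -l\<close> are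
  residue matrices modulo \<open>p ^ l\<close>, measures are cardinalities or weights on them, and
  compactness reduces a cover to finitely many balls, so that a weight on one finite level is
  enough.\<close>

lemma dvd_diff_eq_iff:
  fixes a b c :: int
  assumes "c dvd a - b"
  shows "c dvd a \<longleftrightarrow> c dvd b"
proof -
  have "a = b + (a - b)" by simp
  then show ?thesis using assms by (metis dvd_add_left_iff)
qed

text \<open>Fubini for counting. It is applied with all coordinates fixed except one whose
  coefficient is a unit modulo \<open>p\<close>, possibly times a known power of \<open>p\<close>,
  so that a linear congruence leaves at most one residue class for it.\<close>

lemma card_PiE_fibre:
  fixes S :: "'b set"
  assumes "finite J" "i \<notin> J" "finite S"
  shows "card {x \<in> insert i J \<rightarrow>\<^sub>E S. Q x} = (\<Sum>x\<in>J \<rightarrow>\<^sub>E S. card {v \<in> S. Q (x(i := v))})"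
proof -
  let ?h = "\<lambda>(x, v). x(i := v)"
  let ?A = "SIGMA x:(J \<rightarrow>\<^sub>E S). {v \<in> S. Q (x(i := v))}"
  have inj: "inj_on ?h ?A"
  proof (rule inj_onI)
    fix xv yw assume *: "xv \<in> ?A" "yw \<in> ?A" "?h xv = ?h yw"
    obtain x v y w where xv: "xv = (x, v)" "yw = (y, w)" by fastforce
    have x: "x \<in> J \<rightarrow>\<^sub>E S" using *(1) unfolding xv by (rule SigmaD1)
    have y: "y \<in> J \<rightarrow>\<^sub>E S" using *(2) unfolding xv by (rule SigmaD1)
    have eq: "x(i := v) = y(i := w)" using *(3) unfolding xv by (simp only: prod.case)
    have "v = w" using eq by (metis fun_upd_same)
    moreover have "x k = y k" for k
    proof (cases "k = i")
      case True
      then show ?thesis using PiE_arb[OF x] PiE_arb[OF y] assms(2) by simp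
    next
      case False
      then show ?thesis using eq by (metis fun_upd_other)
    qed
    ultimately show "xv = yw" unfolding xv by (metis ext)
  qed
  have img: "?h ` ?A = {x \<in> insert i J \<rightarrow>\<^sub>E S. Q x}"
  proof
    show "?h ` ?A \<subseteq> {x \<in> insert i J \<rightarrow>\<^sub>E S. Q x}"
    proof (rule image_subsetI)
      fix xv assume *: "xv \<in> ?A"
      obtain x v where xv: "xv = (x, v)" by fastforce
      have "x \<in> J \<rightarrow>\<^sub>E S" "v \<in> S" "Q (x(i := v))"
        using * unfolding xv by (blast dest: SigmaD1 SigmaD2)+
      then show "?h xv \<in> {x \<in> insert i J \<rightarrow>\<^sub>E S. Q x}"
        unfolding xv prod.case by (intro CollectI conjI PiE_fun_upd)
    qed
    show "{x \<in> insert i J \<rightarrow>\<^sub>E S. Q x} \<subseteq> ?h ` ?A"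
    proof
      fix x assume x: "x \<in> {x \<in> insert i J \<rightarrow>\<^sub>E S. Q x}"
      have "(x(i := undefined), x i) \<in> ?A"
        using x assms(2) by (auto simp: PiE_iff extensional_def)
      moreover have "x = ?h (x(i := undefined), x i)" by simp
      ultimately show "x \<in> ?h ` ?A" by (rule rev_image_eqI)
    qed
  qed
  have "card {x \<in> insert i J \<rightarrow>\<^sub>E S. Q x} = card ?A"
    using card_image[OF inj] img by simp
  also have "\<dots> = (\<Sum>x\<in>J \<rightarrow>\<^sub>E S. card {v \<in> S. Q (x(i := v))})"
    using assms by (intro card_SigmaI finite_PiE) auto
  finally show ?thesis .
qed

text \<open>Strip conditions constrain the columns of a matrix separately, so counts over matrices
  are products over columns. The restriction to \<open>I\<close> makes a column an extensional
  function, the form in which the factors count it.\<close>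

lemma card_PiE_columns:
  assumes "finite I" "finite J" "finite S"
  shows "card {x \<in> I \<times> J \<rightarrow>\<^sub>E S. \<forall>j\<in>J. Q j (\<lambda>i\<in>I. x (i, j))} =
    (\<Prod>j\<in>J. card {y \<in> I \<rightarrow>\<^sub>E S. Q j y})"
proof -
  let ?h = "\<lambda>x. \<lambda>j\<in>J. \<lambda>i\<in>I. x (i, j)"
  let ?A = "{x \<in> I \<times> J \<rightarrow>\<^sub>E S. \<forall>j\<in>J. Q j (\<lambda>i\<in>I. x (i, j))}"
  have "bij_betw ?h ?A (PiE J (\<lambda>j. {y \<in> I \<rightarrow>\<^sub>E S. Q j y}))"
  proof (rule bij_betwI[where g = "\<lambda>y. \<lambda>(i,j)\<in>I\<times>J. y j i"])
    show "?h \<in> ?A \<rightarrow> PiE J (\<lambda>j. {y \<in> I \<rightarrow>\<^sub>E S. Q j y})"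
    proof (rule Pi_I)
      fix x assume "x \<in> ?A"
      then show "?h x \<in> PiE J (\<lambda>j. {y \<in> I \<rightarrow>\<^sub>E S. Q j y})"
        by (intro PiE_I) (simp_all add: PiE_iff)
    qed
    show "(\<lambda>y. \<lambda>(i,j)\<in>I\<times>J. y j i) \<in> PiE J (\<lambda>j. {y \<in> I \<rightarrow>\<^sub>E S. Q j y}) \<rightarrow> ?A"
    proof (rule Pi_I)
      fix y assume y: "y \<in> PiE J (\<lambda>j. {y \<in> I \<rightarrow>\<^sub>E S. Q j y})"
      have "(\<lambda>i\<in>I. (\<lambda>(i,j)\<in>I\<times>J. y j i) (i, j)) = y j" if "j \<in> J" for j
      proof
        fix i
        have "y j \<in> I \<rightarrow>\<^sub>E S" using y that by (auto dest: PiE_mem)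
        then show "(\<lambda>i\<in>I. (\<lambda>(i,j)\<in>I\<times>J. y j i) (i, j)) i = y j i"
          using that PiE_arb[OF \<open>y j \<in> I \<rightarrow>\<^sub>E S\<close>] by (cases "i \<in> I") auto
      qed
      moreover have "(\<lambda>(i,j)\<in>I\<times>J. y j i) \<in> I \<times> J \<rightarrow>\<^sub>E S"
      proof (rule PiE_I)
        fix ij assume ij: "ij \<in> I \<times> J"
        then have "y (snd ij) \<in> I \<rightarrow>\<^sub>E S" using y by (auto dest: PiE_mem)
        then show "(\<lambda>(i,j)\<in>I\<times>J. y j i) ij \<in> S" using ij by (auto dest: PiE_mem)
      qed simp
      moreover have "Q j (y j)" if "j \<in> J" for j
        using y that by (auto dest: PiE_mem)
      ultimately show "(\<lambda>(i,j)\<in>I\<times>J. y j i) \<in> ?A" by auto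
    qed
    show "(\<lambda>(i,j)\<in>I\<times>J. ?h x j i) = x" if "x \<in> ?A" for x
      proof (rule ext)
      fix ij show "(\<lambda>(i,j)\<in>I\<times>J. ?h x j i) ij = x ij"
        using that PiE_arb[of x "I \<times> J" "\<lambda>_. S" ij] by (cases "ij \<in> I \<times> J") auto
    qed
    show "?h (\<lambda>(i,j)\<in>I\<times>J. y j i) = y" if "y \<in> PiE J (\<lambda>j. {y \<in> I \<rightarrow>\<^sub>E S. Q j y})" for y
    proof
      fix j
      show "?h (\<lambda>(i,j)\<in>I\<times>J. y j i) j = y j"
      proof (cases "j \<in> J")
        case True
        then have "y j \<in> I \<rightarrow>\<^sub>E S" using that by (auto dest: PiE_mem)
        show ?thesis
        proof (rule ext)
          fix i show "?h (\<lambda>(i,j)\<in>I\<times>J. y j i) j i = y j i"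
            using True PiE_arb[OF \<open>y j \<in> I \<rightarrow>\<^sub>E S\<close>] by (cases "i \<in> I") simp_all
        qed
      next
        case False
        then show ?thesis using PiE_arb[OF that] by simp
      qed
    qed
  qed
  then have "card ?A = card (PiE J (\<lambda>j. {y \<in> I \<rightarrow>\<^sub>E S. Q j y}))"
    by (rule bij_betw_same_card)
  then show ?thesis
    using assms by (simp add: card_PiE)
qed

lemma card_residue_class:
  assumes "0 < p" "e \<le> L"
  shows "card {v \<in> {0..<int p ^ L}. v mod int p ^ e = c mod int p ^ e} = p ^ (L - e)"
proof -
  let ?P = "int p ^ e"
  have P: "0 < ?P" using assms by simp
  have split: "int p ^ L = ?P * int p ^ (L - e)"
    using assms by (simp add: power_add[symmetric])
  have "bij_betw (\<lambda>k. c mod ?P + ?P * k) {0..<int p ^ (L - e)}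
    {v \<in> {0..<int p ^ L}. v mod ?P = c mod ?P}"
  proof (rule bij_betwI[where g = "\<lambda>v. v div ?P"])
    show "(\<lambda>k. c mod ?P + ?P * k) \<in> {0..<int p ^ (L - e)} \<rightarrow> {v \<in> {0..<int p ^ L}. v mod ?P = c mod ?P}"
    proof (rule Pi_I)
      fix k assume k: "k \<in> {0..<int p ^ (L - e)}"
      have c: "0 \<le> c mod ?P" "c mod ?P < ?P" using P by auto
      have "?P * k + ?P \<le> ?P * int p ^ (L - e)"
        using k P by (metis atLeastLessThan_iff distrib_left mult.right_neutral mult_le_cancel_left_pos zless_imp_add1_zle)
      moreover have "0 \<le> ?P * k" using k P by simp
      ultimately show "c mod ?P + ?P * k \<in> {v \<in> {0..<int p ^ L}. v mod ?P = c mod ?P}"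
        using c unfolding split by simp
    qed
    show "(\<lambda>v. v div ?P) \<in> {v \<in> {0..<int p ^ L}. v mod ?P = c mod ?P} \<rightarrow> {0..<int p ^ (L - e)}"
    proof (rule Pi_I)
      fix v assume v: "v \<in> {v \<in> {0..<int p ^ L}. v mod ?P = c mod ?P}"
      have "?P * (v div ?P) \<le> v" using P by (metis minus_mod_eq_mult_div pos_mod_sign diff_le_eq le_add_same_cancel1)
      also have "v < ?P * int p ^ (L - e)" using v split by simp
      finally have "v div ?P < int p ^ (L - e)" using P by (simp only: mult_less_cancel_left_pos)
      moreover have "0 \<le> v div ?P" using v P by (simp only: pos_imp_zdiv_nonneg_iff) simp
      ultimately show "v div ?P \<in> {0..<int p ^ (L - e)}" by (simp only: atLeastLessThan_iff)
    qed
    show "(c mod ?P + ?P * k) div ?P = k" for k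
      using P by simp
    show "c mod ?P + ?P * (v div ?P) = v" if "v \<in> {v \<in> {0..<int p ^ L}. v mod ?P = c mod ?P}" for v
      using that by (metis (mono_tags, lifting) mem_Collect_eq mod_mult_div_eq)
  qed
  then have "card {v \<in> {0..<int p ^ L}. v mod ?P = c mod ?P} = card {0..<int p ^ (L - e)}"
    by (rule bij_betw_same_card[symmetric])
  then show ?thesis by (simp add: nat_power_eq)
qed

lemma card_residue_class_le:
  assumes "0 < p" "e \<le> L" "A \<subseteq> {0..<int p ^ L}"
    and "\<And>u v. u \<in> A \<Longrightarrow> v \<in> A \<Longrightarrow> int p ^ e dvd u - v"
  shows "card A \<le> p ^ (L - e)"
proof (cases "A = {}")
  case False
  then obtain c where "c \<in> A" by auto
  then have "A \<subseteq> {v \<in> {0..<int p ^ L}. v mod int p ^ e = c mod int p ^ e}"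
    using assms(3,4) by (auto simp: mod_eq_dvd_iff)
  then have "card A \<le> card {v \<in> {0..<int p ^ L}. v mod int p ^ e = c mod int p ^ e}"
    by (intro card_mono finite_subset[OF _ finite_atLeastLessThan_int[of 0 "int p ^ L"]]) auto
  then show ?thesis using card_residue_class[OF assms(1,2)] by simp
qed simp

locale padic_grid =
  fixes p m n :: nat
  assumes prime: "prime p" and m0: "0 < m" and n0: "0 < n"
begin

definition idx :: "(nat \<times> nat) set" where "idx = {..<m} \<times> {..<n}"

text \<open>An element is a matrix of residues modulo \<open>p ^ l\<close>, that is, a ball of
  radius \<open>p ^ -l\<close> in the space of p-adic matrices; \<open>red\<close> passes to the
  larger ball around it. The Haar measure of a union of such balls is their number divided by
  \<open>card (Box l)\<close>.\<close>

definition Box :: "nat \<Rightarrow> (nat \<times> nat \<Rightarrow> int) set" where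
  "Box l = idx \<rightarrow>\<^sub>E {0..<int p ^ l}"

definition red :: "nat \<Rightarrow> (nat \<times> nat \<Rightarrow> int) \<Rightarrow> nat \<times> nat \<Rightarrow> int" where
  "red l x = (\<lambda>ij\<in>idx. x ij mod int p ^ l)"

text \<open>When \<open>x\<close> represents a ball of level at least \<open>\<theta>\<close>, this
  is the inequality \<open>|q x + a|_p \<le> p ^ -\<theta>\<close> on that ball; by
  \<open>strip_cong\<close> the representative does not matter.\<close>

definition strip :: "nat \<Rightarrow> (nat \<Rightarrow> int) \<Rightarrow> (nat \<Rightarrow> int) \<Rightarrow> (nat \<times> nat \<Rightarrow> int) \<Rightarrow> bool" where
  "strip \<theta> q a x \<longleftrightarrow> (\<forall>j<n. int p ^ \<theta> dvd (\<Sum>i<m. q i * x (i, j)) + a j)"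

lemma p1: "1 < p" and p0: "0 < p" and P1: "1 < real p" and P0: "0 < real p"
  using prime_gt_1_nat[OF prime] by simp_all

lemma finite_idx [simp]: "finite idx" and card_idx: "card idx = m * n"
  by (auto simp: idx_def)

lemma finite_Box [simp]: "finite (Box l)"
  unfolding Box_def by (intro finite_PiE) auto

lemma card_Box: "card (Box l) = p ^ (l * (m * n))"
  unfolding Box_def by (simp add: card_PiE card_idx power_mult nat_power_eq)

lemma red_Box [simp]: "red l x \<in> Box l"
  unfolding Box_def red_def by (intro restrict_PiE_iff[THEN iffD2] ballI) (simp add: p0)

lemma Box_mod: "x \<in> Box l \<Longrightarrow> ij \<in> idx \<Longrightarrow> x ij mod int p ^ l = x ij"
  unfolding Box_def using PiE_mem[of x idx "\<lambda>_. {0..<int p ^ l}" ij] by simp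

lemma Box_arb: "x \<in> Box l \<Longrightarrow> ij \<notin> idx \<Longrightarrow> x ij = undefined"
  unfolding Box_def by (rule PiE_arb)

lemma red_id:
  assumes "x \<in> Box l"
  shows "red l x = x"
proof (rule ext)
  fix ij show "red l x ij = x ij"
    unfolding red_def using Box_mod[OF assms] Box_arb[OF assms] by (cases "ij \<in> idx") simp_all
qed

lemma red_red: "l \<le> k \<Longrightarrow> red l (red k x) = red l x"
  unfolding red_def by (auto simp: fun_eq_iff mod_mod_cancel le_imp_power_dvd)

lemma red_eq_iff: "red l x = red l y \<longleftrightarrow> (\<forall>ij\<in>idx. int p ^ l dvd x ij - y ij)"
  unfolding red_def by (auto simp: fun_eq_iff restrict_def mod_eq_dvd_iff)

lemma red_mono: "l \<le> k \<Longrightarrow> red k x = red k y \<Longrightarrow> red l x = red l y"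
  using red_red[of l k x] red_red[of l k y] by simp

lemma strip_cong:
  assumes "red \<theta> x = red \<theta> y"
  shows "strip \<theta> q a x \<longleftrightarrow> strip \<theta> q a y"
proof -
  have "int p ^ \<theta> dvd (\<Sum>i<m. q i * x (i, j)) + a j \<longleftrightarrow> int p ^ \<theta> dvd (\<Sum>i<m. q i * y (i, j)) + a j"
    if j: "j < n" for j
  proof -
    have "int p ^ \<theta> dvd (\<Sum>i<m. q i * (x (i, j) - y (i, j)))"
      using assms j unfolding red_eq_iff idx_def by (intro dvd_sum dvd_mult) auto
    also have "(\<Sum>i<m. q i * (x (i, j) - y (i, j))) =
        ((\<Sum>i<m. q i * x (i, j)) + a j) - ((\<Sum>i<m. q i * y (i, j)) + a j)"
      by (simp add: sum_subtractf right_diff_distrib)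
    finally have D: "int p ^ \<theta> dvd ((\<Sum>i<m. q i * x (i, j)) + a j) - ((\<Sum>i<m. q i * y (i, j)) + a j)" .
    show ?thesis using D by (rule dvd_diff_eq_iff)
  qed
  then show ?thesis unfolding strip_def by blast
qed

lemma strip_red: "\<theta> \<le> l \<Longrightarrow> strip \<theta> q a (red l x) \<longleftrightarrow> strip \<theta> q a x"
  by (rule strip_cong) (rule red_red)

lemma strip_antimono:
  assumes "strip \<sigma> q a x" "\<theta> \<le> \<sigma>"
  shows "strip \<theta> q a x"
  using assms(1) dvd_trans[OF le_imp_power_dvd[OF assms(2), of "int p"]] unfolding strip_def by blast

lemma card_red_fibre:
  assumes "l \<le> L" "E \<in> Box l"
  shows "card {y \<in> Box L. red l y = E} = p ^ ((L - l) * (m * n))"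
proof -
  have "{y \<in> Box L. red l y = E} = PiE idx (\<lambda>ij. {v \<in> {0..<int p ^ L}. v mod int p ^ l = E ij mod int p ^ l})"
  proof -
    note Box_mod[OF assms(2)] Box_arb[OF assms(2)]
    then have "red l y = E \<longleftrightarrow> (\<forall>ij\<in>idx. y ij mod int p ^ l = E ij mod int p ^ l)" for y
      unfolding red_def fun_eq_iff restrict_def by metis
    then show ?thesis
      unfolding Box_def by (auto simp: PiE_iff extensional_def)
  qed
  also have "card \<dots> = (\<Prod>ij\<in>idx. p ^ (L - l))"
    using card_residue_class[OF p0 assms(1)] by (simp add: card_PiE)
  finally show ?thesis by (simp add: card_idx power_mult)
qed

lemma coprime_ppow:
  assumes "\<not> int p dvd c"
  shows "coprime (int p ^ k) c"
proof -
  have "prime (int p)" using prime by simp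
  then have "coprime (int p) c" using assms by (rule prime_imp_coprime)
  then show ?thesis by simp
qed

lemma lessThan_m: "{..<m} = insert 0 {1..<m}"
  using m0 by auto

text \<open>The coordinates other than 0 are free in their classes modulo \<open>p ^ l\<close>.
  Since \<open>q 0\<close> is prime to \<open>p\<close>, they determine \<open>y 0\<close> modulo
  \<open>p ^ \<sigma>\<close>, and this value agrees with \<open>e 0\<close> modulo
  \<open>p ^ l\<close> automatically, because the centre \<open>e\<close> already solves the
  congruence modulo \<open>p ^ l\<close>.\<close>

lemma column_count:
  assumes q0: "\<not> int p dvd q 0" and le: "l \<le> \<sigma>" "\<sigma> \<le> L"
    and e: "int p ^ l dvd (\<Sum>i<m. q i * e i) + c"
  shows "card {y \<in> {..<m} \<rightarrow>\<^sub>E {0..<int p ^ L}.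
      (\<forall>i<m. int p ^ l dvd y i - e i) \<and> int p ^ \<sigma> dvd (\<Sum>i<m. q i * y i) + c}
    = p ^ ((L - l) * (m - 1) + (L - \<sigma>))"
proof -
  let ?S = "{0..<int p ^ L}"
  define Q where "Q = (\<lambda>y. (\<forall>i<m. int p ^ l dvd y i - e i) \<and> int p ^ \<sigma> dvd (\<Sum>i<m. q i * y i) + c)"
  have sum_split: "(\<Sum>i<m. h i) = h 0 + (\<Sum>i\<in>{1..<m}. h i)" for h :: "nat \<Rightarrow> int"
    unfolding lessThan_m by simp
  obtain r where "[q 0 * r = 1] (mod int p ^ \<sigma>)"
    using cong_solve_coprime_int[of "q 0" "int p ^ \<sigma>"] coprime_ppow[OF q0] by (auto simp: coprime_commute)
  then have r: "int p ^ \<sigma> dvd q 0 * r - 1" by (simp add: cong_iff_dvd_diff)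
  have "card {y \<in> insert 0 {1..<m} \<rightarrow>\<^sub>E ?S. Q y} = (\<Sum>y\<in>{1..<m} \<rightarrow>\<^sub>E ?S. card {v \<in> ?S. Q (y(0 := v))})"
    by (rule card_PiE_fibre) auto
  also have "\<dots> = (\<Sum>y\<in>{1..<m} \<rightarrow>\<^sub>E ?S. if \<forall>i\<in>{1..<m}. int p ^ l dvd y i - e i then p ^ (L - \<sigma>) else 0)"
  proof (rule sum.cong[OF refl])
    fix y assume y: "y \<in> {1..<m} \<rightarrow>\<^sub>E ?S"
    show "card {v \<in> ?S. Q (y(0 := v))} = (if \<forall>i\<in>{1..<m}. int p ^ l dvd y i - e i then p ^ (L - \<sigma>) else 0)"
    proof (cases "\<forall>i\<in>{1..<m}. int p ^ l dvd y i - e i")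
      case False
      then obtain i where i: "i \<in> {1..<m}" "\<not> int p ^ l dvd y i - e i" by blast
      then have "\<not> Q (y(0 := v))" for v
        unfolding Q_def by (metis atLeastLessThan_iff fun_upd_other not_one_le_zero)
      then have "{v \<in> ?S. Q (y(0 := v))} = {}" by blast
      then show ?thesis using False by (metis card.empty)
    next
      case True
      define b where "b = (\<Sum>i\<in>{1..<m}. q i * y i) + c"
      have Qv: "Q (y(0 := v)) \<longleftrightarrow> v mod int p ^ \<sigma> = (- r * b) mod int p ^ \<sigma>" for v
      proof -
        have s: "(\<Sum>i<m. q i * (y(0 := v)) i) + c = q 0 * v + b"
          unfolding sum_split b_def by simp
        have 1: "int p ^ \<sigma> dvd q 0 * v + b \<longleftrightarrow> v mod int p ^ \<sigma> = (- r * b) mod int p ^ \<sigma>"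
        proof -
          have "int p ^ \<sigma> dvd q 0 * v + b \<longleftrightarrow> int p ^ \<sigma> dvd q 0 * (v + r * b)"
          proof -
            have "q 0 * v + b = q 0 * (v + r * b) - (q 0 * r - 1) * b" by (simp add: algebra_simps)
            then show ?thesis using r by (simp add: dvd_diff_left_iff)
          qed
          also have "\<dots> \<longleftrightarrow> int p ^ \<sigma> dvd v + r * b"
            using coprime_ppow[OF q0] by (simp add: coprime_dvd_mult_right_iff)
          finally show ?thesis by (simp add: mod_eq_dvd_iff)
        qed
        have 2: "int p ^ l dvd v - e 0" if "int p ^ \<sigma> dvd q 0 * v + b"
        proof -
          have "int p ^ l dvd q 0 * v + b" using that le(1) by (meson dvd_trans le_imp_power_dvd)
          moreover have "int p ^ l dvd (\<Sum>i\<in>{1..<m}. q i * (y i - e i))"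
            using True by (intro dvd_sum dvd_mult) auto
          then have "int p ^ l dvd (\<Sum>i\<in>{1..<m}. q i * y i) - (\<Sum>i\<in>{1..<m}. q i * e i)"
            by (simp add: sum_subtractf right_diff_distrib)
          ultimately have "int p ^ l dvd (q 0 * v + b) - ((\<Sum>i<m. q i * e i) + c)
              - ((\<Sum>i\<in>{1..<m}. q i * y i) - (\<Sum>i\<in>{1..<m}. q i * e i))"
            using e dvd_diff by blast
          also have "(q 0 * v + b) - ((\<Sum>i<m. q i * e i) + c)
              - ((\<Sum>i\<in>{1..<m}. q i * y i) - (\<Sum>i\<in>{1..<m}. q i * e i)) = q 0 * (v - e 0)"
            unfolding sum_split b_def by (simp add: algebra_simps)
          finally show ?thesis
            using coprime_ppow[OF q0] by (simp add: coprime_dvd_mult_right_iff)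
        qed
        show ?thesis unfolding Q_def s using 1 2 True
          by (auto simp: le_Suc_eq)
      qed
      show ?thesis using True unfolding Qv using card_residue_class[OF p0 le(2)] by simp
    qed
  qed
  also have "\<dots> = p ^ (L - \<sigma>) * card {y \<in> {1..<m} \<rightarrow>\<^sub>E ?S. \<forall>i\<in>{1..<m}. int p ^ l dvd y i - e i}"
    by (subst sum.If_cases) (auto simp: finite_PiE Int_def)
  also have "{y \<in> {1..<m} \<rightarrow>\<^sub>E ?S. \<forall>i\<in>{1..<m}. int p ^ l dvd y i - e i}
      = PiE {1..<m} (\<lambda>i. {v \<in> ?S. v mod int p ^ l = e i mod int p ^ l})"
    by (auto simp: PiE_iff mod_eq_dvd_iff extensional_def)
  also have "card \<dots> = p ^ ((L - l) * (m - 1))"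
    using card_residue_class[OF p0, of l L] le by (simp add: card_PiE power_mult)
  finally have "card {y \<in> {..<m} \<rightarrow>\<^sub>E ?S. Q y} = p ^ (L - \<sigma>) * p ^ ((L - l) * (m - 1))"
    unfolding lessThan_m[symmetric] .
  then show ?thesis
    unfolding Q_def power_add by (simp only: mult.commute)
qed

lemma strip_count:
  assumes q0: "\<not> int p dvd q 0" and le: "l \<le> \<sigma>" "\<sigma> \<le> L" and E: "E \<in> Box l" "strip l q a E"
  shows "card {y \<in> Box L. red l y = E \<and> strip \<sigma> q a y} = p ^ (((L - l) * (m - 1) + (L - \<sigma>)) * n)"
proof -
  let ?S = "{0..<int p ^ L}"
  let ?Q = "\<lambda>j y. (\<forall>i<m. int p ^ l dvd y i - E (i, j)) \<and> int p ^ \<sigma> dvd (\<Sum>i<m. q i * y i) + a j"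
  have E': "red l y = E \<longleftrightarrow> (\<forall>ij\<in>idx. int p ^ l dvd y ij - E ij)" for y
    using red_eq_iff[of l y E] red_id[OF E(1)] by simp
  have eq: "{y \<in> Box L. red l y = E \<and> strip \<sigma> q a y}
      = {x \<in> {..<m} \<times> {..<n} \<rightarrow>\<^sub>E ?S. \<forall>j\<in>{..<n}. ?Q j (\<lambda>i\<in>{..<m}. x (i, j))}"
    unfolding E' Box_def strip_def idx_def by (rule Collect_cong) auto
  have 1: "card {y \<in> Box L. red l y = E \<and> strip \<sigma> q a y}
      = (\<Prod>j\<in>{..<n}. card {y \<in> {..<m} \<rightarrow>\<^sub>E ?S. ?Q j y})"
    unfolding eq by (rule card_PiE_columns) auto
  have 2: "(\<Prod>j\<in>{..<n}. card {y \<in> {..<m} \<rightarrow>\<^sub>E ?S. ?Q j y})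
      = (\<Prod>j\<in>{..<n}. p ^ ((L - l) * (m - 1) + (L - \<sigma>)))"
  proof (rule prod.cong[OF refl])
    fix j assume "j \<in> {..<n}"
    then have "j < n" by simp
    with E(2) have "int p ^ l dvd (\<Sum>i<m. q i * E (i, j)) + a j"
      unfolding strip_def by (elim allE impE)
    then show "card {y \<in> {..<m} \<rightarrow>\<^sub>E ?S. ?Q j y} = p ^ ((L - l) * (m - 1) + (L - \<sigma>))"
      by (rule column_count[where q = q and c = "a j" and e = "\<lambda>i. E (i, j)", OF q0 le])
  qed
  have 3: "(\<Prod>j\<in>{..<n}. p ^ k) = p ^ (k * n)" for k
    by (simp add: power_mult)
  show ?thesis by (rule trans[OF 1 trans[OF 2 3]])
qed

end

section \<open>Counting pairs with small determinants\<close>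

lemma card_le_fibres:
  assumes "finite S" and "\<And>v. v \<in> f ` S \<Longrightarrow> card {x \<in> S. f x = v} \<le> K"
  shows "card S \<le> card (f ` S) * K"
proof -
  have "S = (\<Union>v\<in>f ` S. {x \<in> S. f x = v})" by blast
  then have "card S \<le> (\<Sum>v\<in>f ` S. card {x \<in> S. f x = v})"
    using card_UN_le[of "f ` S" "\<lambda>v. {x \<in> S. f x = v}"] assms(1) by simp
  also have "\<dots> \<le> of_nat (card (f ` S)) * K"
    using assms(2) by (rule sum_bounded_above)
  finally show ?thesis by simp
qed

lemma card_congruent_le:
  fixes A :: "int set"
  assumes "0 < e" and A: "A \<subseteq> {1..int R}"
    and cong: "\<And>a c. a \<in> A \<Longrightarrow> c \<in> A \<Longrightarrow> e dvd a - c"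
  shows "real (card A) \<le> real R / real_of_int e + 1"
proof -
  have "inj_on (\<lambda>a. a div e) A"
  proof (rule inj_onI)
    fix a c assume ac: "a \<in> A" "c \<in> A" "a div e = c div e"
    then have "a mod e = c mod e" using cong by (simp add: mod_eq_dvd_iff)
    then show "a = c" using ac(3) by (metis div_mult_mod_eq)
  qed
  then have "card A = card ((\<lambda>a. a div e) ` A)" by (simp add: card_image)
  also have "\<dots> \<le> card {0..int R div e}"
  proof (rule card_mono)
    show "(\<lambda>a. a div e) ` A \<subseteq> {0..int R div e}"
    proof (rule image_subsetI)
      fix a assume "a \<in> A"
      then have "1 \<le> a" "a \<le> int R" using A by auto
      then show "a div e \<in> {0..int R div e}"
        using assms(1) by (simp add: zdiv_mono1 pos_imp_zdiv_nonneg_iff)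
    qed
  qed simp
  finally have "card A \<le> card {0..int R div e}" .
  then have "real (card A) \<le> real_of_int (int R div e) + 1"
  proof -
    have "0 \<le> int R div e" using assms(1) by (simp add: pos_imp_zdiv_nonneg_iff)
    then have "card {0..int R div e} = nat (int R div e) + 1" by (simp add: nat_add_distrib)
    then show ?thesis using \<open>card A \<le> card {0..int R div e}\<close> \<open>0 \<le> int R div e\<close> by linarith
  qed
  moreover have "real_of_int (int R div e) \<le> real R / real_of_int e"
    using real_of_int_div4[of "int R" e] by simp
  ultimately show ?thesis by linarith
qed

lemma card_multiples_le:
  assumes "0 < d"
  shows "real (card {b \<in> {1..int R}. int d dvd b}) \<le> real R / real d"
proof -
  have "{b \<in> {1..int R}. int d dvd b} \<subseteq> (\<lambda>k. int d * k) ` {1..int (R div d)}"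
  proof
    fix b assume b: "b \<in> {b \<in> {1..int R}. int d dvd b}"
    then obtain k where k: "b = int d * k" by auto
    have "1 \<le> k" using b k assms by (simp add: int_one_le_iff_zero_less zero_less_mult_iff)
    moreover have "k \<le> int (R div d)"
    proof -
      have "k = b div int d" using k assms by simp
      also have "\<dots> \<le> int R div int d" using b assms by (simp add: zdiv_mono1)
      finally show ?thesis by (simp add: zdiv_int)
    qed
    ultimately show "b \<in> (\<lambda>k. int d * k) ` {1..int (R div d)}" using k by auto
  qed
  then have "card {b \<in> {1..int R}. int d dvd b} \<le> card ((\<lambda>k. int d * k) ` {1..int (R div d)})"
    by (intro card_mono) auto
  also have "\<dots> \<le> card {1..int (R div d)}" by (rule card_image_le) simp
  finally have "real (card {b \<in> {1..int R}. int d dvd b}) \<le> real (R div d)" by simp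
  also have "\<dots> \<le> real R / real d" by (rule of_nat_div_le_of_nat)
  finally show ?thesis .
qed

text \<open>Telescoping, since \<open>4 * k * (k + 1) \<le> (2 * k + 1) ^ 2\<close>.\<close>

lemma sum_inverse_odd_squares:
  "(\<Sum>k=1..N. 1 / real (2 * k + 1) ^ 2) \<le> 1/4 - 1 / (4 * real (N + 1))"
proof (induction N)
  case (Suc N)
  have "1 / real (2 * Suc N + 1) ^ 2 \<le> 1 / (4 * real (N + 1)) - 1 / (4 * real (Suc N + 1))"
  proof -
    have "1 / (4 * real (N + 1)) - 1 / (4 * real (Suc N + 1)) = 1 / (4 * real (N + 1) * real (N + 2))"
    proof -
      have "1 / (4 * (x + 1)) - 1 / (4 * (x + 2)) = 1 / (4 * (x + 1) * (x + 2))" if "0 \<le> x" for x :: real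
        using that by (simp add: divide_simps)
      from this[of "real N"] show ?thesis by (simp add: add.commute)
    qed
    moreover have "4 * real (N + 1) * real (N + 2) \<le> real (2 * Suc N + 1) ^ 2"
      by (simp add: power2_eq_square algebra_simps)
    ultimately show ?thesis by (simp add: frac_le)
  qed
  then show ?case using Suc by simp
qed simp

lemma sum_inverse_prime_squares:
  assumes "finite D" "\<And>d. d \<in> D \<Longrightarrow> prime d \<and> d \<noteq> (2::nat)"
  shows "(\<Sum>d\<in>D. 1 / real d ^ 2) \<le> 1/4"
proof -
  obtain N where N: "\<And>d. d \<in> D \<Longrightarrow> d \<le> N" using assms(1) finite_nat_set_iff_bounded_le by auto
  have inj: "inj_on (\<lambda>k. 2 * k + 1) {1..N}" by (auto simp: inj_on_def)
  have "D \<subseteq> (\<lambda>k. 2 * k + 1) ` {1..N}"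
  proof
    fix d assume d: "d \<in> D"
    then have "odd d" "2 < d" using assms(2)[OF d] prime_odd_nat[of d] prime_ge_2_nat[of d] by auto
    then obtain k where "d = 2 * k + 1" using oddE by blast
    then show "d \<in> (\<lambda>k. 2 * k + 1) ` {1..N}" using N[OF d] \<open>2 < d\<close> by auto
  qed
  then have "(\<Sum>d\<in>D. 1 / real d ^ 2) \<le> (\<Sum>d\<in>(\<lambda>k. 2 * k + 1) ` {1..N}. 1 / real d ^ 2)"
    by (intro sum_mono2) auto
  also have "\<dots> = (\<Sum>k=1..N. 1 / real (2 * k + 1) ^ 2)"
    by (subst sum.reindex[OF inj]) simp
  also have "\<dots> \<le> 1/4 - 1 / (4 * real (N + 1))" by (rule sum_inverse_odd_squares)
  also have "\<dots> \<le> 1/4" by simp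
  finally show ?thesis .
qed

lemma card_Un4_le:
  "finite A \<Longrightarrow> finite B \<Longrightarrow> finite C \<Longrightarrow> finite D \<Longrightarrow> S \<subseteq> A \<union> B \<union> C \<union> D \<Longrightarrow>
    card S \<le> card A + card B + card C + card D"
  using card_mono[of "A \<union> B \<union> C \<union> D" S] card_Un_le[of A B] card_Un_le[of "A \<union> B" C] card_Un_le[of "A \<union> B \<union> C" D]
  by simp

text \<open>A union bound for the complement: pairs with \<open>16 * b \<le> R\<close> have
  proportion at most 1/16, those with \<open>p\<close> dividing \<open>b\<close> at most 1/p, and
  those with a common prime factor \<open>d \<noteq> p\<close> at most the sum of
  \<open>1 / d ^ 2\<close>. A common factor \<open>p\<close> is already excluded by the second
  condition, which is what keeps the total below 9/10 when \<open>p = 2\<close>.\<close>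

lemma card_coprime_pairs:
  assumes p: "prime p" and R: "1 \<le> R"
  shows "real R ^ 2 / 10 \<le> real (card {(b, a). b \<in> {1..int R} \<and> a \<in> {1..int R} \<and>
    int R < 16 * b \<and> \<not> int p dvd b \<and> coprime b a})"
    (is "_ \<le> real (card ?C)")
proof -
  let ?I = "{1..int R}"
  define D where "D = {d \<in> {2..R}. prime d \<and> d \<noteq> p}"
  define A where "A = {b \<in> ?I. 16 * b \<le> int R} \<times> ?I"
  define B where "B = {b \<in> ?I. int p dvd b} \<times> ?I"
  define M where "M = (\<lambda>d. {b \<in> ?I. int d dvd b} \<times> {b \<in> ?I. int d dvd b})"
  have fC: "finite ?C" by (rule finite_subset[of _ "?I \<times> ?I"]) auto
  have fin: "finite {b \<in> ?I. Q b}" for Q by (rule finite_subset[of _ ?I]) auto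
  have fA: "finite A" "finite B" "finite (\<Union>d\<in>D. M d)"     unfolding A_def B_def M_def D_def by (intro finite_cartesian_product finite_UN_I fin; simp)+
  have cover: "?I \<times> ?I \<subseteq> ?C \<union> A \<union> B \<union> (\<Union>d\<in>D. M d)"
  proof
    fix x assume x: "x \<in> ?I \<times> ?I"
    obtain b a where ba: "x = (b, a)" "b \<in> ?I" "a \<in> ?I" using x by auto
    show "x \<in> ?C \<union> A \<union> B \<union> (\<Union>d\<in>D. M d)"
    proof (cases "x \<in> ?C \<union> A \<union> B")
      case False
      then have nc: "\<not> coprime b a" and np: "\<not> int p dvd b" using ba unfolding A_def B_def by auto
      then obtain q where q: "prime q" "q dvd nat b" "q dvd nat a"
      proof -
        have "\<not> coprime (nat b) (nat a)" using nc ba by (metis coprime_int_iff atLeastAtMost_iff int_nat_eq order_trans zero_le_one)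
        then have "gcd (nat b) (nat a) \<noteq> 1" by (simp add: coprime_iff_gcd_eq_1)
        then obtain q where "prime q" "q dvd gcd (nat b) (nat a)" using prime_factor_nat by blast
        then show thesis using that by simp
      qed
      have qb: "int q dvd b" "int q dvd a" using q(2,3) ba by (simp_all add: nat_dvd_iff flip: int_dvd_int_iff)
      have "q \<le> nat b" using q(2) ba by (intro dvd_imp_le) auto
      then have "q \<le> R" using ba by auto
      moreover have "q \<noteq> p" using np qb(1) by auto
      ultimately have "q \<in> D" using q(1) prime_ge_2_nat[of q] unfolding D_def by auto
      then show ?thesis using ba qb unfolding M_def by auto
    qed auto
  qed
  have cI: "card (?I \<times> ?I) = R ^ 2" by (simp add: card_cartesian_product power2_eq_square)
  have "R ^ 2 \<le> card ?C + card A + card B + card (\<Union>d\<in>D. M d)"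
    using card_Un4_le[OF fC fA cover] cI by simp
  then have le: "real R ^ 2 \<le> real (card ?C) + real (card A) + real (card B) + real (card (\<Union>d\<in>D. M d))"
    by (metis (mono_tags, lifting) of_nat_add of_nat_le_iff of_nat_power)
  have cA: "real (card A) \<le> real R ^ 2 / 16"
  proof -
    have "{b \<in> ?I. 16 * b \<le> int R} \<subseteq> {1..int (R div 16)}" by (auto simp: zdiv_int)
    then have "card {b \<in> ?I. 16 * b \<le> int R} \<le> R div 16"
      using card_mono[of "{1..int (R div 16)}"] by fastforce
    then have "real (card {b \<in> ?I. 16 * b \<le> int R}) \<le> real R / 16"
      using of_nat_div_le_of_nat[of R 16] by linarith
    then have "real (card {b \<in> ?I. 16 * b \<le> int R}) * real R \<le> real R / 16 * real R"
      by (rule mult_right_mono) simp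
    then show ?thesis unfolding A_def card_cartesian_product by (simp add: power2_eq_square)
  qed
  have cB: "real (card B) \<le> real R ^ 2 / real p"
  proof -
    have "real (card {b \<in> ?I. int p dvd b}) * real R \<le> real R / real p * real R"
      using card_multiples_le[of p R] prime_gt_0_nat[OF p] by (intro mult_right_mono) auto
    then show ?thesis unfolding B_def card_cartesian_product by (simp add: power2_eq_square)
  qed
  have cM: "real (card (M d)) \<le> real R ^ 2 * (1 / real d ^ 2)" if "d \<in> D" for d
  proof -
    have "real (card {b \<in> ?I. int d dvd b}) * real (card {b \<in> ?I. int d dvd b}) \<le> (real R / real d) * (real R / real d)"
      using card_multiples_le[of d R] that unfolding D_def by (intro mult_mono) auto
    then show ?thesis unfolding M_def card_cartesian_product by (simp add: power2_eq_square)
  qed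
  have finD: "finite D" unfolding D_def by simp
  have "real (card (\<Union>d\<in>D. M d)) \<le> (\<Sum>d\<in>D. real (card (M d)))"
    using card_UN_le[OF finD, of M] by (metis of_nat_le_iff of_nat_sum)
  also have "\<dots> \<le> (\<Sum>d\<in>D. real R ^ 2 * (1 / real d ^ 2))" by (rule sum_mono) (rule cM)
  also have "\<dots> = real R ^ 2 * (\<Sum>d\<in>D. 1 / real d ^ 2)" by (simp only: sum_distrib_left)
  finally have cU: "real (card (\<Union>d\<in>D. M d)) \<le> real R ^ 2 * (\<Sum>d\<in>D. 1 / real d ^ 2)" .
  \<comment> \<open>For \<open>p = 2\<close> the total is at most 1/16 + 1/2 + 1/4. For odd
    \<open>p\<close> it is at most 1/16 + 1/3 + (1/4 + 1/4), which is 43/48.\<close>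
  have num: "1 / 16 + 1 / real p + (\<Sum>d\<in>D. 1 / real d ^ 2) \<le> 9 / 10"
  proof (cases "p = 2")
    case True
    then have "(\<Sum>d\<in>D. 1 / real d ^ 2) \<le> 1/4"
      using finD unfolding D_def by (intro sum_inverse_prime_squares) auto
    then show ?thesis using True by simp
  next
    case False
    then have "3 \<le> p" using prime_ge_2_nat[OF p] by simp
    then have "1 / real p \<le> 1 / 3" by (simp add: field_simps)
    moreover have "(\<Sum>d\<in>D. 1 / real d ^ 2) \<le> 1/2"
    proof -
      have "(\<Sum>d\<in>D - {2}. 1 / real d ^ 2) \<le> 1/4"
        using finD unfolding D_def by (intro sum_inverse_prime_squares) auto
      moreover have "(\<Sum>d\<in>D. 1 / real d ^ 2) \<le> (\<Sum>d\<in>insert 2 (D - {2}). 1 / real d ^ 2)"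
        using finD by (intro sum_mono2) auto
      moreover have "(\<Sum>d\<in>insert 2 (D - {2}). 1 / real d ^ 2) = 1/4 + (\<Sum>d\<in>D - {2}. 1 / real d ^ 2)"
        using finD by (subst sum.insert) auto
      ultimately show ?thesis by linarith
    qed
    ultimately show ?thesis by simp
  qed
  have "real R ^ 2 / 16 + real R ^ 2 / real p + real R ^ 2 * (\<Sum>d\<in>D. 1 / real d ^ 2)
      = real R ^ 2 * (1 / 16 + 1 / real p + (\<Sum>d\<in>D. 1 / real d ^ 2))"
    by (simp add: distrib_left)
  also have "\<dots> \<le> real R ^ 2 * (9 / 10)" using num by (intro mult_left_mono) auto
  finally show ?thesis using le cA cB cU by linarith
qed

text \<open>Put \<open>g = gcd b b'\<close>. The determinant \<open>b * a' - b' * a\<close> is a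
  multiple of \<open>g * P\<close> and at most \<open>R * R'\<close> in absolute value, so by
  \<open>small\<close> it takes at most \<open>3 * R * R' / (g * P)\<close> values. For a given
  value, \<open>a\<close> lies in one class modulo \<open>b / g\<close>, which leaves at most
  \<open>R * g / b + 1 \<le> 17 * g\<close> choices because \<open>16 * b > R\<close>. The factors
  \<open>g\<close> cancel, and \<open>3 * 17 = 51\<close>.\<close>

lemma coprime_pairs_determinant_count:
  fixes b b' P :: int and R R' :: nat
  assumes b: "1 \<le> b" "int R < 16 * b" and b': "1 \<le> b'" "b' \<le> int R'" "b \<le> int R"
    and P: "1 \<le> P" "coprime P b" and small: "gcd b b' * P \<le> int R * int R'"
  shows "real (card {(a, a'). a \<in> {1..int R} \<and> a' \<in> {1..int R'} \<and> P dvd b * a' - b' * a})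
    \<le> 51 * (real R * real R' / real_of_int P)" (is "real (card ?S) \<le> _")
proof -
  define g where "g = gcd b b'"
  have g1: "1 \<le> g" unfolding g_def using b by (simp add: int_one_le_iff_zero_less)
  have gb: "g dvd b" "g dvd b'" unfolding g_def by auto
  obtain \<beta> where \<beta>: "b = g * \<beta>" using gb(1) by auto
  obtain \<beta>' where \<beta>': "b' = g * \<beta>'" using gb(2) by auto
  have \<beta>0: "0 < \<beta>" using \<beta> b g1 by (smt (verit) zero_less_mult_iff)
  have cop: "coprime \<beta> \<beta>'"
  proof -
    have "b div g = \<beta>" "b' div g = \<beta>'" using \<beta> \<beta>' g1 by auto
    moreover have "coprime (b div g) (b' div g)"
      unfolding g_def using b(1) by (intro div_gcd_coprime) simp
    ultimately show ?thesis by metis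
  qed
  have copP: "coprime P g" using P(2) gb(1) by (meson coprime_divisors dvd_refl)
  have fS: "finite ?S" by (rule finite_subset[of _ "{1..int R} \<times> {1..int R'}"]) auto
  let ?f = "\<lambda>(a, a'). b * a' - b' * a"
  have fibre: "card {x \<in> ?S. ?f x = v} \<le> nat (17 * g)" for v
  proof -
    let ?F = "{x \<in> ?S. ?f x = v}"
    have "inj_on fst ?F"
    proof (rule inj_onI)
      fix x y assume "x \<in> ?F" "y \<in> ?F" "fst x = fst y"
      then show "x = y" using b by (cases x; cases y) auto
    qed
    then have "card ?F = card (fst ` ?F)" by (simp add: card_image)
    moreover have "real (card (fst ` ?F)) \<le> real R / real_of_int \<beta> + 1"
    proof (rule card_congruent_le[OF \<beta>0])
      show "fst ` ?F \<subseteq> {1..int R}" by auto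
      fix a c assume "a \<in> fst ` ?F" "c \<in> fst ` ?F"
      then obtain a' c' where "b * a' - b' * a = v" "b * c' - b' * c = v" by auto
      then have "g * (\<beta> * (a' - c')) = g * (\<beta>' * (a - c))" using \<beta> \<beta>' by (simp add: algebra_simps)
      then have "\<beta> * (a' - c') = \<beta>' * (a - c)" using g1 by simp
      then have "\<beta> dvd \<beta>' * (a - c)" by (metis dvd_triv_left)
      then show "\<beta> dvd a - c" using cop by (simp add: coprime_dvd_mult_right_iff)
    qed
    moreover have "real R / real_of_int \<beta> + 1 \<le> 17 * real_of_int g"
    proof -
      have "real R \<le> 16 * (real_of_int g * real_of_int \<beta>)"
        using b(2) \<beta> by (metis less_imp_le of_int_le_iff of_int_mult of_int_numeral of_int_of_nat_eq)
      then have "real R / real_of_int \<beta> \<le> 16 * real_of_int g" using \<beta>0 by (simp add: field_simps)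
      then show ?thesis using g1 by linarith
    qed
    ultimately have "real (card ?F) \<le> 17 * real_of_int g" by linarith
    then show ?thesis using g1 by linarith
  qed
  have img: "real (card (?f ` ?S)) \<le> 3 * (real R * real R' / (real_of_int g * real_of_int P))"
  proof -
    define e where "e = g * P"
    have e1: "1 \<le> e" unfolding e_def using g1 P(1) by (metis mult_mono' mult_1 zero_le_one)
    have "?f ` ?S \<subseteq> (\<lambda>k. e * k) ` {- (int R * int R' div e)..int R * int R' div e}"
    proof
      fix v assume "v \<in> ?f ` ?S"
      then obtain a a' where a: "a \<in> {1..int R}" "a' \<in> {1..int R'}" "P dvd b * a' - b' * a"
        and v: "v = b * a' - b' * a" by auto
      have "g dvd v" unfolding v using gb by auto
      then have "e dvd v" unfolding e_def using a(3) v copP by (simp add: divides_mult coprime_commute)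
      then obtain k where k: "v = e * k" by auto
      have "b * a' \<le> int R * int R'" "b' * a \<le> int R' * int R" "0 \<le> b * a'" "0 \<le> b' * a"
        using a b b' by (auto intro!: mult_mono)
      then have "\<bar>v\<bar> \<le> int R * int R'" unfolding v by (simp add: mult.commute abs_le_iff)
      then have "e * \<bar>k\<bar> \<le> int R * int R'" using k e1 by (simp add: abs_mult)
      then have "\<bar>k\<bar> \<le> int R * int R' div e" using e1
        by (metis int_one_le_iff_zero_less nonzero_mult_div_cancel_left order_less_irrefl zdiv_mono1)
      then show "v \<in> (\<lambda>k. e * k) ` {- (int R * int R' div e)..int R * int R' div e}"
        using k by (intro image_eqI[of _ _ k]) (auto simp: abs_le_iff)
    qed
    then have "card (?f ` ?S) \<le> card ((\<lambda>k. e * k) ` {- (int R * int R' div e)..int R * int R' div e})"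
      by (intro card_mono) auto
    also have "\<dots> \<le> card {- (int R * int R' div e)..int R * int R' div e}" by (rule card_image_le) simp
    also have "\<dots> = nat (2 * (int R * int R' div e) + 1)" by simp
    finally have "card (?f ` ?S) \<le> nat (2 * (int R * int R' div e) + 1)" .
    moreover have "0 \<le> int R * int R' div e" using e1 by (simp add: pos_imp_zdiv_nonneg_iff)
    ultimately have "real (card (?f ` ?S)) \<le> 2 * real_of_int (int R * int R' div e) + 1"
      by linarith
    also have "real_of_int (int R * int R' div e) \<le> real R * real R' / real_of_int e"
      using real_of_int_div4[of "int R * int R'" e] by simp
    also have "(1::real) \<le> real R * real R' / real_of_int e"
    proof -
      have "real_of_int e \<le> real_of_int (int R * int R')" using small unfolding e_def g_def by (simp only: of_int_le_iff)
      then show ?thesis using e1 by simp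
    qed
    finally show ?thesis unfolding e_def by (simp add: mult.commute)
  qed
  have "card ?S \<le> card (?f ` ?S) * nat (17 * g)" by (rule card_le_fibres[OF fS fibre])
  then have "real (card ?S) \<le> real (card (?f ` ?S)) * real (nat (17 * g))"
    by (simp only: of_nat_le_iff flip: of_nat_mult)
  also have "\<dots> \<le> 3 * (real R * real R' / (real_of_int g * real_of_int P)) * (17 * real_of_int g)"
    using img g1 by (intro mult_mono) auto
  also have "\<dots> = 51 * (real R * real R' / real_of_int P)" using g1 by simp
  finally show ?thesis .
qed

section \<open>Overlaps of strips\<close>

text \<open>Cauchy-Schwarz for the constant 1 and the number \<open>?Z x\<close> of sets containing
  \<open>x\<close>: the first moment of \<open>?Z\<close> is the sum of the sizes, the second moment
  the sum of the overlaps.\<close>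

lemma chung_erdos:
  assumes "finite X" "finite T" and "\<And>t. t \<in> T \<Longrightarrow> F t \<subseteq> X"
  shows "(\<Sum>t\<in>T. real (card (F t))) ^ 2 \<le>
    real (card (\<Union>t\<in>T. F t)) * (\<Sum>t\<in>T. \<Sum>u\<in>T. real (card (F t \<inter> F u)))"
proof -
  let ?U = "\<Union>t\<in>T. F t"
  let ?Z = "\<lambda>x. \<Sum>t\<in>T. (if x \<in> F t then 1 else 0) :: real"
  have fU: "finite ?U" using assms by (meson UN_least finite_subset)
  have card_eq: "real (card A) = (\<Sum>x\<in>?U. if x \<in> A then 1 else 0)" if "A \<subseteq> ?U" for A
    using that fU by (simp add: sum.If_cases Int_absorb1)
  have "(\<Sum>t\<in>T. real (card (F t))) = (\<Sum>t\<in>T. \<Sum>x\<in>?U. if x \<in> F t then 1 else 0)"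
    by (rule sum.cong[OF refl], rule card_eq) blast
  also have "\<dots> = (\<Sum>x\<in>?U. 1 * ?Z x)" by (subst sum.swap) simp
  finally have "(\<Sum>t\<in>T. real (card (F t))) ^ 2 = (\<Sum>x\<in>?U. 1 * ?Z x) ^ 2" by simp
  also have "\<dots> \<le> (\<Sum>x\<in>?U. 1 ^ 2) * (\<Sum>x\<in>?U. ?Z x ^ 2)"
    by (rule Cauchy_Schwarz_ineq_sum)
  also have "(\<Sum>x\<in>?U. ?Z x ^ 2) = (\<Sum>x\<in>?U. \<Sum>t\<in>T. \<Sum>u\<in>T. if x \<in> F t \<inter> F u then 1 else 0)"
    by (simp only: power2_eq_square sum_product)
       (intro sum.cong refl, auto)
  also have "\<dots> = (\<Sum>t\<in>T. \<Sum>u\<in>T. \<Sum>x\<in>?U. if x \<in> F t \<inter> F u then 1 else 0)"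
    by (subst sum.swap) (intro sum.cong refl, rule sum.swap)
  also have "\<dots> = (\<Sum>t\<in>T. \<Sum>u\<in>T. real (card (F t \<inter> F u)))"
    by (intro sum.cong refl card_eq[symmetric]) blast
  finally show ?thesis by simp
qed

context padic_grid
begin

text \<open>Entries are positive, so that a determinant of two pairs is a difference of two
  nonnegative numbers and bounded by \<open>R * R'\<close> without a factor 2.\<close>

definition heights :: "nat \<Rightarrow> nat \<Rightarrow> (nat \<Rightarrow> int) set" where
  "heights k R = {..<k} \<rightarrow>\<^sub>E {1..int R}"

text \<open>Coprimality of \<open>q 0\<close> and \<open>a 0\<close> together with \<open>q 0 > R / 16\<close> makes any two different pairs, of
  the same or of different blocks \<open>R = 16 ^ t\<close>, non-proportional; \<open>q 0 > R / 16\<close> is moreover needed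
  to count solutions of \<open>q 0 * a' - q' 0 * a = const\<close>.\<close>

definition primitive_pairs :: "nat \<Rightarrow> ((nat \<Rightarrow> int) \<times> (nat \<Rightarrow> int)) set" where
  "primitive_pairs R = {(q, a). q \<in> heights m R \<and> a \<in> heights n R \<and>
     int R < 16 * q 0 \<and> \<not> int p dvd q 0 \<and> coprime (q 0) (a 0)}"

lemma finite_heights [simp]: "finite (heights k R)"
  unfolding heights_def by (intro finite_PiE) auto

lemma card_heights: "card (heights k R) = R ^ k"
  unfolding heights_def by (simp add: card_PiE)

lemma heights_bound: "q \<in> heights k R \<Longrightarrow> i < k \<Longrightarrow> 1 \<le> q i \<and> q i \<le> int R"
  using PiE_mem[of q "{..<k}" "\<lambda>_. {1..int R}" i] unfolding heights_def by simp

lemma primitive_pairs_subset: "primitive_pairs R \<subseteq> heights m R \<times> heights n R"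
  unfolding primitive_pairs_def by auto

lemma finite_primitive_pairs [simp]: "finite (primitive_pairs R)"
  by (rule finite_subset[OF primitive_pairs_subset]) simp

lemma card_primitive_pairs_le: "card (primitive_pairs R) \<le> R ^ (m + n)"
  using card_mono[OF _ primitive_pairs_subset, of R] by (simp add: card_cartesian_product card_heights power_add)

text \<open>Only \<open>q 0\<close> and \<open>a 0\<close> are constrained, and
  \<open>card_coprime_pairs\<close> counts them; the other \<open>m - 1\<close> and
  \<open>n - 1\<close> entries are free.\<close>

lemma card_primitive_pairs_ge:
  assumes "1 \<le> R"
  shows "real R ^ (m + n) / 10 \<le> real (card (primitive_pairs R))"
proof -
  let ?C = "{(b, a). b \<in> {1..int R} \<and> a \<in> {1..int R} \<and>
    int R < 16 * b \<and> \<not> int p dvd b \<and> coprime b a}"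
  let ?Q = "{1..<m} \<rightarrow>\<^sub>E {1..int R}" and ?A = "{1..<n} \<rightarrow>\<^sub>E {1..int R}"
  let ?h = "\<lambda>((b, a), q, c). (q(0 := b), c(0 := a))"
  have ins: "{..<k} = insert 0 {1..<k}" if "0 < k" for k :: nat using that by auto
  have arb: "q 0 = undefined" if "q \<in> {1..<k} \<rightarrow>\<^sub>E S" for q :: "nat \<Rightarrow> int" and k S
    using PiE_arb[OF that, of 0] by simp
  have inj: "inj_on ?h (?C \<times> (?Q \<times> ?A))"
  proof (rule inj_onI)
    fix x y assume xy: "x \<in> ?C \<times> (?Q \<times> ?A)" "y \<in> ?C \<times> (?Q \<times> ?A)" "?h x = ?h y"
    obtain b a q c where x: "x = ((b, a), q, c)" by (metis surj_pair)
    obtain b' a' q' c' where y: "y = ((b', a'), q', c')" by (metis surj_pair)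
    have q: "q \<in> ?Q" "q' \<in> ?Q" and c: "c \<in> ?A" "c' \<in> ?A" using xy(1,2) unfolding x y by blast+
    have eq: "q(0 := b) = q'(0 := b')" "c(0 := a) = c'(0 := a')" using xy(3) unfolding x y by simp_all
    have "b = b'" "a = a'" using eq by (metis fun_upd_same)+
    moreover have "q = q'" using eq(1) arb[OF q(1)] arb[OF q(2)] by (metis fun_upd_triv fun_upd_upd)
    moreover have "c = c'" using eq(2) arb[OF c(1)] arb[OF c(2)] by (metis fun_upd_triv fun_upd_upd)
    ultimately show "x = y" unfolding x y by simp
  qed
  have sub: "?h ` (?C \<times> (?Q \<times> ?A)) \<subseteq> primitive_pairs R"
  proof (rule image_subsetI)
    fix x assume "x \<in> ?C \<times> (?Q \<times> ?A)"
    moreover obtain b a q c where x: "x = ((b, a), q, c)" by (metis surj_pair)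
    ultimately have ba: "(b, a) \<in> ?C" and q: "q \<in> ?Q" and c: "c \<in> ?A" by blast+
    have "q(0 := b) \<in> heights m R" unfolding heights_def ins[OF m0]
      using ba q by (intro PiE_fun_upd) auto
    moreover have "c(0 := a) \<in> heights n R" unfolding heights_def ins[OF n0]
      using ba c by (intro PiE_fun_upd) auto
    ultimately show "?h x \<in> primitive_pairs R" using ba unfolding primitive_pairs_def x by simp
  qed
  have "card ?C * (R ^ (m - 1) * R ^ (n - 1)) = card (?C \<times> (?Q \<times> ?A))"
    by (simp add: card_cartesian_product card_PiE)
  also have "\<dots> = card (?h ` (?C \<times> (?Q \<times> ?A)))" by (rule card_image[OF inj, symmetric])
  also have "\<dots> \<le> card (primitive_pairs R)" by (rule card_mono[OF finite_primitive_pairs sub])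
  finally have "real (card ?C) * (real R ^ (m - 1) * real R ^ (n - 1)) \<le> real (card (primitive_pairs R))"
    by (simp only: of_nat_le_iff flip: of_nat_mult of_nat_power)
  moreover have "real R ^ 2 / 10 * (real R ^ (m - 1) * real R ^ (n - 1)) \<le>
      real (card ?C) * (real R ^ (m - 1) * real R ^ (n - 1))"
    using card_coprime_pairs[OF prime assms] by (rule mult_right_mono) simp
  moreover have "real R ^ 2 * (real R ^ (m - 1) * real R ^ (n - 1)) = real R ^ (m + n)"
  proof -
    have "m + n = 2 + ((m - 1) + (n - 1))" using m0 n0 by simp
    then show ?thesis by (simp only: power_add)
  qed
  ultimately show ?thesis by simp
qed

text \<open>Elimination: \<open>q 0\<close> times the second congruence minus \<open>q' 0\<close>
  times the first loses \<open>y 0\<close> and leaves the coefficients \<open>D k\<close> modulo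
  \<open>p ^ \<theta>'\<close>. Some \<open>D i\<close> is \<open>p ^ \<kappa>\<close> times a unit,
  so \<open>y i\<close> is fixed modulo \<open>p ^ (\<theta>' - \<kappa>)\<close>, after which the
  first congruence fixes \<open>y 0\<close> modulo \<open>p ^ \<theta>\<close>. If
  \<open>\<kappa> = \<theta>'\<close>, the second congruence is simply dropped. The bound is
  multiplied out to avoid division.\<close>

lemma column_pair_count:
  assumes q0: "\<not> int p dvd q 0" "\<not> int p dvd q' 0" and le: "\<theta>' \<le> \<theta>" "\<theta> \<le> L"
    and \<kappa>: "\<kappa> \<le> \<theta>'" "\<And>i. i < m \<Longrightarrow> int p ^ \<kappa> dvd q 0 * q' i - q' 0 * q i"
    and max: "\<kappa> = \<theta>' \<or> (\<exists>i<m. \<not> int p ^ Suc \<kappa> dvd q 0 * q' i - q' 0 * q i)"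
  shows "card {y \<in> {..<m} \<rightarrow>\<^sub>E {0..<int p ^ L}. int p ^ \<theta> dvd (\<Sum>i<m. q i * y i) + c \<and>
      int p ^ \<theta>' dvd (\<Sum>i<m. q' i * y i) + c'} * p ^ (\<theta> + \<theta>') \<le> p ^ (L * m + \<kappa>)"
    (is "card ?A * _ \<le> _")
proof (cases "\<kappa> = \<theta>'")
  case True
  have "card ?A \<le> card {y \<in> {..<m} \<rightarrow>\<^sub>E {0..<int p ^ L}. int p ^ \<theta> dvd (\<Sum>i<m. q i * y i) + c}"
    by (rule card_mono) (simp add: finite_PiE, blast)
  also have "\<dots> = p ^ (L * (m - 1) + (L - \<theta>))"
    using column_count[where q = q and c = c and e = "\<lambda>_. 0" and l = 0 and \<sigma> = \<theta> and L = L] q0 le by simp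
  finally have "card ?A * p ^ (\<theta> + \<theta>') \<le> p ^ (L * (m - 1) + (L - \<theta>)) * p ^ (\<theta> + \<theta>')" by simp
  also have "\<dots> = p ^ (L * (m - 1) + L + \<theta>')" using le by (simp add: add.assoc flip: power_add)
  also have "L * (m - 1) + L = L * m" using m0 by (cases m) auto
  finally show ?thesis using True by simp
next
  case False
  let ?S = "{0..<int p ^ L}"
  define D where "D = (\<lambda>i. q 0 * q' i - q' 0 * q i)"
  obtain i where i: "i < m" "\<not> int p ^ Suc \<kappa> dvd D i" using max False unfolding D_def by blast
  have i0: "i \<noteq> 0" using i(2) unfolding D_def by (cases i) auto
  obtain u where u: "D i = int p ^ \<kappa> * u" using \<kappa>(2)[OF i(1)] unfolding D_def by blast
  have pu: "\<not> int p dvd u" using i(2) u p0 by auto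
  define J where "J = {..<m} - {0, i}"
  have J: "{..<m} = insert 0 (insert i J)" "0 \<notin> insert i J" "i \<notin> J" "finite J"
    unfolding J_def using i(1) i0 m0 by auto
  have "card (insert 0 (insert i J)) = m" by (simp flip: J(1))
  then have cJ: "card J + 2 = m" using J(2-4) by simp
  define Q where "Q = (\<lambda>y. int p ^ \<theta> dvd (\<Sum>i<m. q i * y i) + c \<and> int p ^ \<theta>' dvd (\<Sum>i<m. q' i * y i) + c')"
  have sumJ: "(\<Sum>k<m. h k) = h 0 + (h i + (\<Sum>k\<in>J. h k))" for h :: "nat \<Rightarrow> int"
    unfolding J(1) using J(2-4) by simp
  have inner: "card {v \<in> ?S. Q (x(0 := v))} \<le> p ^ (L - \<theta>)" for x
  proof (rule card_residue_class_le[OF p0 le(2)])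
    fix v w assume "v \<in> {v \<in> ?S. Q (x(0 := v))}" "w \<in> {v \<in> ?S. Q (x(0 := v))}"
    then have "int p ^ \<theta> dvd (\<Sum>k<m. q k * (x(0 := v)) k) + c" "int p ^ \<theta> dvd (\<Sum>k<m. q k * (x(0 := w)) k) + c"
      unfolding Q_def by blast+
    then have "int p ^ \<theta> dvd ((\<Sum>k<m. q k * (x(0 := v)) k) + c) - ((\<Sum>k<m. q k * (x(0 := w)) k) + c)"
      by (rule dvd_diff)
    also have "((\<Sum>k<m. q k * (x(0 := v)) k) + c) - ((\<Sum>k<m. q k * (x(0 := w)) k) + c) = q 0 * (v - w)"
    proof -
      have "(\<Sum>k\<in>J. q k * (x(0 := v)) k) = (\<Sum>k\<in>J. q k * x k)" for v
        using J(2) by (intro sum.cong) auto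
      then show ?thesis unfolding sumJ using i0 by (simp add: algebra_simps)
    qed
    finally show "int p ^ \<theta> dvd v - w"
      using coprime_ppow[OF q0(1)] by (simp add: coprime_dvd_mult_right_iff)
  qed auto
  define B where "B = {x \<in> insert i J \<rightarrow>\<^sub>E ?S. \<exists>v\<in>?S. Q (x(0 := v))}"
  have fin: "finite (insert i J \<rightarrow>\<^sub>E ?S)" using J(4) by (intro finite_PiE) auto
  have "card ?A = card {y \<in> insert 0 (insert i J) \<rightarrow>\<^sub>E ?S. Q y}"
    unfolding Q_def J(1)[symmetric] ..
  also have "\<dots> = (\<Sum>x\<in>insert i J \<rightarrow>\<^sub>E ?S. card {v \<in> ?S. Q (x(0 := v))})"
    using J(2,4) by (intro card_PiE_fibre) auto
  also have "\<dots> = (\<Sum>x\<in>B. card {v \<in> ?S. Q (x(0 := v))})"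
  proof (rule sum.mono_neutral_right[OF fin])
    show "B \<subseteq> insert i J \<rightarrow>\<^sub>E ?S" unfolding B_def by blast
    show "\<forall>x\<in>(insert i J \<rightarrow>\<^sub>E ?S) - B. card {v \<in> ?S. Q (x(0 := v))} = 0"
    proof
      fix x assume "x \<in> (insert i J \<rightarrow>\<^sub>E ?S) - B"
      then have "{v \<in> ?S. Q (x(0 := v))} = {}" unfolding B_def by blast
      then show "card {v \<in> ?S. Q (x(0 := v))} = 0" by (simp only: card.empty)
    qed
  qed
  also have "\<dots> \<le> of_nat (card B) * p ^ (L - \<theta>)"
    by (rule sum_bounded_above) (rule inner)
  finally have 1: "card ?A \<le> card B * p ^ (L - \<theta>)" by simp
  have inner2: "card {w \<in> ?S. \<exists>v\<in>?S. Q (x(i := w, 0 := v))} \<le> p ^ (L - (\<theta>' - \<kappa>))" for x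
  proof (rule card_residue_class_le[OF p0])
    show "\<theta>' - \<kappa> \<le> L" using le by simp
    fix w w' assume "w \<in> {w \<in> ?S. \<exists>v\<in>?S. Q (x(i := w, 0 := v))}" "w' \<in> {w \<in> ?S. \<exists>v\<in>?S. Q (x(i := w, 0 := v))}"
    then obtain v v' where Qv: "Q (x(i := w, 0 := v))" "Q (x(i := w', 0 := v'))" by blast
    have D: "int p ^ \<theta>' dvd (\<Sum>k<m. D k * y k) + (q 0 * c' - q' 0 * c)" if "Q y" for y
    proof -
      have "int p ^ \<theta>' dvd (\<Sum>k<m. q k * y k) + c" "int p ^ \<theta>' dvd (\<Sum>k<m. q' k * y k) + c'"
        using that le(1) unfolding Q_def by (meson dvd_trans le_imp_power_dvd)+
      then have "int p ^ \<theta>' dvd q 0 * ((\<Sum>k<m. q' k * y k) + c') - q' 0 * ((\<Sum>k<m. q k * y k) + c)"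
        by (intro dvd_diff dvd_mult)
      also have "\<dots> = (\<Sum>k<m. D k * y k) + (q 0 * c' - q' 0 * c)"
        unfolding D_def by (simp add: algebra_simps sum_subtractf sum_distrib_left)
      finally show ?thesis .
    qed
    have D0: "D 0 = 0" unfolding D_def by simp
    have DJ: "(\<Sum>k<m. D k * (x(i := w, 0 := v)) k) = D i * w + (\<Sum>k\<in>J. D k * x k)" for w v
    proof -
      have "(\<Sum>k\<in>J. D k * (x(i := w, 0 := v)) k) = (\<Sum>k\<in>J. D k * x k)"
        using J(2,3) by (intro sum.cong) auto
      then show ?thesis unfolding sumJ using D0 i0 by simp
    qed
    have "int p ^ \<theta>' dvd (D i * w + (\<Sum>k\<in>J. D k * x k) + (q 0 * c' - q' 0 * c))
        - (D i * w' + (\<Sum>k\<in>J. D k * x k) + (q 0 * c' - q' 0 * c))"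
      using dvd_diff[OF D[OF Qv(1)] D[OF Qv(2)]] unfolding DJ .
    also have "\<dots> = int p ^ \<kappa> * (u * (w - w'))" unfolding u by (simp add: algebra_simps)
    also have "int p ^ \<theta>' = int p ^ \<kappa> * int p ^ (\<theta>' - \<kappa>)" using \<kappa>(1) by (simp flip: power_add)
    finally have "int p ^ (\<theta>' - \<kappa>) dvd u * (w - w')" using p0 by simp
    then show "int p ^ (\<theta>' - \<kappa>) dvd w - w'"
      using coprime_dvd_mult_right_iff[OF coprime_ppow[OF pu]] by blast
  qed auto
  have "card B = (\<Sum>x\<in>J \<rightarrow>\<^sub>E ?S. card {w \<in> ?S. \<exists>v\<in>?S. Q (x(i := w, 0 := v))})"
    unfolding B_def using J(3,4) by (intro card_PiE_fibre) auto
  also have "\<dots> \<le> of_nat (card (J \<rightarrow>\<^sub>E ?S)) * p ^ (L - (\<theta>' - \<kappa>))"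
    by (rule sum_bounded_above) (rule inner2)
  also have "card (J \<rightarrow>\<^sub>E ?S) = p ^ (L * card J)"
    using J(4) by (simp add: card_PiE power_mult nat_power_eq)
  finally have "card B \<le> p ^ (L * card J + (L - (\<theta>' - \<kappa>)))" by (simp add: power_add)
  then have "card ?A * p ^ (\<theta> + \<theta>') \<le> p ^ (L * card J + (L - (\<theta>' - \<kappa>))) * p ^ (L - \<theta>) * p ^ (\<theta> + \<theta>')"
    using 1 by (meson le_trans mult_le_mono1)
  also have "\<dots> = p ^ (L * card J + (L - (\<theta>' - \<kappa>)) + (L - \<theta>) + (\<theta> + \<theta>'))"
    by (simp only: power_add)
  also have "L * card J + (L - (\<theta>' - \<kappa>)) + (L - \<theta>) + (\<theta> + \<theta>') = L * m + \<kappa>"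
    using cJ[symmetric] le \<kappa>(1) by (simp add: algebra_simps)
  finally show ?thesis .
qed

text \<open>The 2 by 2 minors through column 0 of the matrix with rows \<open>q\<close>,
  \<open>q'\<close>. When \<open>q 0\<close> is prime to \<open>p\<close>, the power of
  \<open>p\<close> common to all of them measures how close the rows are to being proportional
  p-adically.\<close>

definition minor :: "(nat \<Rightarrow> int) \<Rightarrow> (nat \<Rightarrow> int) \<Rightarrow> nat \<Rightarrow> int" where
  "minor q q' i = q 0 * q' i - q' 0 * q i"

text \<open>The cap \<open>min \<theta> \<theta>'\<close> makes \<open>\<kappa>\<close> exist also
  when all minors vanish, as they always do for \<open>m = 1\<close>.\<close>

lemma obtain_minor_valuation:
  obtains \<kappa> where "\<kappa> \<le> min \<theta> \<theta>'" "\<And>i. i < m \<Longrightarrow> int p ^ \<kappa> dvd minor q q' i"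
    "\<kappa> = min \<theta> \<theta>' \<or> (\<exists>i<m. \<not> int p ^ Suc \<kappa> dvd minor q q' i)"
proof -
  define A where "A = {k. k \<le> min \<theta> \<theta>' \<and> (\<forall>i<m. int p ^ k dvd minor q q' i)}"
  have fin: "finite A" by (rule finite_subset[of _ "{..min \<theta> \<theta>'}"]) (auto simp: A_def)
  have ne: "A \<noteq> {}" unfolding A_def by (rule ex_in_conv[THEN iffD1], rule exI[of _ 0]) simp
  define k where "k = Max A"
  have "k \<in> A" unfolding k_def using fin ne by (rule Max_in)
  then have k: "k \<le> min \<theta> \<theta>'" "\<And>i. i < m \<Longrightarrow> int p ^ k dvd minor q q' i" unfolding A_def by auto
  have "\<not> Suc k \<in> A" using Max_ge[OF fin, of "Suc k"] unfolding k_def by auto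
  then have "k = min \<theta> \<theta>' \<or> (\<exists>i<m. \<not> int p ^ Suc k dvd minor q q' i)"
  proof (rule contrapos_np)
    assume n: "\<not> (k = min \<theta> \<theta>' \<or> (\<exists>i<m. \<not> int p ^ Suc k dvd minor q q' i))"
    then have "k \<noteq> min \<theta> \<theta>'" by blast
    then have "Suc k \<le> min \<theta> \<theta>'" using k(1) by linarith
    then show "Suc k \<in> A" using n unfolding A_def by blast
  qed
  then show thesis using that k by blast
qed

text \<open>Relative to the whole box a strip of level \<open>\<theta>\<close> has measure
  \<open>p ^ -(\<theta> * n)\<close>. Hence the overlap exceeds the product of the two measures at
  most by the factor \<open>p ^ (\<kappa> * n)\<close>, which is 1 when some minor is prime to
  \<open>p\<close>.\<close>

lemma strip_pair_count:
  assumes q0: "\<not> int p dvd q 0" "\<not> int p dvd q' 0" and le: "\<theta> \<le> L" "\<theta>' \<le> L"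
    and \<kappa>: "\<kappa> \<le> min \<theta> \<theta>'" "\<And>i. i < m \<Longrightarrow> int p ^ \<kappa> dvd minor q q' i"
    and max: "\<kappa> = min \<theta> \<theta>' \<or> (\<exists>i<m. \<not> int p ^ Suc \<kappa> dvd minor q q' i)"
  shows "card {x \<in> Box L. strip \<theta> q a x \<and> strip \<theta>' q' a' x} * p ^ ((\<theta> + \<theta>') * n) \<le> p ^ ((L * m + \<kappa>) * n)"
proof -
  let ?S = "{0..<int p ^ L}"
  let ?Q = "\<lambda>j y. int p ^ \<theta> dvd (\<Sum>i<m. q i * y i) + a j \<and> int p ^ \<theta>' dvd (\<Sum>i<m. q' i * y i) + a' j"
  let ?c = "\<lambda>j. card {y \<in> {..<m} \<rightarrow>\<^sub>E ?S. ?Q j y}"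
  have eq: "{x \<in> Box L. strip \<theta> q a x \<and> strip \<theta>' q' a' x}
      = {x \<in> {..<m} \<times> {..<n} \<rightarrow>\<^sub>E ?S. \<forall>j\<in>{..<n}. ?Q j (\<lambda>i\<in>{..<m}. x (i, j))}"
    unfolding Box_def strip_def idx_def by (rule Collect_cong) auto
  have col: "?c j * p ^ (\<theta> + \<theta>') \<le> p ^ (L * m + \<kappa>)" for j
  proof (cases "\<theta>' \<le> \<theta>")
    case True
    then have "min \<theta> \<theta>' = \<theta>'" by simp
    then have "\<kappa> \<le> \<theta>'" "\<kappa> = \<theta>' \<or> (\<exists>i<m. \<not> int p ^ Suc \<kappa> dvd q 0 * q' i - q' 0 * q i)"
      using \<kappa>(1) max unfolding minor_def by simp_all
    then show ?thesis
      by (intro column_pair_count[where q = q and q' = q', OF q0 True le(1)] \<kappa>(2)[unfolded minor_def])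
  next
    case False
    then have min: "min \<theta> \<theta>' = \<theta>" "\<theta> \<le> \<theta>'" by simp_all
    have sym: "int p ^ k dvd q' 0 * q i - q 0 * q' i \<longleftrightarrow> int p ^ k dvd minor q q' i" for k i
      unfolding minor_def by (rule dvd_diff_commute)
    have "card {y \<in> {..<m} \<rightarrow>\<^sub>E ?S. int p ^ \<theta>' dvd (\<Sum>i<m. q' i * y i) + a' j \<and>
        int p ^ \<theta> dvd (\<Sum>i<m. q i * y i) + a j} * p ^ (\<theta>' + \<theta>) \<le> p ^ (L * m + \<kappa>)"
    proof (rule column_pair_count[where q = q' and q' = q, OF q0(2,1) min(2) le(2)])
      show "\<kappa> \<le> \<theta>" using \<kappa>(1) by simp
      show "int p ^ \<kappa> dvd q' 0 * q i - q 0 * q' i" if "i < m" for i using \<kappa>(2)[OF that] unfolding sym .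
      show "\<kappa> = \<theta> \<or> (\<exists>i<m. \<not> int p ^ Suc \<kappa> dvd q' 0 * q i - q 0 * q' i)"
        using max unfolding sym min(1) .
    qed
    then show ?thesis by (simp only: conj_commute add.commute)
  qed
  have 1: "card {x \<in> Box L. strip \<theta> q a x \<and> strip \<theta>' q' a' x} = (\<Prod>j\<in>{..<n}. ?c j)"
    unfolding eq by (rule card_PiE_columns) auto
  have 2: "p ^ (k * n) = (\<Prod>j\<in>{..<n}. p ^ k)" for k
    by (simp add: power_mult)
  have "card {x \<in> Box L. strip \<theta> q a x \<and> strip \<theta>' q' a' x} * p ^ ((\<theta> + \<theta>') * n)
      = (\<Prod>j\<in>{..<n}. ?c j * p ^ (\<theta> + \<theta>'))"
    unfolding 1 2 by (rule prod.distrib[symmetric])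
  also have "\<dots> \<le> (\<Prod>j\<in>{..<n}. p ^ (L * m + \<kappa>))"
    using col by (intro prod_mono) simp
  finally show ?thesis unfolding 2 .
qed

text \<open>The combination \<open>q 0 * (q' x + a') - q' 0 * (q x + a)\<close> has the minors as
  coefficients of \<open>x\<close>; modulo \<open>p ^ \<kappa>\<close> they vanish and only the
  constant term remains.\<close>

lemma strips_meet_congruence:
  assumes "strip \<theta> q a x" "strip \<theta>' q' a' x" "\<kappa> \<le> min \<theta> \<theta>'"
    and "\<And>i. i < m \<Longrightarrow> int p ^ \<kappa> dvd minor q q' i" and j: "j < n"
  shows "int p ^ \<kappa> dvd q 0 * a' j - q' 0 * a j"
proof -
  have "strip \<kappa> q a x" "strip \<kappa> q' a' x" using assms(1-3) strip_antimono by auto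
  then have "int p ^ \<kappa> dvd (\<Sum>i<m. q i * x (i, j)) + a j" "int p ^ \<kappa> dvd (\<Sum>i<m. q' i * x (i, j)) + a' j"
    using j unfolding strip_def by blast+
  then have "int p ^ \<kappa> dvd q 0 * ((\<Sum>i<m. q' i * x (i, j)) + a' j) - q' 0 * ((\<Sum>i<m. q i * x (i, j)) + a j)"
    by (intro dvd_diff dvd_mult)
  moreover have "int p ^ \<kappa> dvd (\<Sum>i<m. minor q q' i * x (i, j))"
    using assms(4) by (intro dvd_sum dvd_mult2) auto
  ultimately have "int p ^ \<kappa> dvd (q 0 * ((\<Sum>i<m. q' i * x (i, j)) + a' j) - q' 0 * ((\<Sum>i<m. q i * x (i, j)) + a j))
      - (\<Sum>i<m. minor q q' i * x (i, j))"
    by (rule dvd_diff)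
  also have "(q 0 * ((\<Sum>i<m. q' i * x (i, j)) + a' j) - q' 0 * ((\<Sum>i<m. q i * x (i, j)) + a j))
      - (\<Sum>i<m. minor q q' i * x (i, j)) = q 0 * a' j - q' 0 * a j"
    unfolding minor_def by (simp add: algebra_simps sum_subtractf sum_distrib_left)
  finally show ?thesis .
qed

lemma heights_ext:
  assumes "q \<in> heights k R" "q' \<in> heights k R'" "\<And>i. i < k \<Longrightarrow> q i = q' i"
  shows "q = q'"
  using assms unfolding heights_def by (intro extensionalityI[of q "{..<k}" q']) (auto simp: PiE_iff)

text \<open>Coprimality turns \<open>q 0 * a' 0 = q' 0 * a 0\<close> into mutual divisibility of
  \<open>q 0\<close> and \<open>q' 0\<close>, so the factor of proportionality is 1.\<close>

lemma proportional_primitive_pairs_eq: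
  assumes v: "(q, a) \<in> primitive_pairs R" and v': "(q', a') \<in> primitive_pairs R'"
    and q: "\<And>i. i < m \<Longrightarrow> q 0 * q' i = q' 0 * q i" and a: "\<And>j. j < n \<Longrightarrow> q 0 * a' j = q' 0 * a j"
  shows "q = q' \<and> a = a'"
proof -
  have h: "q \<in> heights m R" "q' \<in> heights m R'" "a \<in> heights n R" "a' \<in> heights n R'"
    and c: "coprime (q 0) (a 0)" "coprime (q' 0) (a' 0)"
    using v v' unfolding primitive_pairs_def by auto
  have pos: "1 \<le> q 0" "1 \<le> q' 0" using heights_bound[OF h(1) m0] heights_bound[OF h(2) m0] by auto
  have "q 0 dvd q' 0 * a 0" using a[OF n0] by (metis dvd_triv_left)
  then have 1: "q 0 dvd q' 0" using c(1) by (simp add: coprime_dvd_mult_left_iff)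
  have "q' 0 dvd q 0 * a' 0" using a[OF n0] by (metis dvd_triv_left)
  then have 2: "q' 0 dvd q 0" using c(2) by (simp add: coprime_dvd_mult_left_iff)
  have q0: "q 0 = q' 0" using 1 2 pos by (intro zdvd_antisym_nonneg) auto
  have "q i = q' i" if "i < m" for i using q[OF that] pos unfolding q0 by simp
  then have "q = q'" by (rule heights_ext[OF h(1,2)])
  moreover have "a j = a' j" if "j < n" for j using a[OF that] pos unfolding q0 by simp
  then have "a = a'" by (rule heights_ext[OF h(3,4)])
  ultimately show ?thesis by blast
qed

lemma abs_mult_diff_le:
  fixes b b' a a' R R' :: int
  assumes "1 \<le> b" "b \<le> R" "1 \<le> a" "a \<le> R" "1 \<le> b'" "b' \<le> R'" "1 \<le> a'" "a' \<le> R'"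
  shows "\<bar>b * a' - b' * a\<bar> \<le> R * R'"
proof -
  have "b * a' \<le> R * R'" "b' * a \<le> R' * R" "0 \<le> b * a'" "0 \<le> b' * a"
    using assms by (auto intro!: mult_mono)
  then show ?thesis by (simp add: mult.commute abs_le_iff)
qed

text \<open>The loss of independence is \<open>p ^ (\<kappa> * n)\<close>, where \<open>p ^ \<kappa>\<close> divides all \<open>minor q q' i\<close>. It is compensated by
  the number of pairs \<open>(a, a')\<close> whose strips meet, because these satisfy congruences modulo \<open>p ^ \<kappa>\<close>.
  If \<open>gcd (q 0) (q' 0) * p ^ \<kappa> > R * R'\<close>, the congruences are equalities and the pairs are proportional.\<close>

lemma strip_pair_sum_fixed_q:
  assumes q: "q \<in> heights m R" "int R < 16 * q 0" "\<not> int p dvd q 0"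
    and q': "q' \<in> heights m R'" "int R' < 16 * q' 0" "\<not> int p dvd q' 0"
    and le: "\<theta> \<le> L" "\<theta>' \<le> L"
  shows "(\<Sum>a\<in>heights n R. \<Sum>a'\<in>heights n R'.
      if (q, a) \<in> primitive_pairs R \<and> (q', a') \<in> primitive_pairs R' \<and> (q, a) \<noteq> (q', a')
      then real (card {x \<in> Box L. strip \<theta> q a x \<and> strip \<theta>' q' a' x}) else 0)
    \<le> 51 ^ n * (real R * real R') ^ n * real p ^ (L * (m * n)) / real p ^ ((\<theta> + \<theta>') * n)"
    (is "?sum \<le> _")
proof -
  let ?c = "\<lambda>a a'. real (card {x \<in> Box L. strip \<theta> q a x \<and> strip \<theta>' q' a' x})"
  obtain \<kappa> where \<kappa>: "\<kappa> \<le> min \<theta> \<theta>'" "\<And>i. i < m \<Longrightarrow> int p ^ \<kappa> dvd minor q q' i"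
    "\<kappa> = min \<theta> \<theta>' \<or> (\<exists>i<m. \<not> int p ^ Suc \<kappa> dvd minor q q' i)"
    by (rule obtain_minor_valuation[of \<theta> \<theta>' q q']) blast
  define W where "W = {(a, a'). (q, a) \<in> primitive_pairs R \<and> (q', a') \<in> primitive_pairs R' \<and> (q, a) \<noteq> (q', a') \<and>
      (\<exists>x\<in>Box L. strip \<theta> q a x \<and> strip \<theta>' q' a' x)}"
  have Wsub: "W \<subseteq> heights n R \<times> heights n R'" unfolding W_def primitive_pairs_def by auto
  have finW: "finite W" by (rule finite_subset[OF Wsub]) simp
  have hq: "1 \<le> q 0" "q 0 \<le> int R" using heights_bound[OF q(1) m0] by auto
  have hq': "1 \<le> q' 0" "q' 0 \<le> int R'" using heights_bound[OF q'(1) m0] by auto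
  have Wcong: "int p ^ \<kappa> dvd q 0 * a' j - q' 0 * a j" if "(a, a') \<in> W" "j < n" for a a' j
    using that strips_meet_congruence[OF _ _ \<kappa>(1,2) that(2), of a _ a'] unfolding W_def by blast
  have cW: "real (card W) \<le> (51 * (real R * real R' / real p ^ \<kappa>)) ^ n"
  proof (cases "gcd (q 0) (q' 0) * int p ^ \<kappa> \<le> int R * int R'")
    case True
    let ?T = "{(a, a'). a \<in> {1..int R} \<and> a' \<in> {1..int R'} \<and> int p ^ \<kappa> dvd q 0 * a' - q' 0 * a}"
    let ?h = "\<lambda>(a, a'). \<lambda>j\<in>{..<n}. (a j, a' j)"
    have finT: "finite ?T" by (rule finite_subset[of _ "{1..int R} \<times> {1..int R'}"]) auto
    have "inj_on ?h W"
    proof (rule inj_onI)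
      fix x y assume xy: "x \<in> W" "y \<in> W" "?h x = ?h y"
      obtain a a' where x: "x = (a, a')" by fastforce
      obtain b b' where y: "y = (b, b')" by fastforce
      have m: "a \<in> heights n R" "b \<in> heights n R" "a' \<in> heights n R'" "b' \<in> heights n R'"
        using xy(1,2) Wsub unfolding x y by auto
      have eq: "a j = b j \<and> a' j = b' j" if "j < n" for j
        using fun_cong[OF xy(3), of j] that unfolding x y by simp
      have "a = b" using eq by (intro heights_ext[OF m(1,2)]) blast
      moreover have "a' = b'" using eq by (intro heights_ext[OF m(3,4)]) blast
      ultimately show "x = y" unfolding x y by simp
    qed
    then have "card W = card (?h ` W)" by (simp add: card_image)
    also have "\<dots> \<le> card ({..<n} \<rightarrow>\<^sub>E ?T)"
    proof (rule card_mono)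
      show "finite ({..<n} \<rightarrow>\<^sub>E ?T)" using finT by (intro finite_PiE) auto
      show "?h ` W \<subseteq> {..<n} \<rightarrow>\<^sub>E ?T"
      proof (rule image_subsetI)
        fix x assume xW: "x \<in> W"
        obtain a a' where x: "x = (a, a')" by fastforce
        have m: "a \<in> heights n R" "a' \<in> heights n R'" using xW Wsub unfolding x by auto
        have "(a j, a' j) \<in> ?T" if "j \<in> {..<n}" for j
          using heights_bound[OF m(1), of j] heights_bound[OF m(2), of j] Wcong[of a a' j] xW that
          unfolding x by simp
        then show "?h x \<in> {..<n} \<rightarrow>\<^sub>E ?T" unfolding x prod.case by (intro restrict_PiE_iff[THEN iffD2] ballI)
      qed
    qed
    also have "\<dots> = card ?T ^ n" by (simp add: card_PiE)
    finally have "real (card W) \<le> real (card ?T) ^ n" by (simp only: of_nat_le_iff flip: of_nat_power)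
    also have "\<dots> \<le> (51 * (real R * real R' / real_of_int (int p ^ \<kappa>))) ^ n"
    proof (rule power_mono[OF coprime_pairs_determinant_count])
      show "1 \<le> int p ^ \<kappa>" using p0 by simp
      show "coprime (int p ^ \<kappa>) (q 0)" by (rule coprime_ppow[OF q(3)])
    qed (use hq hq' q q' True in simp_all)
    finally show ?thesis by simp
  next
    case False
    \<comment> \<open>\<open>p\<close> does not divide \<open>q 0\<close>, hence not the gcd; so
      whatever both the gcd and \<open>p ^ \<kappa>\<close> divide is a multiple of their product,
      which is too large for a nonzero determinant.\<close>
    have gp: "coprime (gcd (q 0) (q' 0)) (int p ^ \<kappa>)"
      using coprime_ppow[OF q(3), of \<kappa>] by (meson coprime_commute coprime_divisors dvd_refl gcd_dvd1)
    have zero: "v = 0" if "gcd (q 0) (q' 0) dvd v" "int p ^ \<kappa> dvd v" "\<bar>v\<bar> \<le> int R * int R'" for v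
    proof (rule ccontr)
      assume "v \<noteq> 0"
      have "gcd (q 0) (q' 0) * int p ^ \<kappa> dvd v" using that(1,2) gp by (rule divides_mult)
      then have "\<bar>gcd (q 0) (q' 0) * int p ^ \<kappa>\<bar> \<le> \<bar>v\<bar>" by (rule dvd_imp_le_int[OF \<open>v \<noteq> 0\<close>])
      then show False using that(3) False by linarith
    qed
    have gdvd: "gcd (q 0) (q' 0) dvd q 0 * u - q' 0 * w" for u w by simp
    have "W = {}"
    proof (rule equals0I)
      fix x assume xW: "x \<in> W"
      obtain a a' where x: "x = (a, a')" by fastforce
      have m: "a \<in> heights n R" "a' \<in> heights n R'" using xW Wsub unfolding x by auto
      have vv: "(q, a) \<in> primitive_pairs R" "(q', a') \<in> primitive_pairs R'" "(q, a) \<noteq> (q', a')" using xW unfolding x W_def by auto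
      have "q 0 * a' j - q' 0 * a j = 0" if "j < n" for j
        using heights_bound[OF m(1) that] heights_bound[OF m(2) that] hq hq' Wcong[of a a' j] xW that
        unfolding x by (intro zero[OF gdvd] abs_mult_diff_le) auto
      moreover have "q 0 * q' i - q' 0 * q i = 0" if "i < m" for i
        using heights_bound[OF q(1) that] heights_bound[OF q'(1) that] hq hq' \<kappa>(2)[OF that]
        by (intro zero[OF gdvd] abs_mult_diff_le) (auto simp: minor_def)
      ultimately show False using proportional_primitive_pairs_eq[OF vv(1,2)] vv(3) by simp
    qed
    then show ?thesis by simp
  qed
  let ?B = "real p ^ ((L * m + \<kappa>) * n) / real p ^ ((\<theta> + \<theta>') * n)"
  have cB: "?c a a' \<le> ?B" for a a'
  proof -
    have "real (card {x \<in> Box L. strip \<theta> q a x \<and> strip \<theta>' q' a' x} * p ^ ((\<theta> + \<theta>') * n)) \<le> real (p ^ ((L * m + \<kappa>) * n))"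
      using strip_pair_count[OF q(3) q'(3) le \<kappa>] by (simp only: of_nat_le_iff)
    then show ?thesis using p0 by (simp add: pos_le_divide_eq)
  qed
  have "?sum = (\<Sum>(a, a')\<in>heights n R \<times> heights n R'.
      if (q, a) \<in> primitive_pairs R \<and> (q', a') \<in> primitive_pairs R' \<and> (q, a) \<noteq> (q', a') then ?c a a' else 0)"
    by (rule sum.cartesian_product)
  also have "\<dots> = (\<Sum>(a, a')\<in>W. ?c a a')"
  proof (rule sum.mono_neutral_cong_right)
    show "\<forall>i\<in>heights n R \<times> heights n R' - W. (case i of (a, a') \<Rightarrow>
        if (q, a) \<in> primitive_pairs R \<and> (q', a') \<in> primitive_pairs R' \<and> (q, a) \<noteq> (q', a') then ?c a a' else 0) = 0"
    proof
      fix x assume x: "x \<in> heights n R \<times> heights n R' - W"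
      obtain a a' where xe: "x = (a, a')" by fastforce
      have z: "{x \<in> Box L. strip \<theta> q a x \<and> strip \<theta>' q' a' x} = {}"
        if "(q, a) \<in> primitive_pairs R \<and> (q', a') \<in> primitive_pairs R' \<and> (q, a) \<noteq> (q', a')"
        using that x unfolding xe W_def by blast
      then show "(case x of (a, a') \<Rightarrow>
        if (q, a) \<in> primitive_pairs R \<and> (q', a') \<in> primitive_pairs R' \<and> (q, a) \<noteq> (q', a') then ?c a a' else 0) = 0"
      proof (cases "(q, a) \<in> primitive_pairs R \<and> (q', a') \<in> primitive_pairs R' \<and> (q, a) \<noteq> (q', a')")
        case True
        show ?thesis unfolding xe prod.case if_P[OF True] z[OF True] card.empty of_nat_0 ..
      next
        case False
        show ?thesis unfolding xe prod.case if_not_P[OF False] ..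
      qed
    qed
    show "W \<subseteq> heights n R \<times> heights n R'" by (rule Wsub)
    fix x assume "x \<in> W"
    then show "(case x of (a, a') \<Rightarrow>
        if (q, a) \<in> primitive_pairs R \<and> (q', a') \<in> primitive_pairs R' \<and> (q, a) \<noteq> (q', a') then ?c a a' else 0) = (case x of (a, a') \<Rightarrow> ?c a a')"
      unfolding W_def by auto
  qed simp
  also have "\<dots> \<le> of_nat (card W) * ?B"
    using cB by (intro sum_bounded_above) auto
  also have "\<dots> \<le> (51 * (real R * real R' / real p ^ \<kappa>)) ^ n * ?B"
    using cW by (intro mult_right_mono) auto
  also have "\<dots> = 51 ^ n * (real R * real R') ^ n * real p ^ (L * (m * n)) / real p ^ ((\<theta> + \<theta>') * n)"
  proof -
    have "(L * m + \<kappa>) * n = L * (m * n) + \<kappa> * n" by (simp add: algebra_simps)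
    then have "real p ^ ((L * m + \<kappa>) * n) = real p ^ (L * (m * n)) * (real p ^ \<kappa>) ^ n"
      by (simp only: power_add power_mult[symmetric])
    then show ?thesis using P0 by (simp add: power_mult_distrib power_divide)
  qed
  finally show ?thesis .
qed

end

section \<open>The local Khintchine--Groshev estimate\<close>

lemma not_summable_sum_ge:
  fixes u :: "nat \<Rightarrow> real"
  assumes "\<not> summable u" and nonneg: "\<And>t. 0 \<le> u t"
  obtains t1 where "B \<le> (\<Sum>t=t0..t1. u t)"
proof -
  obtain N where N: "B + (\<Sum>t<t0. u t) < (\<Sum>t<N. u t)"
    using summableI_nonneg_bounded[OF nonneg] assms(1) by (meson not_le)
  have "(\<Sum>t<N. u t) \<le> (\<Sum>t\<in>{..<t0} \<union> {t0..N}. u t)"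
    using nonneg by (intro sum_mono2) auto
  also have "\<dots> = (\<Sum>t<t0. u t) + (\<Sum>t=t0..N. u t)"
    by (rule sum.union_disjoint) auto
  finally show thesis using N that[of N] by linarith
qed

context padic_grid
begin

definition strip_set :: "nat \<Rightarrow> nat \<Rightarrow> (nat \<Rightarrow> int) \<times> (nat \<Rightarrow> int) \<Rightarrow> (nat \<times> nat \<Rightarrow> int) set" where
  "strip_set L \<theta> v = {x \<in> Box L. strip \<theta> (fst v) (snd v) x}"

lemma strip_set_Int: "strip_set L \<theta> (q, a) \<inter> strip_set L \<theta>' (q', a') =
    {x \<in> Box L. strip \<theta> q a x \<and> strip \<theta>' q' a' x}"
  unfolding strip_set_def by auto

text \<open>Extending the summand by 0 to all heights frees the order of summation, so that
  \<open>q\<close> and \<open>q'\<close> can be fixed and \<open>strip_pair_sum_fixed_q\<close>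
  applied. Removing \<open>v\<close> from the inner sum keeps out the diagonal, where independence
  fails.\<close>

lemma strip_set_pair_sum:
  assumes le: "\<theta> \<le> L" "\<theta>' \<le> L"
  shows "(\<Sum>v\<in>primitive_pairs R. \<Sum>w\<in>primitive_pairs R' - {v}. real (card (strip_set L \<theta> v \<inter> strip_set L \<theta>' w)))
    \<le> 51 ^ n * (real R * real R') ^ (m + n) * real p ^ (L * (m * n)) / real p ^ ((\<theta> + \<theta>') * n)"
    (is "?lhs \<le> _")
proof -
  let ?H = "heights m R \<times> heights n R" and ?H' = "heights m R' \<times> heights n R'"
  let ?c = "\<lambda>v w. real (card (strip_set L \<theta> v \<inter> strip_set L \<theta>' w))"
  define h where "h = (\<lambda>v w. if v \<in> primitive_pairs R \<and> w \<in> primitive_pairs R' \<and> v \<noteq> w then ?c v w else 0)"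
  have inner: "(\<Sum>w\<in>primitive_pairs R' - {v}. ?c v w) = (\<Sum>w\<in>?H'. h v w)" if "v \<in> primitive_pairs R" for v
  proof (rule sum.mono_neutral_cong_left)
    show "primitive_pairs R' - {v} \<subseteq> ?H'" using primitive_pairs_subset by blast
    show "\<forall>w\<in>?H' - (primitive_pairs R' - {v}). h v w = 0" unfolding h_def by auto
    fix w assume "w \<in> primitive_pairs R' - {v}"
    then show "?c v w = h v w" unfolding h_def using that by auto
  qed simp
  have "?lhs = (\<Sum>v\<in>primitive_pairs R. \<Sum>w\<in>?H'. h v w)"
    by (rule sum.cong[OF refl]) (rule inner)
  also have "\<dots> = (\<Sum>v\<in>?H. \<Sum>w\<in>?H'. h v w)"
  proof (rule sum.mono_neutral_left)
    show "\<forall>v\<in>?H - primitive_pairs R. (\<Sum>w\<in>?H'. h v w) = 0" unfolding h_def by auto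
  qed (use primitive_pairs_subset in auto)
  also have "\<dots> = (\<Sum>q\<in>heights m R. \<Sum>a\<in>heights n R. \<Sum>q'\<in>heights m R'. \<Sum>a'\<in>heights n R'. h (q, a) (q', a'))"
    by (simp only: sum.cartesian_product' )
  also have "\<dots> = (\<Sum>q\<in>heights m R. \<Sum>q'\<in>heights m R'. \<Sum>a\<in>heights n R. \<Sum>a'\<in>heights n R'. h (q, a) (q', a'))"
    by (intro sum.cong refl sum.swap)
  also have "\<dots> \<le> (\<Sum>q\<in>heights m R. \<Sum>q'\<in>heights m R'.
      51 ^ n * (real R * real R') ^ n * real p ^ (L * (m * n)) / real p ^ ((\<theta> + \<theta>') * n))"
  proof (intro sum_mono)
    fix q q' assume q: "q \<in> heights m R" "q' \<in> heights m R'"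
    show "(\<Sum>a\<in>heights n R. \<Sum>a'\<in>heights n R'. h (q, a) (q', a')) \<le>
        51 ^ n * (real R * real R') ^ n * real p ^ (L * (m * n)) / real p ^ ((\<theta> + \<theta>') * n)"
    proof (cases "int R < 16 * q 0 \<and> \<not> int p dvd q 0 \<and> int R' < 16 * q' 0 \<and> \<not> int p dvd q' 0")
      case True
      then show ?thesis
        using strip_pair_sum_fixed_q[of q R q' R' \<theta> L \<theta>'] q le unfolding h_def strip_set_Int by blast
    next
      case False
      have "h (q, a) (q', a') = 0" for a a' using False unfolding h_def primitive_pairs_def by auto
      then have "(\<Sum>a\<in>heights n R. \<Sum>a'\<in>heights n R'. h (q, a) (q', a')) = 0" by simp
      also have "0 \<le> 51 ^ n * (real R * real R') ^ n * real p ^ (L * (m * n)) / real p ^ ((\<theta> + \<theta>') * n)"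
        by simp
      finally show ?thesis .
    qed
  qed
  also have "\<dots> = 51 ^ n * (real R * real R') ^ (m + n) * real p ^ (L * (m * n)) / real p ^ ((\<theta> + \<theta>') * n)"
    by (simp add: card_heights power_add power_mult_distrib)
  finally show ?thesis .
qed

lemma card_strip_set:
  assumes "\<not> int p dvd q 0" "\<theta> \<le> L"
  shows "real (card (strip_set L \<theta> (q, a))) = real p ^ (L * (m * n)) / real p ^ (n * \<theta>)"
proof -
  let ?E = "\<lambda>ij\<in>idx. 0 :: int"
  have E: "red 0 y = ?E" for y unfolding red_def by simp
  have "?E \<in> Box 0" using red_Box[of 0] unfolding E .
  moreover have "strip 0 q a ?E" unfolding strip_def by simp
  ultimately have "card {y \<in> Box L. red 0 y = ?E \<and> strip \<theta> q a y} = p ^ (((L - 0) * (m - 1) + (L - \<theta>)) * n)"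
    using assms by (intro strip_count) auto
  then have "card (strip_set L \<theta> (q, a)) = p ^ ((L * (m - 1) + (L - \<theta>)) * n)"
    unfolding strip_set_def E by simp
  moreover have "(L * (m - 1) + (L - \<theta>)) * n + n * \<theta> = L * (m * n)"
  proof -
    obtain k where k: "m = Suc k" using m0 by (cases m) auto
    obtain r where r: "L = \<theta> + r" using assms(2) le_Suc_ex by blast
    show ?thesis unfolding k r by (simp add: algebra_simps)
  qed
  ultimately have "real (card (strip_set L \<theta> (q, a))) * real p ^ (n * \<theta>) = real p ^ (L * (m * n))"
    by (simp flip: power_add)
  then show ?thesis using p0 by (simp add: eq_divide_eq)
qed

text \<open>In the block \<open>16 ^ t\<close> the entry \<open>q 0\<close> is greater than
  \<open>16 ^ t / 16\<close> and at most \<open>16 ^ t\<close>; these ranges are disjoint for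
  different \<open>t\<close>.\<close>

lemma primitive_pairs_disjoint:
  assumes "v \<in> primitive_pairs (16 ^ t)" "v \<in> primitive_pairs (16 ^ t')"
  shows "t = t'"
proof -
  have False if *: "v \<in> primitive_pairs (16 ^ t)" "v \<in> primitive_pairs (16 ^ t')" "t < t'" for t t'
  proof -
    obtain q a where v: "v = (q, a)" by fastforce
    have "q 0 \<le> int (16 ^ t)" using *(1) heights_bound[OF _ m0] unfolding v primitive_pairs_def by blast
    moreover have "int (16 ^ t') < 16 * q 0" using *(2) unfolding v primitive_pairs_def by blast
    moreover have "16 ^ Suc t \<le> (16 ^ t' :: nat)" using *(3) by (intro power_increasing) auto
    then have "16 * int (16 ^ t) \<le> int (16 ^ t')" by (simp flip: of_nat_le_iff[where 'a = int])
    ultimately show False by linarith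
  qed
  then show ?thesis using assms by (meson linorder_neqE_nat)
qed

text \<open>Second moment method. Divergence is used to make the sum \<open>S\<close> of the
  \<open>u t\<close> at least 1. The total size of the strips is at least \<open>S * M / 10\<close>,
  and the sum of all overlaps at most \<open>(51 ^ n + 1) * S ^ 2 * M\<close>, where the 1 accounts
  for the diagonal \<open>S * M \<le> S ^ 2 * M\<close>. In the quotient \<open>S\<close> cancels,
  so the proportion depends on \<open>n\<close> alone and not on the widths.\<close>

lemma strips_cover_proportion:
  fixes \<theta> :: "nat \<Rightarrow> nat"
  assumes "\<not> summable (\<lambda>t. 16 ^ (t * (m + n)) / real p ^ (n * \<theta> t))"
  shows "\<exists>t1. \<forall>L. (\<forall>t\<in>{t0..t1}. \<theta> t \<le> L) \<longrightarrow> real p ^ (L * (m * n)) / (100 * (51 ^ n + 1)) \<le>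
    real (card {x \<in> Box L. \<exists>t\<in>{t0..t1}. \<exists>(q, a)\<in>primitive_pairs (16 ^ t). strip (\<theta> t) q a x})"
proof -
  define u where "u = (\<lambda>t. 16 ^ (t * (m + n)) / real p ^ (n * \<theta> t))"
  have u0: "0 \<le> u t" for t unfolding u_def by simp
  obtain t1 where t1: "1 \<le> (\<Sum>t=t0..t1. u t)"
    using not_summable_sum_ge[of u 1 t0] assms u0 unfolding u_def by blast
  define S where "S = (\<Sum>t=t0..t1. u t)"
  have S1: "1 \<le> S" using t1 unfolding S_def .
  have "real p ^ (L * (m * n)) / (100 * (51 ^ n + 1)) \<le>
      real (card {x \<in> Box L. \<exists>t\<in>{t0..t1}. \<exists>(q, a)\<in>primitive_pairs (16 ^ t). strip (\<theta> t) q a x})"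
    if L: "\<forall>t\<in>{t0..t1}. \<theta> t \<le> L" for L
  proof -
    define M where "M = real p ^ (L * (m * n))"
    have M0: "0 < M" unfolding M_def using p0 by simp
    define T where "T = (SIGMA t:{t0..t1}. primitive_pairs (16 ^ t))"
    define F where "F = (\<lambda>(t, v). strip_set L (\<theta> t) v)"
    have finT: "finite T" unfolding T_def by (intro finite_SigmaI) auto
    have FB: "F \<alpha> \<subseteq> Box L" for \<alpha> unfolding F_def strip_set_def by (cases \<alpha>) auto
    have U: "{x \<in> Box L. \<exists>t\<in>{t0..t1}. \<exists>(q, a)\<in>primitive_pairs (16 ^ t). strip (\<theta> t) q a x} = (\<Union>\<alpha>\<in>T. F \<alpha>)"
      unfolding T_def F_def strip_set_def by fastforce
    have cF: "real (card (strip_set L (\<theta> t) v)) = M / real p ^ (n * \<theta> t)" if "t \<in> {t0..t1}" "v \<in> primitive_pairs (16 ^ t)" for t v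
    proof -
      obtain q a where v: "v = (q, a)" by fastforce
      have "\<not> int p dvd q 0" using that(2) unfolding v primitive_pairs_def by blast
      then show ?thesis unfolding v M_def using L that(1) by (intro card_strip_set) auto
    qed
    have Vle: "real (card (primitive_pairs (16 ^ t))) * (M / real p ^ (n * \<theta> t)) \<le> u t * M" for t
    proof -
      have "real (card (primitive_pairs (16 ^ t))) \<le> real ((16 ^ t) ^ (m + n))"
        using card_primitive_pairs_le by (simp only: of_nat_le_iff)
      also have "\<dots> = 16 ^ (t * (m + n))" by (simp add: power_mult)
      finally have "real (card (primitive_pairs (16 ^ t))) * (M / real p ^ (n * \<theta> t)) \<le> 16 ^ (t * (m + n)) * (M / real p ^ (n * \<theta> t))"
        using M0 by (intro mult_right_mono) auto
      then show ?thesis unfolding u_def by simp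
    qed
    have Vge: "u t * M / 10 \<le> real (card (primitive_pairs (16 ^ t))) * (M / real p ^ (n * \<theta> t))" for t
    proof -
      have "16 ^ (t * (m + n)) / 10 \<le> real (card (primitive_pairs (16 ^ t)))"
        using card_primitive_pairs_ge[of "16 ^ t"] by (simp add: power_mult)
      then have "16 ^ (t * (m + n)) / 10 * (M / real p ^ (n * \<theta> t)) \<le> real (card (primitive_pairs (16 ^ t))) * (M / real p ^ (n * \<theta> t))"
        using M0 by (intro mult_right_mono) auto
      then show ?thesis unfolding u_def by simp
    qed
    have first: "S * M / 10 \<le> (\<Sum>\<alpha>\<in>T. real (card (F \<alpha>)))"
    proof -
      have "S * M / 10 = (\<Sum>t=t0..t1. u t * M / 10)"
        unfolding S_def by (simp add: sum_distrib_right sum_divide_distrib)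
      also have "\<dots> \<le> (\<Sum>t=t0..t1. real (card (primitive_pairs (16 ^ t))) * (M / real p ^ (n * \<theta> t)))"
        by (intro sum_mono Vge)
      also have "\<dots> = (\<Sum>t=t0..t1. \<Sum>v\<in>primitive_pairs (16 ^ t). M / real p ^ (n * \<theta> t))" by simp
      also have "\<dots> = (\<Sum>t=t0..t1. \<Sum>v\<in>primitive_pairs (16 ^ t). real (card (strip_set L (\<theta> t) v)))"
        by (intro sum.cong refl cF[symmetric])
      also have "\<dots> = (\<Sum>\<alpha>\<in>T. real (card (F \<alpha>)))"
        unfolding T_def F_def by (subst sum.Sigma) (auto intro!: sum.cong)
      finally show ?thesis .
    qed
    have cross: "(\<Sum>v\<in>primitive_pairs (16 ^ t). \<Sum>w\<in>primitive_pairs (16 ^ t'). real (card (strip_set L (\<theta> t) v \<inter> strip_set L (\<theta> t') w)))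
        \<le> 51 ^ n * u t * u t' * M + (if t = t' then u t * M else 0)" if tt: "t \<in> {t0..t1}" "t' \<in> {t0..t1}" for t t'
    proof -
      let ?c = "\<lambda>v w. real (card (strip_set L (\<theta> t) v \<inter> strip_set L (\<theta> t') w))"
      have split: "(\<Sum>w\<in>primitive_pairs (16 ^ t'). ?c v w) \<le> (\<Sum>w\<in>primitive_pairs (16 ^ t') - {v}. ?c v w)
          + (if t = t' then M / real p ^ (n * \<theta> t) else 0)" if v: "v \<in> primitive_pairs (16 ^ t)" for v
      proof (cases "v \<in> primitive_pairs (16 ^ t')")
        case True
        then have t: "t = t'" using primitive_pairs_disjoint v by blast
        have "(\<Sum>w\<in>primitive_pairs (16 ^ t'). ?c v w) = ?c v v + (\<Sum>w\<in>primitive_pairs (16 ^ t') - {v}. ?c v w)"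
          using True by (intro sum.remove) auto
        moreover have "?c v v = M / real p ^ (n * \<theta> t)" using cF[OF tt(1) v] t by simp
        ultimately show ?thesis using t by simp
      next
        case False
        then show ?thesis using M0 by simp
      qed
      have "(\<Sum>v\<in>primitive_pairs (16 ^ t). \<Sum>w\<in>primitive_pairs (16 ^ t'). ?c v w) \<le> (\<Sum>v\<in>primitive_pairs (16 ^ t). (\<Sum>w\<in>primitive_pairs (16 ^ t') - {v}. ?c v w)
          + (if t = t' then M / real p ^ (n * \<theta> t) else 0))"
        by (intro sum_mono split)
      also have "\<dots> = (\<Sum>v\<in>primitive_pairs (16 ^ t). \<Sum>w\<in>primitive_pairs (16 ^ t') - {v}. ?c v w)
          + real (card (primitive_pairs (16 ^ t))) * (if t = t' then M / real p ^ (n * \<theta> t) else 0)"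
        by (simp only: sum.distrib sum_constant)
      also have "(\<Sum>v\<in>primitive_pairs (16 ^ t). \<Sum>w\<in>primitive_pairs (16 ^ t') - {v}. ?c v w) \<le>
          51 ^ n * (real (16 ^ t) * real (16 ^ t')) ^ (m + n) * M / real p ^ ((\<theta> t + \<theta> t') * n)"
        unfolding M_def using L tt by (intro strip_set_pair_sum) auto
      also have "51 ^ n * (real (16 ^ t) * real (16 ^ t')) ^ (m + n) * M / real p ^ ((\<theta> t + \<theta> t') * n) = 51 ^ n * u t * u t' * M"
      proof -
        have "(real (16 ^ t) * real (16 ^ t')) ^ (m + n) = 16 ^ (t * (m + n)) * 16 ^ (t' * (m + n))"
          by (simp add: power_mult power_mult_distrib)
        moreover have "real p ^ ((\<theta> t + \<theta> t') * n) = real p ^ (n * \<theta> t) * real p ^ (n * \<theta> t')"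
          by (simp add: algebra_simps flip: power_add)
        ultimately show ?thesis unfolding u_def by simp
      qed
      also have "real (card (primitive_pairs (16 ^ t))) * (if t = t' then M / real p ^ (n * \<theta> t) else 0) \<le> (if t = t' then u t * M else 0)"
        using Vle[of t] Vle[of t'] by (cases "t = t'") simp_all
      finally show ?thesis by simp
    qed
    have "(\<Sum>\<alpha>\<in>T. \<Sum>\<beta>\<in>T. real (card (F \<alpha> \<inter> F \<beta>))) =
        (\<Sum>t=t0..t1. \<Sum>v\<in>primitive_pairs (16 ^ t). \<Sum>t'=t0..t1. \<Sum>w\<in>primitive_pairs (16 ^ t').
          real (card (strip_set L (\<theta> t) v \<inter> strip_set L (\<theta> t') w)))"
      unfolding T_def F_def by (subst (1 2) sum.Sigma) (auto intro!: sum.cong)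
    also have "\<dots> = (\<Sum>t=t0..t1. \<Sum>t'=t0..t1. \<Sum>v\<in>primitive_pairs (16 ^ t). \<Sum>w\<in>primitive_pairs (16 ^ t').
          real (card (strip_set L (\<theta> t) v \<inter> strip_set L (\<theta> t') w)))"
      by (intro sum.cong refl sum.swap)
    also have "\<dots> \<le> (\<Sum>t=t0..t1. \<Sum>t'=t0..t1. 51 ^ n * u t * u t' * M + (if t = t' then u t * M else 0))"
      by (intro sum_mono cross)
    also have "\<dots> = 51 ^ n * M * S ^ 2 + S * M"
    proof -
      have "(\<Sum>t=t0..t1. \<Sum>t'=t0..t1. 51 ^ n * u t * u t' * M) = 51 ^ n * M * (S * S)"
      proof -
        have "51 ^ n * M * (S * S) = (\<Sum>t=t0..t1. \<Sum>t'=t0..t1. 51 ^ n * M * (u t * u t'))"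
          unfolding S_def sum_product by (simp only: sum_distrib_left)
        also have "\<dots> = (\<Sum>t=t0..t1. \<Sum>t'=t0..t1. 51 ^ n * u t * u t' * M)"
          by (intro sum.cong refl) (simp only: ac_simps)
        finally show ?thesis by simp
      qed
      moreover have "(\<Sum>t=t0..t1. \<Sum>t'=t0..t1. if t = t' then u t * M else 0) = S * M"
        unfolding S_def by (simp add: sum_distrib_right)
      ultimately show ?thesis by (simp add: sum.distrib power2_eq_square)
    qed
    also have "\<dots> \<le> M * (51 ^ n + 1) * S ^ 2"
      using S1 M0 by (simp add: algebra_simps power2_eq_square)
    finally have second: "(\<Sum>\<alpha>\<in>T. \<Sum>\<beta>\<in>T. real (card (F \<alpha> \<inter> F \<beta>))) \<le> M * (51 ^ n + 1) * S ^ 2" .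
    have "(S * M / 10) ^ 2 \<le> (\<Sum>\<alpha>\<in>T. real (card (F \<alpha>))) ^ 2"
      using first S1 M0 by (intro power_mono) auto
    also have "\<dots> \<le> real (card (\<Union>\<alpha>\<in>T. F \<alpha>)) * (\<Sum>\<alpha>\<in>T. \<Sum>\<beta>\<in>T. real (card (F \<alpha> \<inter> F \<beta>)))"
      by (rule chung_erdos[OF finite_Box finT]) (rule FB)
    also have "\<dots> \<le> real (card (\<Union>\<alpha>\<in>T. F \<alpha>)) * (M * (51 ^ n + 1) * S ^ 2)"
      using second by (intro mult_left_mono) auto
    finally have "(M * S ^ 2) * (M / 100) \<le> (M * S ^ 2) * (real (card (\<Union>\<alpha>\<in>T. F \<alpha>)) * (51 ^ n + 1))"
      by (simp add: power2_eq_square algebra_simps)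
    moreover have "0 < M * S ^ 2" using M0 S1 by simp
    ultimately have "M / 100 \<le> real (card (\<Union>\<alpha>\<in>T. F \<alpha>)) * (51 ^ n + 1)"
      by (simp only: mult_le_cancel_left_pos)
    moreover have "0 < (51 ^ n + 1 :: real)" by (simp add: add_pos_pos)
    ultimately have "M / 100 / (51 ^ n + 1) \<le> real (card (\<Union>\<alpha>\<in>T. F \<alpha>))"
      by (simp only: pos_divide_le_eq)
    then show ?thesis unfolding U M_def by simp
  qed
  then show ?thesis by blast
qed

text \<open>The form that primitive pairs take after an affine change of variables: entries may be
  negative and coprimality is lost, but \<open>q 0\<close> stays prime to \<open>p\<close>. The
  bound \<open>T \<le> q 0\<close> forces large heights.\<close>

definition resonant :: "nat \<Rightarrow> nat \<Rightarrow> ((nat \<Rightarrow> int) \<times> (nat \<Rightarrow> int)) set" where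
  "resonant T R = {(q, a). q \<in> int_vectors m \<and> a \<in> int_vectors n \<and> \<not> int p dvd q 0 \<and> int T \<le> q 0 \<and>
     (\<forall>i<m. \<bar>q i\<bar> \<le> int R) \<and> (\<forall>j<n. \<bar>a j\<bar> \<le> int R)}"

lemma strip_rescale:
  assumes "strip \<theta> q a x"
  shows "strip (s + \<theta>) q (\<lambda>j\<in>{..<n}. int p ^ s * a j - (\<Sum>i<m. q i * b (i, j))) (\<lambda>ij\<in>idx. b ij + int p ^ s * x ij)"
proof -
  have "int p ^ (s + \<theta>) dvd (\<Sum>i<m. q i * (b (i, j) + int p ^ s * x (i, j))) + (int p ^ s * a j - (\<Sum>i<m. q i * b (i, j)))"
    if "j < n" for j
  proof -
    have "(\<Sum>i<m. q i * (b (i, j) + int p ^ s * x (i, j))) + (int p ^ s * a j - (\<Sum>i<m. q i * b (i, j)))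
        = int p ^ s * ((\<Sum>i<m. q i * x (i, j)) + a j)"
      by (simp add: algebra_simps sum.distrib sum_distrib_left)
    then show ?thesis using assms that unfolding strip_def by (simp add: power_add mult_dvd_mono)
  qed
  then show ?thesis unfolding strip_def idx_def by simp
qed

text \<open>The affine map \<open>x \<mapsto> b + p ^ s * x\<close> sends strips to strips, so that the global estimate for the
  shifted sequence \<open>\<theta> (t + e) - s\<close> yields the local one with the same constant.\<close>

lemma strips_cover_proportion_local:
  fixes \<theta> :: "nat \<Rightarrow> nat"
  assumes div: "\<not> summable (\<lambda>t. 16 ^ (t * (m + n)) / real p ^ (n * \<theta> t))" and s\<theta>: "\<And>t. s \<le> \<theta> t"
  shows "\<exists>t1. \<forall>L\<ge>s. (\<forall>t\<le>t1. \<theta> t \<le> L) \<longrightarrow> (\<forall>b\<in>Box s. real p ^ ((L - s) * (m * n)) / (100 * (51 ^ n + 1)) \<le>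
    real (card {x \<in> Box L. red s x = b \<and> (\<exists>t\<le>t1. \<exists>(q, a)\<in>resonant T (16 ^ t). strip (\<theta> t) q a x)}))"
proof -
  \<comment> \<open>Rescaling turns \<open>a\<close> into \<open>p ^ s * a - q b\<close>, which
    enlarges heights at most by the factor \<open>(m + 1) * p ^ s\<close>; a shift by
    \<open>e\<close> blocks makes room for it.\<close>
  obtain e where e: "(m + 1) * p ^ s < 16 ^ e"
    using power_gt_expt[of "16::nat" "(m + 1) * p ^ s"] by auto
  define \<theta>' where "\<theta>' = (\<lambda>t. \<theta> (t + e) - s)"
  have "\<not> summable (\<lambda>t. 16 ^ (t * (m + n)) / real p ^ (n * \<theta>' t))"
  proof
    assume sm: "summable (\<lambda>t. 16 ^ (t * (m + n)) / real p ^ (n * \<theta>' t))"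
    have "16 ^ ((t + e) * (m + n)) / real p ^ (n * \<theta> (t + e)) =
        16 ^ (e * (m + n)) / real p ^ (n * s) * (16 ^ (t * (m + n)) / real p ^ (n * \<theta>' t))" for t
    proof -
      have "n * \<theta> (t + e) = n * s + n * \<theta>' t" unfolding \<theta>'_def using s\<theta>[of "t + e"]
        by (simp flip: distrib_left)
      moreover have "(t + e) * (m + n) = e * (m + n) + t * (m + n)" by (simp add: algebra_simps)
      ultimately show ?thesis by (simp only: power_add times_divide_times_eq)
    qed
    then have "summable (\<lambda>t. 16 ^ ((t + e) * (m + n)) / real p ^ (n * \<theta> (t + e)))"
      using summable_mult[OF sm, of "16 ^ (e * (m + n)) / real p ^ (n * s)"] by simp
    then show False using div summable_iff_shift[of "\<lambda>t. 16 ^ (t * (m + n)) / real p ^ (n * \<theta> t)" e] by blast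
  qed
  \<comment> \<open>Starting at \<open>T + 1\<close> yields
    \<open>16 * q 0 > 16 ^ (T + 1) > 16 * T\<close>, the lower bound that \<open>resonant\<close>
    asks for.\<close>
  from strips_cover_proportion[OF this, of "T + 1"]
  obtain t1 where t1: "\<And>L. (\<forall>t\<in>{T + 1..t1}. \<theta>' t \<le> L) \<Longrightarrow> real p ^ (L * (m * n)) / (100 * (51 ^ n + 1)) \<le>
    real (card {x \<in> Box L. \<exists>t\<in>{T + 1..t1}. \<exists>(q, a)\<in>primitive_pairs (16 ^ t). strip (\<theta>' t) q a x})" by blast
  have res: "\<exists>(q', a')\<in>resonant T (16 ^ (t + e)). strip (\<theta> (t + e)) q' a' (\<lambda>ij\<in>idx. b ij + int p ^ s * x ij)"
    if va: "(q, a) \<in> primitive_pairs (16 ^ t)" "strip (\<theta>' t) q a x" and t: "T + 1 \<le> t" and b: "b \<in> Box s" for q a x t b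
  proof -
    let ?a = "\<lambda>j\<in>{..<n}. int p ^ s * a j - (\<Sum>i<m. q i * b (i, j))"
    have h: "q \<in> heights m (16 ^ t)" "a \<in> heights n (16 ^ t)" "\<not> int p dvd q 0" "int (16 ^ t) < 16 * q 0"
      using va(1) unfolding primitive_pairs_def by auto
    have R: "int (16 ^ (t + e)) = 16 ^ t * 16 ^ e" by (simp add: power_add)
    have e': "(int m + 1) * int p ^ s \<le> 16 ^ e"
    proof -
      have "int ((m + 1) * p ^ s) \<le> int (16 ^ e)" using e by (simp only: of_nat_le_iff less_imp_le)
      then show ?thesis by (simp add: distrib_right)
    qed
    have e1: "(1::int) \<le> 16 ^ e" by simp
    have qb: "1 \<le> q i \<and> q i \<le> 16 ^ t" if "i < m" for i using heights_bound[OF h(1) that] by simp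
    have ab: "1 \<le> a j \<and> a j \<le> 16 ^ t" if "j < n" for j using heights_bound[OF h(2) that] by simp
    have bb: "0 \<le> b (i, j) \<and> b (i, j) < int p ^ s" if "i < m" "j < n" for i j
      using b that PiE_mem[of b idx "\<lambda>_. {0..<int p ^ s}" "(i, j)"] unfolding Box_def idx_def by simp
    have "int T < 2 ^ T" by (rule of_nat_less_two_power)
    also have "\<dots> \<le> (16::int) ^ T" by (rule power_mono) auto
    finally have "16 * int T < 16 ^ (T + 1)" by simp
    also have "\<dots> \<le> (16::int) ^ t" using t by (intro power_increasing) auto
    also have "\<dots> < 16 * q 0" using h(4) by simp
    finally have "int T \<le> q 0" by simp
    moreover have "\<bar>q i\<bar> \<le> int (16 ^ (t + e))" if "i < m" for i
    proof -
      have "\<bar>q i\<bar> \<le> 16 ^ t * 1" using qb[OF that] by simp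
      also have "\<dots> \<le> 16 ^ t * 16 ^ e" by (intro mult_left_mono e1) simp
      finally show ?thesis unfolding R .
    qed
    moreover have "\<bar>?a j\<bar> \<le> int (16 ^ (t + e))" if j: "j < n" for j
    proof -
      have "(\<Sum>i<m. q i * b (i, j)) \<le> (\<Sum>i<m. 16 ^ t * int p ^ s)"
        using qb bb[OF _ j] by (intro sum_mono mult_mono) (auto intro: less_imp_le order_trans[of 0 1])
      moreover have "0 \<le> (\<Sum>i<m. q i * b (i, j))"
        using qb bb[OF _ j] by (intro sum_nonneg mult_nonneg_nonneg) (auto intro: order_trans[of 0 1])
      moreover have "0 \<le> int p ^ s * a j" using ab[OF j] by simp
      moreover have "int p ^ s * a j \<le> int p ^ s * 16 ^ t" using ab[OF j] by (intro mult_left_mono) auto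
      ultimately have "\<bar>int p ^ s * a j - (\<Sum>i<m. q i * b (i, j))\<bar> \<le> 16 ^ t * ((int m + 1) * int p ^ s)"
        by (simp add: algebra_simps abs_le_iff)
      also have "\<dots> \<le> 16 ^ t * 16 ^ e" by (intro mult_left_mono e') simp
      finally show ?thesis unfolding R using j by simp
    qed
    moreover have "q \<in> int_vectors m" using h(1) unfolding heights_def int_vectors_def by (auto simp: PiE_iff)
    moreover have "?a \<in> int_vectors n" unfolding int_vectors_def by simp
    ultimately have "(q, ?a) \<in> resonant T (16 ^ (t + e))" unfolding resonant_def using h(3) by simp
    moreover have "s + \<theta>' t = \<theta> (t + e)" unfolding \<theta>'_def using s\<theta> by simp
    then have "strip (\<theta> (t + e)) q ?a (\<lambda>ij\<in>idx. b ij + int p ^ s * x ij)"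
      using strip_rescale[OF va(2), of s b] by simp
    ultimately show ?thesis by blast
  qed
  have "real p ^ ((L - s) * (m * n)) / (100 * (51 ^ n + 1)) \<le>
      real (card {x \<in> Box L. red s x = b \<and> (\<exists>t\<le>t1 + e. \<exists>(q, a)\<in>resonant T (16 ^ t). strip (\<theta> t) q a x)})"
      (is "_ \<le> real (card ?A)") if L: "s \<le> L" "\<forall>t\<le>t1 + e. \<theta> t \<le> L" and b: "b \<in> Box s" for L b
  proof -
    let ?h = "\<lambda>x. \<lambda>ij\<in>idx. b ij + int p ^ s * x ij"
    let ?B = "{x \<in> Box (L - s). \<exists>t\<in>{T + 1..t1}. \<exists>(q, a)\<in>primitive_pairs (16 ^ t). strip (\<theta>' t) q a x}"
    have "\<theta>' t \<le> L - s" if "t \<in> {T + 1..t1}" for t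
      using L(2) that unfolding \<theta>'_def by (simp add: diff_le_mono)
    then have "real p ^ ((L - s) * (m * n)) / (100 * (51 ^ n + 1)) \<le> real (card ?B)"
      by (intro t1) blast
    also have "card ?B \<le> card ?A"
    proof (rule card_inj_on_le)
      show "inj_on ?h ?B"
      proof (rule inj_onI)
        fix x y assume xy: "x \<in> ?B" "y \<in> ?B" "?h x = ?h y"
        have "x ij = y ij" for ij
        proof (cases "ij \<in> idx")
          case True
          then show ?thesis using fun_cong[OF xy(3), of ij] p0 by simp
        next
          case False
          then show ?thesis using Box_arb[of x "L - s" ij] Box_arb[of y "L - s" ij] xy(1,2) by simp
        qed
        then show "x = y" by (rule ext)
      qed
      show "?h ` ?B \<subseteq> ?A"
      proof (rule image_subsetI)
        fix x assume x: "x \<in> ?B"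
        then obtain t q a where t: "t \<in> {T + 1..t1}" and v: "(q, a) \<in> primitive_pairs (16 ^ t)" "strip (\<theta>' t) q a x" by blast
        have "b ij + int p ^ s * x ij \<in> {0..<int p ^ L}" if "ij \<in> idx" for ij
        proof -
          have "0 \<le> x ij" "x ij + 1 \<le> int p ^ (L - s)" "0 \<le> b ij" "b ij < int p ^ s"
            using x b that PiE_mem[of x idx "\<lambda>_. {0..<int p ^ (L - s)}" ij] PiE_mem[of b idx "\<lambda>_. {0..<int p ^ s}" ij]
            unfolding Box_def by simp_all
          moreover from this(2) have "int p ^ s * (x ij + 1) \<le> int p ^ s * int p ^ (L - s)"
            by (intro mult_left_mono) auto
          moreover have "int p ^ s * int p ^ (L - s) = int p ^ L" using L(1) by (simp flip: power_add)
          ultimately show ?thesis by (simp add: distrib_left)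
        qed
        then have "?h x \<in> Box L" unfolding Box_def by (intro restrict_PiE_iff[THEN iffD2] ballI)
        moreover have "red s (?h x) = b"
          using red_id[OF b] red_eq_iff[of s "?h x" b] by simp
        moreover have "\<exists>t\<le>t1 + e. \<exists>(q, a)\<in>resonant T (16 ^ t). strip (\<theta> t) q a (?h x)"
          using res[OF v _ b] t by (intro exI[of _ "t + e"]) simp
        ultimately show "?h x \<in> ?A" by blast
      qed
    qed simp
    finally show ?thesis by simp
  qed
  then show ?thesis by blast
qed

end

section \<open>Redistributing mass onto thin strips\<close>

context padic_grid
begin

lemma strip_fibre_exponent:
  assumes "l \<le> \<sigma>" "\<sigma> \<le> L"
  shows "((L - l) * (m - 1) + (L - \<sigma>)) * n + (l * (m * n) + n * (\<sigma> - l)) = L * (m * n)"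
proof -
  obtain k where k: "m = Suc k" using m0 by (cases m) auto
  obtain r where r: "\<sigma> = l + r" using assms(1) le_Suc_ex by blast
  obtain t where t: "L = l + r + t" using assms(2) le_Suc_ex unfolding r by blast
  show ?thesis unfolding k t r by (simp add: algebra_simps)
qed

text \<open>For \<open>l \<le> \<sigma>\<close> a ball of level \<open>l\<close> either misses the
  strip or is counted by \<open>strip_count\<close>. For \<open>l > \<sigma>\<close> the truncated
  difference \<open>\<sigma> - l\<close> is 0 and the bound is the size of the whole ball.\<close>

lemma card_strip_fibre_le:
  assumes q0: "\<not> int p dvd q 0" and le: "l \<le> L" "\<sigma> \<le> L" and E: "E \<in> Box l"
  shows "real (card {y \<in> Box L. red l y = E \<and> strip \<sigma> q a y}) * (real p ^ (l * (m * n)) * real p ^ (n * (\<sigma> - l)))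
    \<le> real p ^ (L * (m * n))"
proof (cases "l \<le> \<sigma>")
  case True
  have "card {y \<in> Box L. red l y = E \<and> strip \<sigma> q a y} \<le> p ^ (((L - l) * (m - 1) + (L - \<sigma>)) * n)"
  proof (cases "strip l q a E")
    case s: True
    show ?thesis using strip_count[OF q0 True le(2) E s] by simp
  next
    case False
    have "\<not> strip \<sigma> q a y" if "red l y = E" for y
      using False strip_antimono[OF _ True, of q a y] strip_red[of l l q a y] that by blast
    then have "{y \<in> Box L. red l y = E \<and> strip \<sigma> q a y} = {}" by blast
    then show ?thesis by (simp only: card.empty)
  qed
  then have "card {y \<in> Box L. red l y = E \<and> strip \<sigma> q a y} * (p ^ (l * (m * n)) * p ^ (n * (\<sigma> - l)))
      \<le> p ^ (((L - l) * (m - 1) + (L - \<sigma>)) * n) * (p ^ (l * (m * n)) * p ^ (n * (\<sigma> - l)))"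
    by (rule mult_le_mono1)
  also have "\<dots> = p ^ (L * (m * n))"
    unfolding power_add[symmetric] strip_fibre_exponent[OF True le(2)] ..
  finally show ?thesis by (simp only: of_nat_le_iff flip: of_nat_power of_nat_mult)
next
  case False
  have "card {y \<in> Box L. red l y = E \<and> strip \<sigma> q a y} \<le> card {y \<in> Box L. red l y = E}"
    by (rule card_mono) (simp, blast)
  also have "\<dots> = p ^ ((L - l) * (m * n))" by (rule card_red_fibre[OF le(1) E])
  finally have "card {y \<in> Box L. red l y = E \<and> strip \<sigma> q a y} * p ^ (l * (m * n)) \<le> p ^ ((L - l) * (m * n)) * p ^ (l * (m * n))"
    by (rule mult_le_mono1)
  also have "\<dots> = p ^ (L * (m * n))" using le(1) by (simp flip: power_add distrib_right)
  finally have "real (card {y \<in> Box L. red l y = E \<and> strip \<sigma> q a y}) * real p ^ (l * (m * n)) \<le> real p ^ (L * (m * n))"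
    by (simp only: of_nat_le_iff flip: of_nat_power of_nat_mult)
  then show ?thesis using False by simp
qed

text \<open>The reason why redistribution conserves mass: in a ball lying inside the strip of its
  own level, the thin strip has relative size exactly \<open>p ^ -(n * (\<sigma> - l))\<close>, and
  weights on it will be raised by the inverse factor.\<close>

lemma card_strip_fibre_eq:
  assumes q0: "\<not> int p dvd q 0" and le: "l \<le> \<sigma>" "\<sigma> \<le> L" and E: "E \<in> Box l" "strip l q a E"
  shows "real (card {y \<in> Box L. red l y = E \<and> strip \<sigma> q a y}) * real p ^ (n * (\<sigma> - l)) = real (card {y \<in> Box L. red l y = E})"
proof -
  have "((L - l) * (m - 1) + (L - \<sigma>)) * n + n * (\<sigma> - l) = (L - l) * (m * n)"
    using strip_fibre_exponent[OF le] le by (simp add: diff_mult_distrib)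
  then have "p ^ (((L - l) * (m - 1) + (L - \<sigma>)) * n) * p ^ (n * (\<sigma> - l)) = p ^ ((L - l) * (m * n))"
    by (simp only: flip: power_add)
  then show ?thesis
    unfolding strip_count[OF q0 le E] card_red_fibre[OF order_trans[OF le] E(1)]
    by (simp only: flip: of_nat_power of_nat_mult)
qed

text \<open>The mass of each maximal ball inside a fat strip of level \<open>\<theta>\<close> is pushed onto the thin strip
  of level \<open>\<sigma>\<close> around the same resonant subspace. Balls of minimal level \<open>\<theta>\<close> are pairwise disjoint,
  so that no mass is counted twice.\<close>

lemma redistribute:
  fixes T :: "(nat \<times> nat \<times> (nat \<Rightarrow> int) \<times> (nat \<Rightarrow> int)) set" and B :: "nat \<Rightarrow> real"
  assumes sL: "s \<le> L" and c: "0 < c"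
    and T: "\<And>\<theta> \<sigma> q a. (\<theta>, \<sigma>, q, a) \<in> T \<Longrightarrow> s \<le> \<theta> \<and> \<theta> \<le> \<sigma> \<and> \<sigma> \<le> L \<and> \<not> int p dvd q 0"
    and dens: "\<And>b. b \<in> Box s \<Longrightarrow> c * real p ^ ((L - s) * (m * n)) \<le>
      real (card {x \<in> Box L. red s x = b \<and> (\<exists>\<theta> \<sigma> q a. (\<theta>, \<sigma>, q, a) \<in> T \<and> strip \<theta> q a x)})"
    and mass: "\<And>\<theta> \<sigma> q a l. (\<theta>, \<sigma>, q, a) \<in> T \<Longrightarrow> \<theta> \<le> l \<Longrightarrow> l \<le> L \<Longrightarrow>
      real p ^ (n * (\<sigma> - \<theta>)) / (real p ^ (l * (m * n)) * real p ^ (n * (\<sigma> - l))) \<le> B l"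
    and B: "\<And>l. 1 / real p ^ (l * (m * n)) \<le> B l"
  obtains k where "\<And>y. 0 \<le> k y"
    and "\<And>y. y \<in> Box L \<Longrightarrow> 0 < k y \<Longrightarrow> \<exists>\<theta> \<sigma> q a. (\<theta>, \<sigma>, q, a) \<in> T \<and> strip \<sigma> q a y"
    and "\<And>b. b \<in> Box s \<Longrightarrow> (\<Sum>y\<in>{y \<in> Box L. red s y = b}. k y) = (1::real)"
    and "\<And>l E. s \<le> l \<Longrightarrow> l \<le> L \<Longrightarrow> E \<in> Box l \<Longrightarrow>
      (\<Sum>y\<in>{y \<in> Box L. red l y = E}. k y) \<le> real p ^ (s * (m * n)) / c * B l"
proof -
  define hit where "hit = (\<lambda>\<theta> x. \<exists>\<sigma> q a. (\<theta>, \<sigma>, q, a) \<in> T \<and> strip \<theta> q a x)"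
  define A where "A = {x \<in> Box L. \<exists>\<theta>. hit \<theta> x}"
  define lev where "lev = (\<lambda>x. LEAST \<theta>. hit \<theta> x)"
  \<comment> \<open>Choosing by level and class, not by point, makes the selected strip constant on
    each ball of minimal level.\<close>
  define sel where "sel = (\<lambda>\<theta> D. SOME z. (\<theta>, z) \<in> T \<and> strip \<theta> (fst (snd z)) (snd (snd z)) D)"
  define sg where "sg = (\<lambda>x. fst (sel (lev x) (red (lev x) x)))"
  define Q where "Q = (\<lambda>x. fst (snd (sel (lev x) (red (lev x) x))))"
  define C where "C = (\<lambda>x. snd (snd (sel (lev x) (red (lev x) x))))"
  define N where "N = (\<lambda>b. real (card {x \<in> A. red s x = b}))"
  \<comment> \<open>Uniform mass \<open>1 / N\<close> on the points of \<open>A\<close> in a ball of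
    level \<open>s\<close>, compressed onto the thin strips by the density
    \<open>p ^ (n * (\<sigma> - \<theta>))\<close>.\<close>
  define k where "k = (\<lambda>y. if y \<in> A \<and> strip (sg y) (Q y) (C y) y then real p ^ (n * (sg y - lev y)) / N (red s y) else 0)"
  have hit_cong: "hit \<theta> x \<longleftrightarrow> hit \<theta> y" if "red \<theta> x = red \<theta> y" for \<theta> x y
    unfolding hit_def using strip_cong[OF that] by blast
  have AB: "x \<in> Box L" if "x \<in> A" for x using that unfolding A_def by blast
  have finA: "finite A" by (rule finite_subset[OF _ finite_Box[of L]]) (use AB in blast)
  have hit_lev: "hit (lev x) x" if "x \<in> A" for x
    using that unfolding A_def lev_def by (auto intro: LeastI)
  have selT: "(lev x, sg x, Q x, C x) \<in> T" "strip (lev x) (Q x) (C x) (red (lev x) x)" if x: "x \<in> A" for x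
  proof -
    obtain \<sigma> q a where "(lev x, \<sigma>, q, a) \<in> T" "strip (lev x) q a x"
      using hit_lev[OF x] unfolding hit_def by blast
    then have "\<exists>z. (lev x, z) \<in> T \<and> strip (lev x) (fst (snd z)) (snd (snd z)) (red (lev x) x)"
      by (intro exI[of _ "(\<sigma>, q, a)"]) (simp add: strip_red)
    from someI_ex[OF this] show "(lev x, sg x, Q x, C x) \<in> T" "strip (lev x) (Q x) (C x) (red (lev x) x)"
      unfolding sg_def Q_def C_def sel_def by simp_all
  qed
  have levb: "s \<le> lev x" "lev x \<le> sg x" "sg x \<le> L" "\<not> int p dvd Q x 0" if "x \<in> A" for x
    using T[OF selT(1)[OF that]] by blast+
  \<comment> \<open>\<open>hit \<theta>\<close> depends only on the class of level
    \<open>\<theta>\<close>, so for all \<open>\<theta> \<le> lev x\<close> it is decided by the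
    ball of level \<open>lev x\<close> around \<open>x\<close>, and \<open>lev\<close> is constant
    on that ball.\<close>
  have loc: "y \<in> A" "lev y = lev x" if x: "x \<in> A" and y: "y \<in> Box L" "red (lev x) y = red (lev x) x" for x y
  proof -
    have h: "hit \<theta> y \<longleftrightarrow> hit \<theta> x" if "\<theta> \<le> lev x" for \<theta>
      by (rule hit_cong[OF red_mono[OF that y(2)]])
    have hy: "hit (lev x) y" using h hit_lev[OF x] by blast
    then show "y \<in> A" using y(1) unfolding A_def by blast
    show "lev y = lev x"
      unfolding lev_def
    proof (rule Least_equality)
      show "hit (LEAST \<theta>. hit \<theta> x) y" using hy unfolding lev_def .
      fix \<theta> assume \<theta>: "hit \<theta> y"
      show "(LEAST \<theta>. hit \<theta> x) \<le> \<theta>"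
      proof (rule ccontr)
        assume "\<not> ?thesis"
        then have lt: "\<theta> < lev x" unfolding lev_def by simp
        then have "hit \<theta> x" using h \<theta> by simp
        then show False using not_less_Least[of \<theta> "\<lambda>\<theta>. hit \<theta> x"] lt unfolding lev_def by blast
      qed
    qed
  qed
  have sel_eq: "sg y = sg x" "Q y = Q x" "C y = C x" if "lev y = lev x" "red (lev x) y = red (lev x) x" for x y
    unfolding sg_def Q_def C_def using that by simp_all
  have N_ge: "c * real p ^ ((L - s) * (m * n)) \<le> N b" if "b \<in> Box s" for b
  proof -
    have "{x \<in> Box L. red s x = b \<and> (\<exists>\<theta> \<sigma> q a. (\<theta>, \<sigma>, q, a) \<in> T \<and> strip \<theta> q a x)} = {x \<in> A. red s x = b}"
      unfolding A_def hit_def by blast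
    then show ?thesis using dens[OF that] unfolding N_def by simp
  qed
  have N_pos: "0 < N b" if "b \<in> Box s" for b
  proof -
    have "0 < c * real p ^ ((L - s) * (m * n))" using c p0 by simp
    then show ?thesis using N_ge[OF that] by linarith
  qed
  have N_inv: "1 / N b \<le> real p ^ (s * (m * n)) / c / real p ^ (L * (m * n))" if "b \<in> Box s" for b
  proof -
    have "1 / N b \<le> 1 / (c * real p ^ ((L - s) * (m * n)))"
      using N_ge[OF that] c p0 by (intro divide_left_mono) (auto intro!: mult_pos_pos N_pos[OF that])
    also have "real p ^ (L * (m * n)) = real p ^ (s * (m * n)) * real p ^ ((L - s) * (m * n))"
      using sL by (simp flip: power_add distrib_right)
    then have "1 / (c * real p ^ ((L - s) * (m * n))) = real p ^ (s * (m * n)) / c / real p ^ (L * (m * n))"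
      using P0 by simp
    finally show ?thesis .
  qed
  have k0: "0 \<le> k y" for y unfolding k_def N_def by simp
  have k_supp: "\<exists>\<theta> \<sigma> q a. (\<theta>, \<sigma>, q, a) \<in> T \<and> strip \<sigma> q a y" if "0 < k y" for y
  proof -
    have "y \<in> A \<and> strip (sg y) (Q y) (C y) y"
    proof (rule ccontr)
      assume "\<not> ?thesis"
      then have "k y = 0" unfolding k_def by (rule if_not_P)
      then show False using that by simp
    qed
    then show ?thesis using selT(1) by blast
  qed
  \<comment> \<open>If all maximal balls that meet \<open>E\<close> are contained in it,
    redistribution only moves mass inside \<open>E\<close>, so \<open>E\<close> keeps the uniform
    mass of its points in \<open>A\<close>.\<close>
  have small: "(\<Sum>y\<in>{y \<in> Box L. red l y = E}. k y) = real (card {y \<in> A. red l y = E}) / N (red s E)"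
    if l: "s \<le> l" "l \<le> L" and E: "E \<in> Box l" and deep: "\<And>x. x \<in> A \<Longrightarrow> red l x = E \<Longrightarrow> l \<le> lev x" for l E
  proof -
    let ?G = "{y \<in> A. red l y = E}"
    let ?\<phi> = "\<lambda>x. (lev x, red (lev x) x)"
    have finG: "finite ?G" using finA by simp
    have b: "red s y = red s E" if "red l y = E" for y
      using red_red[OF l(1), of y] that by simp
    have "(\<Sum>y\<in>{y \<in> Box L. red l y = E}. k y) = (\<Sum>y\<in>?G. k y)"
    proof (rule sum.mono_neutral_right)
      show "?G \<subseteq> {y \<in> Box L. red l y = E}" using AB by blast
      show "\<forall>i\<in>{y \<in> Box L. red l y = E} - ?G. k i = 0" unfolding k_def by auto
    qed simp
    also have "\<dots> = (\<Sum>d\<in>?\<phi> ` ?G. \<Sum>x\<in>{x \<in> ?G. ?\<phi> x = d}. k x)"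
      using finG by (intro sum.group[symmetric]) auto
    also have "\<dots> = (\<Sum>d\<in>?\<phi> ` ?G. \<Sum>x\<in>{x \<in> ?G. ?\<phi> x = d}. 1 / N (red s E))"
    proof (rule sum.cong[OF refl])
      fix d assume "d \<in> ?\<phi> ` ?G"
      then obtain x0 where x0: "x0 \<in> A" "red l x0 = E" and d: "d = ?\<phi> x0" by blast
      define \<theta> where "\<theta> = lev x0"
      define D where "D = red \<theta> x0"
      have l\<theta>: "l \<le> \<theta>" unfolding \<theta>_def by (rule deep[OF x0])
      have \<theta>\<sigma>: "\<theta> \<le> sg x0" "sg x0 \<le> L" unfolding \<theta>_def using levb[OF x0(1)] by auto
      have D: "D \<in> Box \<theta>" "strip \<theta> (Q x0) (C x0) D" unfolding D_def \<theta>_def using selT(2)[OF x0(1)] by simp_all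
      have cls: "{x \<in> ?G. ?\<phi> x = d} = {y \<in> Box L. red \<theta> y = D}"
      proof
        show "{x \<in> ?G. ?\<phi> x = d} \<subseteq> {y \<in> Box L. red \<theta> y = D}"
          unfolding d D_def \<theta>_def using AB by auto
        show "{y \<in> Box L. red \<theta> y = D} \<subseteq> {x \<in> ?G. ?\<phi> x = d}"
        proof
          fix y assume "y \<in> {y \<in> Box L. red \<theta> y = D}"
          then have y: "y \<in> Box L" "red (lev x0) y = red (lev x0) x0" unfolding D_def \<theta>_def by auto
          have "red l y = E" using red_mono[OF l\<theta>[unfolded \<theta>_def] y(2)] x0(2) by simp
          then show "y \<in> {x \<in> ?G. ?\<phi> x = d}" using loc[OF x0(1) y] y(2) unfolding d by simp
        qed
      qed
      have kc: "k y = (if strip (sg x0) (Q x0) (C x0) y then real p ^ (n * (sg x0 - \<theta>)) / N (red s E) else 0)"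
        if "y \<in> {y \<in> Box L. red \<theta> y = D}" for y
      proof -
        have y: "y \<in> Box L" "red (lev x0) y = red (lev x0) x0" using that unfolding D_def \<theta>_def by auto
        have "red s y = red s E" using b red_mono[OF l\<theta>[unfolded \<theta>_def] y(2)] x0(2) by simp
        then show ?thesis
          unfolding k_def sel_eq[OF loc(2)[OF x0(1) y] y(2)] loc(2)[OF x0(1) y] \<theta>_def using loc(1)[OF x0(1) y] by simp
      qed
      have "(\<Sum>x\<in>{x \<in> ?G. ?\<phi> x = d}. k x) = (\<Sum>y\<in>{y \<in> Box L. red \<theta> y = D}.
          if strip (sg x0) (Q x0) (C x0) y then real p ^ (n * (sg x0 - \<theta>)) / N (red s E) else 0)"
        unfolding cls by (rule sum.cong[OF refl]) (rule kc)
      also have "\<dots> = real (card {y \<in> Box L. red \<theta> y = D \<and> strip (sg x0) (Q x0) (C x0) y}) * (real p ^ (n * (sg x0 - \<theta>)) / N (red s E))"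
        by (subst sum.inter_filter[symmetric]) (simp_all add: conj_assoc)
      also have "\<dots> = real (card {y \<in> Box L. red \<theta> y = D}) / N (red s E)"
        using card_strip_fibre_eq[where q = "Q x0", OF levb(4)[OF x0(1)] \<theta>\<sigma> D] by simp
      also have "\<dots> = (\<Sum>x\<in>{x \<in> ?G. ?\<phi> x = d}. 1 / N (red s E))" unfolding cls by simp
      finally show "(\<Sum>x\<in>{x \<in> ?G. ?\<phi> x = d}. k x) = (\<Sum>x\<in>{x \<in> ?G. ?\<phi> x = d}. 1 / N (red s E))" .
    qed
    also have "\<dots> = (\<Sum>x\<in>?G. 1 / N (red s E))"
      using finG by (intro sum.group) auto
    finally show ?thesis by simp
  qed
  show thesis
  proof (rule that[of k])
    show "0 \<le> k y" for y by (rule k0)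
    show "\<exists>\<theta> \<sigma> q a. (\<theta>, \<sigma>, q, a) \<in> T \<and> strip \<sigma> q a y" if "y \<in> Box L" "0 < k y" for y
      using k_supp[OF that(2)] .
    show "(\<Sum>y\<in>{y \<in> Box L. red s y = b}. k y) = 1" if b: "b \<in> Box s" for b
    proof -
      have "(\<Sum>y\<in>{y \<in> Box L. red s y = b}. k y) = real (card {y \<in> A. red s y = b}) / N (red s b)"
        by (rule small[OF order_refl sL b]) (rule levb(1))
      then show ?thesis using N_pos[OF b] unfolding red_id[OF b] N_def by simp
    qed
    show "(\<Sum>y\<in>{y \<in> Box L. red l y = E}. k y) \<le> real p ^ (s * (m * n)) / c * B l"
      if l: "s \<le> l" "l \<le> L" and E: "E \<in> Box l" for l E
    proof (cases "\<exists>x\<in>A. red l x = E \<and> lev x \<le> l")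
      case True
      \<comment> \<open>Here \<open>E\<close> lies inside one maximal ball, so a single thin strip
        carries its whole mass.\<close>
      then obtain x0 where x0: "x0 \<in> A" "red l x0 = E" "lev x0 \<le> l" by blast
      let ?\<sigma> = "sg x0" and ?\<theta> = "lev x0"
      have kc: "k y = (if strip ?\<sigma> (Q x0) (C x0) y then real p ^ (n * (?\<sigma> - ?\<theta>)) / N (red s E) else 0)"
        if "y \<in> {y \<in> Box L. red l y = E}" for y
      proof -
        have y: "y \<in> Box L" "red (lev x0) y = red (lev x0) x0" using that red_mono[OF x0(3), of y x0] x0(2) by auto
        have "red s y = red s E" using red_red[OF l(1), of y] that by auto
        then show ?thesis
          unfolding k_def sel_eq[OF loc(2)[OF x0(1) y] y(2)] loc(2)[OF x0(1) y] using loc(1)[OF x0(1) y] by simp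
      qed
      let ?n = "real (card {y \<in> Box L. red l y = E \<and> strip ?\<sigma> (Q x0) (C x0) y})"
      let ?P = "real p ^ (l * (m * n)) * real p ^ (n * (?\<sigma> - l))"
      have P_pos: "0 < ?P" using p0 by simp
      have "(\<Sum>y\<in>{y \<in> Box L. red l y = E}. k y) = (\<Sum>y\<in>{y \<in> Box L. red l y = E}.
          if strip ?\<sigma> (Q x0) (C x0) y then real p ^ (n * (?\<sigma> - ?\<theta>)) / N (red s E) else 0)"
        by (rule sum.cong[OF refl]) (rule kc)
      also have "\<dots> = ?n * (real p ^ (n * (?\<sigma> - ?\<theta>)) * (1 / N (red s E)))"
        by (subst sum.inter_filter[symmetric]) (simp_all add: conj_assoc)
      also have "\<dots> \<le> (real p ^ (L * (m * n)) / ?P) *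
          (real p ^ (n * (?\<sigma> - ?\<theta>)) * (real p ^ (s * (m * n)) / c / real p ^ (L * (m * n))))"
      proof (intro mult_mono mult_left_mono N_inv)
        show "?n \<le> real p ^ (L * (m * n)) / ?P"
          using card_strip_fibre_le[where q = "Q x0", OF levb(4)[OF x0(1)] l(2) levb(3)[OF x0(1)] E] P_pos
          by (simp only: pos_le_divide_eq)
        show "0 \<le> real p ^ (n * (?\<sigma> - ?\<theta>)) * (1 / N (red s E))" unfolding N_def by simp
      qed (simp_all add: N_def)
      also have "\<dots> = real p ^ (s * (m * n)) / c * (real p ^ (n * (?\<sigma> - ?\<theta>)) / ?P)"
        using P0 by (simp add: mult_ac)
      also have "\<dots> \<le> real p ^ (s * (m * n)) / c * B l"
        using c by (intro mult_left_mono mass[OF selT(1)[OF x0(1)] x0(3) l(2)]) simp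
      finally show ?thesis .
    next
      case False
      \<comment> \<open>Every maximal ball that meets \<open>E\<close> now has level greater than
        \<open>l\<close>, so it lies inside \<open>E\<close> and \<open>small\<close>
        applies.\<close>
      have "(\<Sum>y\<in>{y \<in> Box L. red l y = E}. k y) = real (card {y \<in> A. red l y = E}) * (1 / N (red s E))"
        using small[OF l E] False by (simp, meson nat_le_linear)
      also have "\<dots> \<le> (real p ^ (L * (m * n)) / real p ^ (l * (m * n))) * (real p ^ (s * (m * n)) / c / real p ^ (L * (m * n)))"
      proof (intro mult_mono N_inv)
        have "card {y \<in> A. red l y = E} \<le> card {y \<in> Box L. red l y = E}"
          using AB by (intro card_mono) auto
        also have "\<dots> = p ^ ((L - l) * (m * n))" by (rule card_red_fibre[OF l(2) E])
        finally have "real (card {y \<in> A. red l y = E}) \<le> real p ^ ((L - l) * (m * n))"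
          by (simp only: of_nat_le_iff flip: of_nat_power)
        also have "\<dots> = real p ^ (L * (m * n)) / real p ^ (l * (m * n))"
          using l(2) P0 by (simp add: eq_divide_eq flip: power_add distrib_right)
        finally show "real (card {y \<in> A. red l y = E}) \<le> real p ^ (L * (m * n)) / real p ^ (l * (m * n))" .
      qed (simp_all add: N_def)
      also have "\<dots> = real p ^ (s * (m * n)) / c * (1 / real p ^ (l * (m * n)))"
        using P0 by simp
      also have "\<dots> \<le> real p ^ (s * (m * n)) / c * B l"
        using c by (intro mult_left_mono B) simp
      finally show ?thesis .
    qed
  qed
qed

end

section \<open>Dimension functions along powers of \<open>p\<close>\<close>

locale jarnik = padic_grid +
  fixes \<psi> :: "nat \<Rightarrow> real" and f :: "real \<Rightarrow> real"
  assumes \<psi>_pos: "\<And>r. 1 \<le> r \<Longrightarrow> 0 < \<psi> r"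
    and \<psi>_anti: "antimono_on {1..} \<psi>"
    and f_dim: "dimension_function f"
    and f_inf: "filterlim (\<lambda>r. f r / r ^ (m * n)) at_top (at_right 0)"
    and f_anti: "antimono_on {0<..} (\<lambda>r. f r / r ^ (m * n))"
    and g_mono: "mono_on {0<..} (\<lambda>r. f r / r ^ ((m - 1) * n))"
begin

definition g :: "real \<Rightarrow> real" where "g r = f r / r ^ ((m - 1) * n)"

definition \<phi> :: "nat \<Rightarrow> real" where "\<phi> l = f ((1 / real p) ^ l)"

text \<open>The level of the open ball of radius \<open>r\<close>: p-adic distances are 0 or powers
  of \<open>1 / p\<close>, so for them \<open>< r\<close> and \<open>\<le> (1 / p) ^ lv r\<close>
  mean the same. The level is 0 for every \<open>r > 1\<close>.\<close>

definition lv :: "real \<Rightarrow> nat" where "lv r = (LEAST l. (1 / real p) ^ l < r)"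

abbreviation pp :: "nat \<Rightarrow> real" where "pp \<equiv> power (real p)"

lemma pp_pos [simp]: "0 < pp k" and pp_ge1: "1 \<le> pp k"
  using p0 by simp_all

declare p0 [simp]

lemma inv_pow: "(1 / real p) ^ l = 1 / pp l" by (simp add: power_one_over)

lemma inv_pow_pos [simp]: "0 < (1 / real p) ^ l" using p0 by simp

lemma f_mono: "0 < r \<Longrightarrow> r \<le> r' \<Longrightarrow> f r \<le> f r'"
  using f_dim mono_onD[of "{0<..}" f r r'] unfolding dimension_function_def by simp

text \<open>Positivity is not built into \<open>dimension_function\<close>. Near 0 it follows from
  \<open>f r / r ^ (m * n)\<close> tending to infinity, and monotonicity carries it to all
  radii.\<close>

lemma f_pos:
  assumes "0 < r"
  shows "0 < f r"
proof -
  have "eventually (\<lambda>x. 1 \<le> f x / x ^ (m * n)) (at_right 0)"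
    using f_inf unfolding filterlim_at_top by blast
  then obtain b where b: "0 < b" "\<And>y. 0 < y \<Longrightarrow> y < b \<Longrightarrow> 1 \<le> f y / y ^ (m * n)"
    unfolding eventually_at_right_field by blast
  define y where "y = min r (b / 2)"
  have y: "0 < y" "y < b" "y \<le> r" using b(1) assms unfolding y_def by auto
  then have "0 < f y / y ^ (m * n)" using b(2)[of y] by linarith
  then have "0 < f y" using y(1) by (simp add: zero_less_divide_iff)
  then show ?thesis using f_mono[OF y(1,3)] by linarith
qed

lemma g_pos: "0 < r \<Longrightarrow> 0 < g r"
  unfolding g_def by (simp add: f_pos)

lemma g_le: "0 < r \<Longrightarrow> r \<le> r' \<Longrightarrow> g r \<le> g r'"
  using mono_onD[OF g_mono, of r r'] unfolding g_def by simp

lemma \<phi>_pos [simp]: "0 < \<phi> l" unfolding \<phi>_def by (simp add: f_pos)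

lemma \<phi>_nonneg [simp]: "0 \<le> \<phi> l" using \<phi>_pos[of l] by linarith

lemma g_inv_pow: "g ((1 / real p) ^ l) = \<phi> l * pp (l * ((m - 1) * n))"
  unfolding g_def \<phi>_def by (simp add: power_one_over power_mult power_divide)

lemma f_div_le: "0 < r \<Longrightarrow> r \<le> r' \<Longrightarrow> f r' / r' ^ (m * n) \<le> f r / r ^ (m * n)"
  using monotone_onD[OF f_anti, of r r'] by simp

lemma mn_split: "m * n = (m - 1) * n + n"
  using m0 by (cases m) auto

lemma mn_level: "k * (m * n) = k * ((m - 1) * n) + n * k"
  using m0 by (cases m) (auto simp: algebra_simps)

text \<open>This is where \<open>g r / r ^ n = f r / r ^ (m * n)\<close> being decreasing enters.\<close>

lemma g_scale:
  assumes "0 < r" "1 \<le> c"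
  shows "g (c * r) \<le> c ^ n * g r"
proof -
  have "r \<le> c * r" using assms by simp
  from f_div_le[OF assms(1) this] have "f (c * r) / (c * r) ^ (m * n) \<le> f r / r ^ (m * n)" .
  then have "g (c * r) / (c * r) ^ n \<le> g r / r ^ n"
    unfolding mn_split power_add g_def by (simp only: divide_divide_eq_left)
  moreover have "0 < (c * r) ^ n" "0 < r ^ n" using assms by auto
  ultimately have "g (c * r) \<le> g r / r ^ n * (c * r) ^ n" by (simp only: pos_divide_le_eq)
  then show ?thesis using assms by (simp add: power_mult_distrib mult.commute)
qed

text \<open>The product is \<open>f r / r ^ (m * n)\<close> at \<open>r = p ^ -l\<close>, the ratio
  of the gauge to the Haar measure of a ball.\<close>

lemma \<phi>_density_mono:
  assumes "l \<le> l'"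
  shows "\<phi> l * pp (l * (m * n)) \<le> \<phi> l' * pp (l' * (m * n))"
proof -
  have "(1 / real p) ^ l' \<le> (1 / real p) ^ l"
    using assms P1 by (intro power_decreasing) auto
  from f_div_le[OF inv_pow_pos this] show ?thesis
    unfolding \<phi>_def by (simp add: power_one_over power_mult power_divide)
qed

text \<open>The monotonicity of \<open>g\<close>, read at powers of \<open>1 / p\<close>.\<close>

lemma \<phi>_slice_antimono:
  assumes "l \<le> l'"
  shows "\<phi> l' * pp (l' * ((m - 1) * n)) \<le> \<phi> l * pp (l * ((m - 1) * n))"
proof -
  have "(1 / real p) ^ l' \<le> (1 / real p) ^ l"
    using assms P1 by (intro power_decreasing) auto
  from g_le[OF inv_pow_pos this] show ?thesis unfolding g_inv_pow .
qed

lemma \<phi>_density_unbounded: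
  shows "\<exists>l\<ge>l0. B \<le> \<phi> l * pp (l * (m * n))"
proof -
  have "eventually (\<lambda>x. B \<le> f x / x ^ (m * n)) (at_right 0)"
    using f_inf unfolding filterlim_at_top by blast
  then obtain b where b: "0 < b" "\<And>y. 0 < y \<Longrightarrow> y < b \<Longrightarrow> B \<le> f y / y ^ (m * n)"
    unfolding eventually_at_right_field by blast
  obtain k where k: "(1 / real p) ^ k < b"
    using real_arch_pow_inv[OF b(1), of "1 / real p"] P1 by auto
  have "(1 / real p) ^ (max k l0) \<le> (1 / real p) ^ k"
    using P1 by (intro power_decreasing) auto
  then have "B \<le> \<phi> (max k l0) * pp (max k l0 * (m * n))"
    using b(2)[OF inv_pow_pos, of "max k l0"] k
    unfolding \<phi>_def by (simp add: power_one_over power_mult power_divide)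
  then show ?thesis by (intro exI[of _ "max k l0"]) simp
qed

lemma lv_less:
  assumes "0 < r"
  shows "(1 / real p) ^ lv r < r"
proof -
  obtain k where "(1 / real p) ^ k < r"
    using real_arch_pow_inv[OF assms, of "1 / real p"] P1 by auto
  then show ?thesis unfolding lv_def by (rule LeastI)
qed

lemma lv_le: "(1 / real p) ^ l < r \<Longrightarrow> lv r \<le> l"
  unfolding lv_def by (rule Least_le)

lemma lv_upper:
  assumes "lv r = Suc l"
  shows "r \<le> (1 / real p) ^ l"
  using lv_le[of l r] assms by fastforce

text \<open>Replacing \<open>\<psi> t\<close> by the power of \<open>1 / p\<close> just below it
  changes \<open>g\<close> at most by \<open>p ^ n\<close>, by \<open>g_scale\<close>. When
  \<open>\<psi> t > 1\<close> the level is 0 and the gap may be larger; it is then controlled by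
  \<open>\<psi> t \<le> \<psi> 1\<close>.\<close>

lemma g_lv:
  obtains c where "0 < c" "\<And>t. 1 \<le> t \<Longrightarrow> c * g (\<psi> t) \<le> g ((1 / real p) ^ lv (\<psi> t))"
proof -
  define c where "c = min (1 / real p ^ n) (g 1 / g (\<psi> 1))"
  have "0 < c" unfolding c_def using g_pos[of 1] g_pos[OF \<psi>_pos[of 1]] p0 by simp
  moreover have "c * g (\<psi> t) \<le> g ((1 / real p) ^ lv (\<psi> t))" if t: "1 \<le> t" for t
  proof (cases "lv (\<psi> t)")
    case 0
    have "\<psi> t \<le> \<psi> 1" using monotone_onD[OF \<psi>_anti, of 1 t] t by simp
    then have "g (\<psi> t) \<le> g (\<psi> 1)" by (rule g_le[OF \<psi>_pos[OF t]])
    then have "c * g (\<psi> t) \<le> (g 1 / g (\<psi> 1)) * g (\<psi> 1)"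
      using g_pos[OF \<psi>_pos[OF t]] g_pos[of 1] g_pos[OF \<psi>_pos[of 1]] unfolding c_def by (intro mult_mono) auto
    then show ?thesis using 0 g_pos[OF \<psi>_pos[of 1]] by simp
  next
    case (Suc l)
    have "\<psi> t \<le> real p * (1 / real p) ^ Suc l" using lv_upper[OF Suc] P0 by simp
    then have "g (\<psi> t) \<le> g (real p * (1 / real p) ^ Suc l)" by (rule g_le[OF \<psi>_pos[OF t]])
    also have "\<dots> \<le> real p ^ n * g ((1 / real p) ^ Suc l)"
      using P1 by (intro g_scale) auto
    finally have "1 / real p ^ n * g (\<psi> t) \<le> g ((1 / real p) ^ lv (\<psi> t))"
      unfolding Suc using P0 by (simp add: field_simps)
    moreover have "c * g (\<psi> t) \<le> 1 / real p ^ n * g (\<psi> t)"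
      using g_pos[OF \<psi>_pos[OF t]] unfolding c_def by (intro mult_right_mono) auto
    ultimately show ?thesis by linarith
  qed
  ultimately show thesis by (rule that)
qed

text \<open>Neighbourhoods of the resonant subspaces of height at most \<open>16 ^ t\<close>: the level \<open>thin s t\<close> lies
  inside the set to be measured, the level \<open>fat K s t\<close> corresponds to the width \<open>\<Theta>\<close> with
  \<open>\<Theta> ^ n = g \<psi> / K\<close>. Both are truncated so as to lie inside balls of level \<open>s\<close>.\<close>

definition thin :: "nat \<Rightarrow> nat \<Rightarrow> nat" where "thin s t = max (lv (\<psi> (16 ^ t))) s"

definition fat :: "real \<Rightarrow> nat \<Rightarrow> nat \<Rightarrow> nat" where
  "fat K s t = min (thin s t) (max s (LEAST \<theta>. K \<le> g ((1 / real p) ^ thin s t) * pp (n * \<theta>)))"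

lemma fat_bounds: "s \<le> fat K s t" "fat K s t \<le> thin s t"
  unfolding fat_def thin_def by auto

lemma ex_fat:
  assumes "0 < a"
  shows "\<exists>\<theta>. K \<le> a * pp (n * \<theta>)"
proof -
  obtain k where k: "K / a < pp k" using real_arch_pow[OF P1] by blast
  have "pp k \<le> pp (n * k)" using P1 n0 by (intro power_increasing) auto
  then have "K / a < pp (n * k)" using k by linarith
  then show ?thesis using assms by (intro exI[of _ k]) (simp add: field_simps)
qed

text \<open>For \<open>\<Theta> = p ^ -fat\<close> this is the bound
  \<open>\<Theta> ^ n \<le> g / K\<close>. The hypothesis says that the cap by \<open>thin\<close>
  is inactive; where the two levels agree, no mass is concentrated.\<close>

lemma fat_concentrates:
  assumes "fat K s t < thin s t"
  shows "K \<le> g ((1 / real p) ^ thin s t) * pp (n * fat K s t)"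
proof -
  let ?L = "LEAST \<theta>. K \<le> g ((1 / real p) ^ thin s t) * pp (n * \<theta>)"
  have "K \<le> g ((1 / real p) ^ thin s t) * pp (n * ?L)"
    by (rule LeastI_ex[OF ex_fat]) (simp add: g_pos)
  also have "\<dots> \<le> g ((1 / real p) ^ thin s t) * pp (n * fat K s t)"
    using assms P1 g_pos[OF inv_pow_pos, of "thin s t"] unfolding fat_def
    by (intro mult_left_mono power_increasing) auto
  finally show ?thesis .
qed

text \<open>Up to constants \<open>1 / pp (n * fat K s t)\<close> is at least
  \<open>g (\<psi> (16 ^ t))\<close>, unless the truncation at level \<open>s\<close> intervenes,
  and then it is at least the constant \<open>c2\<close>. If the series converged, its terms would
  tend to 0, the second alternative would die out, and comparison would make the original series
  converge.\<close>

lemma fat_divergent: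
  assumes K: "0 < K" and div: "\<not> summable (\<lambda>t. 16 ^ (t * (m + n)) * g (\<psi> (16 ^ t)))"
  shows "\<not> summable (\<lambda>t. 16 ^ (t * (m + n)) / real p ^ (n * fat K s t))"
proof
  let ?u = "\<lambda>t. 16 ^ (t * (m + n)) / real p ^ (n * fat K s t)"
  let ?G = "\<lambda>l. g ((1 / real p) ^ l)"
  assume sm: "summable ?u"
  obtain c where c: "0 < c" "\<And>t. 1 \<le> t \<Longrightarrow> c * g (\<psi> t) \<le> ?G (lv (\<psi> t))" using g_lv by blast
  \<comment> \<open>Minimality of the exponent in \<open>fat\<close> is exploited one step before
    the minimum, at the cost of a factor \<open>p ^ n\<close>.\<close>
  define c1 where "c1 = 1 / (pp n * K)"
  have c1: "0 < c1" unfolding c1_def using K by (simp add: zero_less_mult_iff)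
  define c2 where "c2 = min (1 / pp (n * s)) (c1 * ?G s)"
  have c2: "0 < c2" unfolding c2_def using c1 by (simp add: g_pos zero_less_mult_iff)
  have low: "min c2 (c1 * c * g (\<psi> (16 ^ t))) \<le> 1 / pp (n * fat K s t)" for t
  proof -
    let ?L = "LEAST \<theta>. K \<le> ?G (thin s t) * pp (n * \<theta>)"
    have *: "1 / pp (n * max s ?L) \<le> 1 / pp (n * fat K s t)"
      using P1 unfolding fat_def by (intro divide_left_mono power_increasing) auto
    show ?thesis
    proof (cases "?L \<le> s")
      case True
      then have "max s ?L = s" by simp
      then have "1 / pp (n * s) \<le> 1 / pp (n * fat K s t)" using * by metis
      then show ?thesis unfolding c2_def by (auto simp: min_le_iff_disj)
    next
      case False
      then obtain j where j: "?L = Suc j" "max s ?L = Suc j" by (cases ?L) auto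
      then have "\<not> K \<le> ?G (thin s t) * pp (n * j)"
        using not_less_Least[of j "\<lambda>\<theta>. K \<le> ?G (thin s t) * pp (n * \<theta>)"] by simp
      then have "?G (thin s t) * pp (n * j) * pp n \<le> K * pp n" by (intro mult_right_mono) auto
      then have "c1 * ?G (thin s t) \<le> 1 / pp (n * Suc j)"
        unfolding c1_def using K P0 by (simp add: field_simps power_add)
      then have 1: "c1 * ?G (thin s t) \<le> 1 / pp (n * fat K s t)" using * unfolding j(2) by linarith
      have "min (?G s) (c * g (\<psi> (16 ^ t))) \<le> ?G (thin s t)"
        using c(2)[of "16 ^ t"] unfolding thin_def max_def by auto
      then have "c1 * min (?G s) (c * g (\<psi> (16 ^ t))) \<le> c1 * ?G (thin s t)"
        using c1 by (intro mult_left_mono) auto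
      moreover have "min c2 (c1 * c * g (\<psi> (16 ^ t))) \<le> c1 * min (?G s) (c * g (\<psi> (16 ^ t)))"
        unfolding c2_def by (auto simp: min_def mult.assoc)
      ultimately show ?thesis using 1 by linarith
    qed
  qed
  have "?u \<longlonglongrightarrow> 0" by (rule summable_LIMSEQ_zero[OF sm])
  then have "eventually (\<lambda>t. ?u t < c2) sequentially" using c2 by (rule order_tendstoD)
  then have "eventually (\<lambda>t. norm (16 ^ (t * (m + n)) * g (\<psi> (16 ^ t))) \<le> 1 / (c1 * c) * ?u t) sequentially"
  proof eventually_elim
    case (elim t)
    have "16 ^ (t * (m + n)) * min c2 (c1 * c * g (\<psi> (16 ^ t))) \<le> 16 ^ (t * (m + n)) * (1 / pp (n * fat K s t))"
      using low by (intro mult_left_mono) auto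
    then have *: "16 ^ (t * (m + n)) * min c2 (c1 * c * g (\<psi> (16 ^ t))) \<le> ?u t" by simp
    have "c2 \<le> 16 ^ (t * (m + n)) * c2" using c2 by simp
    then have "16 ^ (t * (m + n)) * (c1 * c * g (\<psi> (16 ^ t))) \<le> ?u t"
      using * elim by (cases "c2 \<le> c1 * c * g (\<psi> (16 ^ t))") (auto simp: min_def)
    then have "16 ^ (t * (m + n)) * g (\<psi> (16 ^ t)) \<le> 1 / (c1 * c) * ?u t"
      using c1 c(1) by (simp add: field_simps)
    moreover have "0 \<le> 16 ^ (t * (m + n)) * g (\<psi> (16 ^ t))" using g_pos[OF \<psi>_pos[of "16 ^ t"]] by simp
    ultimately show ?case by (simp only: real_norm_def abs_of_nonneg)
  qed
  then have "summable (\<lambda>t. 16 ^ (t * (m + n)) * g (\<psi> (16 ^ t)))"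
    by (rule summable_comparison_test_ev) (rule summable_mult[OF sm])
  then show False using div by blast
qed

text \<open>One pair of height at least \<open>T\<close> satisfies the approximation inequality on
  the whole ball \<open>y\<close> of level \<open>L\<close>; \<open>\<sigma> \<le> L\<close> is what
  makes this a property of the ball.\<close>

definition good :: "nat \<Rightarrow> nat \<Rightarrow> (nat \<times> nat \<Rightarrow> int) \<Rightarrow> bool" where
  "good T L y \<longleftrightarrow> (\<exists>q a \<sigma>. q \<in> int_vectors m \<and> a \<in> int_vectors n \<and>
     T \<le> max (int_max_abs n a) (int_max_abs m q) \<and> \<sigma> \<le> L \<and>
     (1 / real p) ^ \<sigma> < \<psi> (max (int_max_abs n a) (int_max_abs m q)) \<and> strip \<sigma> q a y)"

text \<open>The thin level is built from \<open>\<psi> (16 ^ t)\<close>, and the true height is at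
  most \<open>16 ^ t\<close>, so \<open>\<psi>\<close> at the height is no smaller. The bound
  \<open>1 \<le> T\<close> keeps the height in the range where \<open>\<psi>\<close>
  decreases.\<close>

lemma resonant_good:
  assumes qa: "(q, a) \<in> resonant T (16 ^ t)" and T: "1 \<le> T" and y: "strip (thin s t) q a y" and L: "thin s t \<le> L"
  shows "good T L y"
proof -
  let ?h = "max (int_max_abs n a) (int_max_abs m q)"
  have r: "q \<in> int_vectors m" "a \<in> int_vectors n" "int T \<le> q 0" "\<And>i. i < m \<Longrightarrow> \<bar>q i\<bar> \<le> int (16 ^ t)" "\<And>j. j < n \<Longrightarrow> \<bar>a j\<bar> \<le> int (16 ^ t)"
    using qa unfolding resonant_def by auto
  have "int_max_abs n a \<le> 16 ^ t" unfolding int_max_abs_def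
  proof (subst Max_le_iff)
    show "\<forall>h\<in>(\<lambda>i. nat \<bar>a i\<bar>) ` {..<n}. h \<le> 16 ^ t" using r(5) by (auto simp: nat_le_iff)
  qed (use n0 in auto)
  moreover have "int_max_abs m q \<le> 16 ^ t" unfolding int_max_abs_def
  proof (subst Max_le_iff)
    show "\<forall>h\<in>(\<lambda>i. nat \<bar>q i\<bar>) ` {..<m}. h \<le> 16 ^ t" using r(4) by (auto simp: nat_le_iff)
  qed (use m0 in auto)
  ultimately have h1: "?h \<le> 16 ^ t" by simp
  have "nat \<bar>q 0\<bar> \<le> int_max_abs m q" unfolding int_max_abs_def using m0 by (intro Max_ge) auto
  then have h2: "T \<le> ?h" using r(3) by linarith
  have "\<psi> (16 ^ t) \<le> \<psi> ?h" using monotone_onD[OF \<psi>_anti, of ?h "16 ^ t"] h1 h2 T by simp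
  moreover have "(1 / real p) ^ thin s t \<le> (1 / real p) ^ lv (\<psi> (16 ^ t))"
    unfolding thin_def using P1 by (intro power_decreasing) auto
  moreover have "(1 / real p) ^ lv (\<psi> (16 ^ t)) < \<psi> (16 ^ t)" by (rule lv_less[OF \<psi>_pos]) simp
  ultimately have "(1 / real p) ^ thin s t < \<psi> ?h" by linarith
  then show ?thesis unfolding good_def using r(1,2) h2 L y by blast
qed

definition kernel_const :: real where "kernel_const = 100 * (51 ^ n + 1)"

lemma kernel_const_pos: "0 < kernel_const" unfolding kernel_const_def by (simp add: add_pos_pos)

text \<open>One stage of the Cantor construction. In the last bound the first term is a multiple of
  Haar measure normalised on a ball of level \<open>s\<close>; the second can be made as small as
  desired against \<open>\<phi> l\<close>, because \<open>kernel_const\<close> does not depend on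
  \<open>K\<close>.\<close>

lemma mass_kernel:
  assumes K: "0 < K" and div: "\<not> summable (\<lambda>t. 16 ^ (t * (m + n)) * g (\<psi> (16 ^ t)))" and T: "1 \<le> T"
  obtains L k where "s < L" "\<And>y. 0 \<le> k y" "\<And>y. y \<in> Box L \<Longrightarrow> 0 < k y \<Longrightarrow> good T L y"
    and "\<And>b. b \<in> Box s \<Longrightarrow> (\<Sum>y\<in>{y \<in> Box L. red s y = b}. k y) = (1::real)"
    and "\<And>l E. s \<le> l \<Longrightarrow> l \<le> L \<Longrightarrow> E \<in> Box l \<Longrightarrow>
      (\<Sum>y\<in>{y \<in> Box L. red l y = E}. k y) \<le> kernel_const * pp (s * (m * n)) / pp (l * (m * n)) + \<phi> l / K"
proof -
  \<comment> \<open>\<open>redistribute\<close> loses the factor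
    \<open>kernel_const * pp (s * (m * n))\<close>, its second part because each ball of level
    \<open>s\<close> carries mass 1. Enlarging \<open>K\<close> by this factor in advance leaves
    exactly \<open>\<phi> l / K\<close>.\<close>
  define K' where "K' = K * kernel_const * pp (s * (m * n))"
  have K': "0 < K'" unfolding K'_def using K kernel_const_pos by (simp add: zero_less_mult_iff)
  obtain t1 where t1: "\<And>L. s \<le> L \<Longrightarrow> (\<forall>t\<le>t1. fat K' s t \<le> L) \<Longrightarrow> (\<forall>b\<in>Box s. pp ((L - s) * (m * n)) / kernel_const \<le>
    real (card {x \<in> Box L. red s x = b \<and> (\<exists>t\<le>t1. \<exists>(q, a)\<in>resonant T (16 ^ t). strip (fat K' s t) q a x)}))"
    using strips_cover_proportion_local[OF fat_divergent[OF K' div, of s] fat_bounds(1), of T] unfolding kernel_const_def by blast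
  define L where "L = Suc s + (\<Sum>t\<le>t1. thin s t)"
  have thinL: "thin s t \<le> L" if "t \<le> t1" for t
    unfolding L_def using member_le_sum[of t "{..t1}" "thin s"] that by simp
  define TT where "TT = {(\<theta>, \<sigma>, q, a). \<exists>t\<le>t1. \<theta> = fat K' s t \<and> \<sigma> = thin s t \<and> (q, a) \<in> resonant T (16 ^ t)}"
  let ?B = "\<lambda>l. 1 / pp (l * (m * n)) + \<phi> l / K'"
  have sL: "s \<le> L" unfolding L_def by simp
  obtain k where k: "\<And>y. 0 \<le> k y"
    "\<And>y. y \<in> Box L \<Longrightarrow> 0 < k y \<Longrightarrow> \<exists>\<theta> \<sigma> q a. (\<theta>, \<sigma>, q, a) \<in> TT \<and> strip \<sigma> q a y"
    "\<And>b. b \<in> Box s \<Longrightarrow> (\<Sum>y\<in>{y \<in> Box L. red s y = b}. k y) = (1::real)"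
    "\<And>l E. s \<le> l \<Longrightarrow> l \<le> L \<Longrightarrow> E \<in> Box l \<Longrightarrow>
      (\<Sum>y\<in>{y \<in> Box L. red l y = E}. k y) \<le> pp (s * (m * n)) / (1 / kernel_const) * ?B l"
  proof (rule redistribute[of s L "1 / kernel_const" TT ?B])
    show "s \<le> L" by (rule sL)
    show "0 < 1 / kernel_const" using kernel_const_pos by simp
    show "s \<le> \<theta> \<and> \<theta> \<le> \<sigma> \<and> \<sigma> \<le> L \<and> \<not> int p dvd q 0" if "(\<theta>, \<sigma>, q, a) \<in> TT" for \<theta> \<sigma> q a
      using that fat_bounds thinL unfolding TT_def resonant_def by auto
    show "1 / kernel_const * pp ((L - s) * (m * n)) \<le>
      real (card {x \<in> Box L. red s x = b \<and> (\<exists>\<theta> \<sigma> q a. (\<theta>, \<sigma>, q, a) \<in> TT \<and> strip \<theta> q a x)})" if b: "b \<in> Box s" for b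
    proof -
      have "{x \<in> Box L. red s x = b \<and> (\<exists>\<theta> \<sigma> q a. (\<theta>, \<sigma>, q, a) \<in> TT \<and> strip \<theta> q a x)}
          = {x \<in> Box L. red s x = b \<and> (\<exists>t\<le>t1. \<exists>(q, a)\<in>resonant T (16 ^ t). strip (fat K' s t) q a x)}"
        unfolding TT_def by blast
      moreover have "\<forall>t\<le>t1. fat K' s t \<le> L" using fat_bounds(2) thinL by (meson le_trans)
      ultimately show ?thesis using t1[OF sL] b by simp
    qed
    show "pp (n * (\<sigma> - \<theta>)) / (pp (l * (m * n)) * pp (n * (\<sigma> - l))) \<le> ?B l"
      if TT: "(\<theta>, \<sigma>, q, a) \<in> TT" and l: "\<theta> \<le> l" for \<theta> \<sigma> q a l
    proof -
      obtain t where t: "\<theta> = fat K' s t" "\<sigma> = thin s t" using TT unfolding TT_def by blast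
      have \<theta>\<sigma>: "\<theta> \<le> \<sigma>" unfolding t by (rule fat_bounds(2))
      show ?thesis
      proof (cases "\<theta> = \<sigma>")
        case True
        then show ?thesis using l K' \<phi>_pos[of l] by simp
      next
        case False
        then have "K' \<le> \<phi> \<sigma> * pp (\<sigma> * ((m - 1) * n)) * pp (n * \<theta>)"
          using fat_concentrates[of K' s t] \<theta>\<sigma> unfolding t g_inv_pow by simp
        then have "K' * pp (n * (\<sigma> - \<theta>)) \<le> \<phi> \<sigma> * pp (\<sigma> * ((m - 1) * n)) * pp (n * \<theta>) * pp (n * (\<sigma> - \<theta>))"
          by (intro mult_right_mono) auto
        also have "\<dots> = \<phi> \<sigma> * pp (\<sigma> * ((m - 1) * n) + (n * \<theta> + n * (\<sigma> - \<theta>)))"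
          by (simp only: power_add mult.assoc)
        also have "\<sigma> * ((m - 1) * n) + (n * \<theta> + n * (\<sigma> - \<theta>)) = \<sigma> * (m * n)"
          unfolding mn_level using \<theta>\<sigma> by (simp flip: distrib_left)
        finally have *: "K' * pp (n * (\<sigma> - \<theta>)) \<le> \<phi> \<sigma> * pp (\<sigma> * (m * n))" .
        \<comment> \<open>For radii up to the thin width, \<open>\<sigma> \<le> l\<close>, this is
          the monotonicity of \<open>f r / r ^ (m * n)\<close>; for larger radii it is that of
          \<open>g\<close>.\<close>
        have "\<phi> \<sigma> * pp (\<sigma> * (m * n)) \<le> \<phi> l * pp (l * (m * n)) * pp (n * (\<sigma> - l))"
        proof (cases "\<sigma> \<le> l")
          case True
          then show ?thesis using \<phi>_density_mono[OF True] by simp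
        next
          case False
          note e = mn_level
          have "\<phi> \<sigma> * pp (\<sigma> * (m * n)) = \<phi> \<sigma> * pp (\<sigma> * ((m - 1) * n)) * pp (n * \<sigma>)"
            unfolding e power_add by simp
          also have "\<dots> \<le> \<phi> l * pp (l * ((m - 1) * n)) * pp (n * \<sigma>)"
            using \<phi>_slice_antimono[of l \<sigma>] False by (intro mult_right_mono) auto
          also have "n * \<sigma> = n * l + n * (\<sigma> - l)" using False by (simp flip: distrib_left)
          also have "\<phi> l * pp (l * ((m - 1) * n)) * pp (n * l + n * (\<sigma> - l)) = \<phi> l * pp (l * (m * n)) * pp (n * (\<sigma> - l))"
            unfolding e power_add by simp
          finally show ?thesis .
        qed
        then have "K' * pp (n * (\<sigma> - \<theta>)) \<le> \<phi> l * (pp (l * (m * n)) * pp (n * (\<sigma> - l)))" using * by (simp add: mult.assoc)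
        then have "pp (n * (\<sigma> - \<theta>)) / (pp (l * (m * n)) * pp (n * (\<sigma> - l))) \<le> \<phi> l / K'"
          using K' by (simp add: pos_divide_le_eq pos_le_divide_eq mult.commute mult.left_commute)
        moreover have "0 \<le> 1 / pp (l * (m * n))" by simp
        ultimately show ?thesis by linarith
      qed
    qed
    show "1 / pp (l * (m * n)) \<le> ?B l" for l using K' \<phi>_pos[of l] by simp
  qed blast
  show thesis
  proof (rule that[of L k])
    show "s < L" unfolding L_def by simp
    show "good T L y" if y: "y \<in> Box L" "0 < k y" for y
    proof -
      obtain t q a where "t \<le> t1" "(q, a) \<in> resonant T (16 ^ t)" "strip (thin s t) q a y"
        using k(2)[OF y] unfolding TT_def by blast
      then show ?thesis using resonant_good[OF _ T] thinL by blast
    qed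
    show "(\<Sum>y\<in>{y \<in> Box L. red l y = E}. k y) \<le> kernel_const * pp (s * (m * n)) / pp (l * (m * n)) + \<phi> l / K"
      if "s \<le> l" "l \<le> L" "E \<in> Box l" for l E
    proof -
      have "pp (s * (m * n)) / (1 / kernel_const) * ?B l = kernel_const * pp (s * (m * n)) / pp (l * (m * n)) + \<phi> l / K"
        unfolding K'_def using K kernel_const_pos P0 by (simp add: field_simps)
      then show ?thesis using k(4)[OF that] by simp
    qed
  qed (use k(1,3) in blast)+
qed

end

section \<open>The Cantor construction\<close>

context padic_grid
begin

definition mass :: "nat \<Rightarrow> (nat \<times> nat \<Rightarrow> int) \<Rightarrow> ((nat \<times> nat \<Rightarrow> int) \<Rightarrow> real) \<Rightarrow> nat \<Rightarrow> real" where
  "mass L E w l = (\<Sum>y\<in>{y \<in> Box L. red l y = E}. w y)"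

lemma mass_split:
  assumes "l \<le> s" "s \<le> L"
  shows "mass L E w l = (\<Sum>b\<in>{b \<in> Box s. red l b = E}. mass L b w s)"
proof -
  let ?S = "{y \<in> Box L. red l y = E}" and ?T = "{b \<in> Box s. red l b = E}"
  have "mass L E w l = (\<Sum>b\<in>?T. \<Sum>y\<in>{y \<in> ?S. red s y = b}. w y)"
    unfolding mass_def
  proof (rule sum.group[symmetric])
    show "red s ` ?S \<subseteq> ?T" using red_red[OF assms(1)] by auto
  qed simp_all
  also have "\<dots> = (\<Sum>b\<in>?T. mass L b w s)"
    unfolding mass_def
  proof (intro sum.cong refl)
    fix b assume "b \<in> ?T"
    then show "{y \<in> ?S. red s y = b} = {y \<in> Box L. red s y = b}"
      using red_red[OF assms(1)] by auto
  qed
  finally show ?thesis .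
qed

lemma mass_self:
  assumes "E \<in> Box L"
  shows "mass L E w L = w E"
proof -
  have "{y \<in> Box L. red L y = E} = {E}" using assms red_id by auto
  then show ?thesis unfolding mass_def by simp
qed

lemma red_0: "red 0 y = (\<lambda>ij\<in>idx. 0)"
  unfolding red_def by simp

lemma mass_total: "mass L (\<lambda>ij\<in>idx. 0) w 0 = sum w (Box L)"
  unfolding mass_def red_0 by simp

lemma zero_Box: "(\<lambda>ij\<in>idx. 0) \<in> Box l"
  unfolding Box_def by (simp add: p0)

end

context jarnik
begin

text \<open>A probability on the balls of level \<open>L\<close> with a Frostman bound at all levels
  from \<open>s1\<close> on; \<open>s1\<close> stays fixed during the construction while
  \<open>L\<close> grows.\<close>

definition admissible :: "real \<Rightarrow> nat \<Rightarrow> nat \<Rightarrow> ((nat \<times> nat \<Rightarrow> int) \<Rightarrow> real) \<Rightarrow> bool" where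
  "admissible \<epsilon> s1 L w \<longleftrightarrow> s1 \<le> L \<and> (\<forall>y. 0 \<le> w y) \<and> sum w (Box L) = 1 \<and>
     (\<forall>l E. s1 \<le> l \<longrightarrow> l \<le> L \<longrightarrow> E \<in> Box l \<longrightarrow> mass L E w l \<le> \<epsilon> * \<phi> l)"

text \<open>The mass is spread evenly from level \<open>L\<close> to a deeper level \<open>s\<close>
  and then redistributed inside each ball of level \<open>s\<close>. Balls of level at most
  \<open>L\<close> keep their mass, so earlier bounds survive; between \<open>L\<close> and
  \<open>s\<close> the density monotonicity suffices; beyond \<open>s\<close> the two terms of
  \<open>mass_kernel\<close> share the allowance \<open>\<epsilon> * \<phi> l\<close>.\<close>

lemma admissible_step:
  assumes adm: "admissible \<epsilon> s1 L w" and \<epsilon>: "0 < \<epsilon>" and T: "1 \<le> T"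
    and div: "\<not> summable (\<lambda>t. 16 ^ (t * (m + n)) * g (\<psi> (16 ^ t)))"
  obtains L' w' where "admissible \<epsilon> s1 L' w'" "L < L'"
    "\<And>y. y \<in> Box L' \<Longrightarrow> 0 < w' y \<Longrightarrow> 0 < w (red L y) \<and> good T L' y"
proof -
  have s1: "s1 \<le> L" and w0: "\<And>y. 0 \<le> w y" and w1: "sum w (Box L) = 1"
    and wm: "\<And>l E. s1 \<le> l \<Longrightarrow> l \<le> L \<Longrightarrow> E \<in> Box l \<Longrightarrow> mass L E w l \<le> \<epsilon> * \<phi> l"
    using adm unfolding admissible_def by blast+
  let ?d = "m * n"
  have wL: "w E \<le> \<epsilon> * \<phi> L" if "E \<in> Box L" for E
    using wm[OF s1 order_refl that] mass_self[OF that] by simp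
  have wle1: "w E \<le> 1" if "E \<in> Box L" for E
    using member_le_sum[of E "Box L" w] that w0 w1 by simp
  \<comment> \<open>The factor 2 makes the Haar part of the kernel cost at most half of the
    allowance; \<open>K = 2 / \<epsilon>\<close> below bounds the other half.\<close>
  obtain s where s: "L \<le> s" "2 * kernel_const * (\<phi> L * pp (L * ?d)) \<le> \<phi> s * pp (s * ?d)"
    using \<phi>_density_unbounded by blast
  obtain L' k where sL: "s < L'" and k0: "\<And>y. 0 \<le> k y" and kg: "\<And>y. y \<in> Box L' \<Longrightarrow> 0 < k y \<Longrightarrow> good T L' y"
    and k1: "\<And>b. b \<in> Box s \<Longrightarrow> (\<Sum>y\<in>{y \<in> Box L'. red s y = b}. k y) = (1::real)"
    and kb: "\<And>l E. s \<le> l \<Longrightarrow> l \<le> L' \<Longrightarrow> E \<in> Box l \<Longrightarrow>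
      (\<Sum>y\<in>{y \<in> Box L'. red l y = E}. k y) \<le> kernel_const * pp (s * ?d) / pp (l * ?d) + \<phi> l / (2 / \<epsilon>)"
    using mass_kernel[OF _ div T, of "2 / \<epsilon>" s] \<epsilon> by (auto simp del: divide_divide_eq_right)
  \<comment> \<open>The number of balls of level \<open>s\<close> in a ball of level
    \<open>L\<close>, among which its mass is divided evenly.\<close>
  define N where "N = pp ((s - L) * ?d)"
  have N: "1 \<le> N" "N * pp (L * ?d) = pp (s * ?d)"
    unfolding N_def using s(1) by (simp_all add: pp_ge1 flip: power_add distrib_right)
  define w' where "w' = (\<lambda>y. w (red L y) / N * k y)"
  have fine: "mass L' E w' l = w (red L E) / N * (\<Sum>y\<in>{y \<in> Box L'. red l y = E}. k y)" if "L \<le> l" for l E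
  proof -
    have "red L y = red L E" if "red l y = E" for y using red_red[OF \<open>L \<le> l\<close>, of y] that by simp
    then show ?thesis unfolding mass_def w'_def by (simp add: sum_distrib_left)
  qed
  have at_s: "mass L' b w' s = w (red L b) / N" if "b \<in> Box s" for b
    unfolding fine[OF s(1)] k1[OF that] by simp
  have mid: "mass L' E w' l = w (red L E) / N * pp ((s - l) * ?d)" if l: "L \<le> l" "l \<le> s" "E \<in> Box l" for l E
  proof -
    have "mass L' E w' l = (\<Sum>b\<in>{b \<in> Box s. red l b = E}. mass L' b w' s)"
      using l(2) sL by (intro mass_split) auto
    also have "\<dots> = (\<Sum>b\<in>{b \<in> Box s. red l b = E}. w (red L E) / N)"
    proof (rule sum.cong[OF refl])
      fix b assume b: "b \<in> {b \<in> Box s. red l b = E}"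
      then have "red L b = red L E" using red_red[OF l(1), of b] by simp
      then show "mass L' b w' s = w (red L E) / N" using at_s[of b] b by simp
    qed
    also have "\<dots> = real (card {b \<in> Box s. red l b = E}) * (w (red L E) / N)" by simp
    finally show ?thesis unfolding card_red_fibre[OF l(2,3)] by simp
  qed
  have coarse: "mass L' E w' l = mass L E w l" if l: "l \<le> L" for l E
  proof -
    have "mass L' E w' l = (\<Sum>b\<in>{b \<in> Box L. red l b = E}. mass L' b w' L)"
      using l s(1) sL by (intro mass_split) auto
    also have "\<dots> = (\<Sum>b\<in>{b \<in> Box L. red l b = E}. w b)"
    proof (rule sum.cong[OF refl])
      fix b assume b: "b \<in> {b \<in> Box L. red l b = E}"
      then show "mass L' b w' L = w b" using mid[OF order_refl s(1), of b] N(1) red_id[of b L] unfolding N_def by simp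
    qed
    finally show ?thesis unfolding mass_def .
  qed
  have "admissible \<epsilon> s1 L' w'"
    unfolding admissible_def
  proof (intro conjI allI impI)
    show "s1 \<le> L'" using s1 s(1) sL by simp
    show "0 \<le> w' y" for y unfolding w'_def using w0 k0 N(1) by simp
    show "sum w' (Box L') = 1"
      using coarse[of 0 "\<lambda>ij\<in>idx. 0"] w1 unfolding mass_total by simp
    fix l E assume l: "s1 \<le> l" "l \<le> L'" and E: "E \<in> Box l"
    consider "l \<le> L" | "L \<le> l" "l \<le> s" | "s \<le> l" by linarith
    then show "mass L' E w' l \<le> \<epsilon> * \<phi> l"
    proof cases
      case 1
      then show ?thesis using coarse[OF 1] wm[OF l(1) 1 E] by simp
    next
      case 2
      have e: "N * pp (L * ?d) = pp ((s - l) * ?d) * pp (l * ?d)"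
        unfolding N(2) using 2(2) by (simp flip: power_add distrib_right)
      have "w (red L E) / N * pp ((s - l) * ?d) = w (red L E) * pp (L * ?d) / pp (l * ?d)"
        using e N(1) by (simp add: field_simps)
      also have "\<dots> \<le> \<epsilon> * \<phi> L * pp (L * ?d) / pp (l * ?d)"
        by (intro divide_right_mono mult_right_mono wL) simp_all
      also have "\<dots> \<le> \<epsilon> * (\<phi> l * pp (l * ?d)) / pp (l * ?d)"
        using \<phi>_density_mono[OF 2(1)] \<epsilon> by (intro divide_right_mono) (simp_all add: mult.assoc)
      finally show ?thesis unfolding mid[OF 2 E] using p0 by simp
    next
      case 3
      then have Ll: "L \<le> l" using s(1) by simp
      have "mass L' E w' l \<le> w (red L E) / N * (kernel_const * pp (s * ?d) / pp (l * ?d) + \<phi> l / (2 / \<epsilon>))"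
        unfolding fine[OF Ll] using kb[OF 3 l(2) E] w0 N(1) by (intro mult_left_mono) auto
      also have "\<dots> = w (red L E) * (kernel_const * pp (L * ?d) / pp (l * ?d)) + w (red L E) / N * (\<epsilon> * \<phi> l / 2)"
        unfolding N(2)[symmetric] using N(1) by (simp add: field_simps)
      also have "w (red L E) * (kernel_const * pp (L * ?d) / pp (l * ?d)) \<le> \<epsilon> * \<phi> L * (kernel_const * pp (L * ?d) / pp (l * ?d))"
        using kernel_const_pos by (intro mult_right_mono wL) simp_all
      also have "\<epsilon> * \<phi> L * (kernel_const * pp (L * ?d) / pp (l * ?d)) = \<epsilon> / 2 * (2 * kernel_const * (\<phi> L * pp (L * ?d)) / pp (l * ?d))"
        by simp
      also have "2 * kernel_const * (\<phi> L * pp (L * ?d)) / pp (l * ?d) \<le> \<phi> l"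
      proof -
        have "2 * kernel_const * (\<phi> L * pp (L * ?d)) \<le> \<phi> l * pp (l * ?d)"
          using s(2) \<phi>_density_mono[OF 3] by linarith
        then show ?thesis by (simp add: pos_divide_le_eq)
      qed
      \<comment> \<open>For the concentrated part it is enough that the mass of a ball of level
        \<open>s\<close> is at most 1.\<close>
      also have "w (red L E) / N * (\<epsilon> * \<phi> l / 2) \<le> 1 * (\<epsilon> * \<phi> l / 2)"
      proof (rule mult_right_mono)
        have "w (red L E) / N \<le> 1 / 1" using wle1[of "red L E"] N(1) w0 by (intro frac_le) auto
        then show "w (red L E) / N \<le> 1" by simp
      qed (use \<epsilon> in simp)
      finally show ?thesis using \<epsilon> by simp
    qed
  qed
  moreover have "0 < w (red L y) \<and> good T L' y" if y: "y \<in> Box L'" "0 < w' y" for y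
  proof -
    have "w (red L y) \<noteq> 0" "k y \<noteq> 0" using y(2) unfolding w'_def by auto
    then show ?thesis using w0[of "red L y"] k0[of y] kg[OF y(1)] by simp
  qed
  ultimately show thesis using that[of L' w'] s(1) sL by simp
qed

text \<open>Uniform distribution at a level where the Haar measure of a ball is at most
  \<open>\<epsilon> * \<phi> s1\<close>; such levels exist because \<open>f r / r ^ (m * n)\<close>
  is unbounded.\<close>

lemma admissible_start:
  assumes "0 < \<epsilon>"
  obtains s1 w where "l0 \<le> s1" "admissible \<epsilon> s1 s1 w"
proof -
  obtain s1 where s1: "l0 \<le> s1" "1 / \<epsilon> \<le> \<phi> s1 * pp (s1 * (m * n))"
    using \<phi>_density_unbounded by blast
  let ?w = "\<lambda>_. 1 / pp (s1 * (m * n))"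
  have "?w E \<le> \<epsilon> * \<phi> s1" for E :: "nat \<times> nat \<Rightarrow> int"
    using s1(2) assms by (simp add: field_simps)
  moreover have "sum ?w (Box s1) = 1" by (simp add: card_Box)
  ultimately have "admissible \<epsilon> s1 s1 ?w"
    unfolding admissible_def using mass_self[of _ s1 ?w] by (auto dest: le_antisym)
  then show thesis using that s1(1) by blast
qed

text \<open>Dependent choice. Stage \<open>k + 1\<close> demands heights at least
  \<open>Suc k\<close>, so that a matrix surviving all stages has approximating pairs of unbounded
  height.\<close>

lemma admissible_sequence:
  assumes \<epsilon>: "0 < \<epsilon>" and div: "\<not> summable (\<lambda>t. 16 ^ (t * (m + n)) * g (\<psi> (16 ^ t)))"
  obtains s1 L w where "l0 \<le> s1" "\<And>k. admissible \<epsilon> s1 (L k) (w k)" "strict_mono L"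
    "\<And>k y. y \<in> Box (L (Suc k)) \<Longrightarrow> 0 < w (Suc k) y \<Longrightarrow> 0 < w k (red (L k) y) \<and> good (Suc k) (L (Suc k)) y"
proof -
  obtain s1 w0 where s1: "l0 \<le> s1" "admissible \<epsilon> s1 s1 w0" using admissible_start[OF \<epsilon>] by blast
  have "\<exists>h. \<forall>k. (admissible \<epsilon> s1 (fst (h k)) (snd (h k))) \<and>
      (fst (h k) < fst (h (Suc k)) \<and> (\<forall>y\<in>Box (fst (h (Suc k))). 0 < snd (h (Suc k)) y \<longrightarrow>
        0 < snd (h k) (red (fst (h k)) y) \<and> good (Suc k) (fst (h (Suc k))) y))"
  proof (rule dependent_nat_choice)
    show "\<exists>x. admissible \<epsilon> s1 (fst x) (snd x)" using s1(2) by (intro exI[of _ "(s1, w0)"]) simp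
    fix x k assume adm: "admissible \<epsilon> s1 (fst x) (snd x)"
    obtain L' w' where "admissible \<epsilon> s1 L' w'" "fst x < L'"
      "\<And>y. y \<in> Box L' \<Longrightarrow> 0 < w' y \<Longrightarrow> 0 < snd x (red (fst x) y) \<and> good (Suc k) L' y"
      by (rule admissible_step[OF adm \<epsilon> _ div, of "Suc k"]) auto
    then show "\<exists>y. admissible \<epsilon> s1 (fst y) (snd y) \<and> (fst x < fst y \<and> (\<forall>ya\<in>Box (fst y). 0 < snd y ya \<longrightarrow>
        0 < snd x (red (fst x) ya) \<and> good (Suc k) (fst y) ya))"
      by (intro exI[of _ "(L', w')"]) simp
  qed
  then obtain h where h: "\<And>k. admissible \<epsilon> s1 (fst (h k)) (snd (h k))"
    "\<And>k. fst (h k) < fst (h (Suc k))"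
    "\<And>k y. y \<in> Box (fst (h (Suc k))) \<Longrightarrow> 0 < snd (h (Suc k)) y \<Longrightarrow>
        0 < snd (h k) (red (fst (h k)) y) \<and> good (Suc k) (fst (h (Suc k))) y" by blast
  show thesis
    by (rule that[OF s1(1), of "\<lambda>k. fst (h k)" "\<lambda>k. snd (h k)"]) (use h in \<open>auto simp: strict_mono_Suc_iff\<close>)
qed

end

section \<open>Compactness and the divergence case\<close>

lemma sum_UNION_le:
  fixes h :: "'b \<Rightarrow> real"
  assumes "finite I" "\<And>i. i \<in> I \<Longrightarrow> finite (A i)" "\<And>x. 0 \<le> h x"
  shows "sum h (\<Union>i\<in>I. A i) \<le> (\<Sum>i\<in>I. sum h (A i))"
  using assms(1,2)
proof (induction I rule: finite_induct)
  case (insert i I)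
  have "sum h (A i \<union> (\<Union>i\<in>I. A i)) \<le> sum h (A i) + sum h (\<Union>i\<in>I. A i)"
    using insert.hyps insert.prems assms(3) by (subst sum.union_inter[symmetric]) (auto intro!: sum_nonneg)
  then show ?case using insert by simp
qed simp

lemma padic_finsum_nth:
  assumes "finite A" "\<And>i. i \<in> A \<Longrightarrow> h i \<in> carrier (padic_ring p)"
  shows "(\<Oplus>\<^bsub>padic_ring p\<^esub>i\<in>A. h i) l = (\<Sum>i\<in>A. h i l) mod int p ^ l"
proof -
  interpret cring "padic_ring p" by (rule padic_cring)
  have add: "(x \<oplus>\<^bsub>padic_ring p\<^esub> y) l = (x l + y l) mod int p ^ l" for x y
    by (simp add: padic_ring_def)
  show ?thesis using assms
  proof (induction A rule: finite_induct)
    case empty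
    show ?case unfolding finsum_empty by (simp add: padic_ring_def)
  next
    case (insert i A)
    have IH: "(\<Oplus>\<^bsub>padic_ring p\<^esub>i\<in>A. h i) l = (\<Sum>i\<in>A. h i l) mod int p ^ l"
      using insert.prems by (intro insert.IH) auto
    have "(\<Oplus>\<^bsub>padic_ring p\<^esub>i\<in>insert i A. h i) = h i \<oplus>\<^bsub>padic_ring p\<^esub> (\<Oplus>\<^bsub>padic_ring p\<^esub>i\<in>A. h i)"
      using insert.hyps insert.prems by (intro finsum_insert) auto
    then have "(\<Oplus>\<^bsub>padic_ring p\<^esub>i\<in>insert i A. h i) l = (h i l + (\<Oplus>\<^bsub>padic_ring p\<^esub>i\<in>A. h i) l) mod int p ^ l"
      by (simp only: add)
    then show ?case unfolding IH using insert.hyps by (simp add: mod_simps)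
  qed
qed

section \<open>P-adic matrices as coherent sequences of residue matrices, and compactness\<close>

context padic_grid
begin

abbreviation Mat :: "(nat \<times> nat \<Rightarrow> nat \<Rightarrow> int) set" where "Mat \<equiv> padic_matrices p m n"

abbreviation Mmet :: "(nat \<times> nat \<Rightarrow> nat \<Rightarrow> int) metric" where "Mmet \<equiv> padic_matrix_metric p m n"

definition trunc :: "nat \<Rightarrow> (nat \<times> nat \<Rightarrow> nat \<Rightarrow> int) \<Rightarrow> nat \<times> nat \<Rightarrow> int" where
  "trunc l X = (\<lambda>ij\<in>idx. X ij l)"

lemma Mat_entry: "X \<in> Mat \<Longrightarrow> ij \<in> idx \<Longrightarrow> X ij \<in> carrier (padic_ring p)"
  unfolding padic_matrices_def idx_def by (rule PiE_mem)

lemma trunc_Box [simp]: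
  assumes "X \<in> Mat"
  shows "trunc l X \<in> Box l"
proof -
  have "X ij l \<in> {0..<int p ^ l}" if "ij \<in> idx" for ij
  proof -
    have "X ij l mod int p ^ l \<in> {0..<int p ^ l}" using p0 by simp
    then show ?thesis unfolding padic_carrier_mod[OF Mat_entry[OF assms that]] .
  qed
  then show ?thesis unfolding trunc_def Box_def by (intro restrict_PiE_iff[THEN iffD2] ballI)
qed

lemma red_trunc:
  assumes "X \<in> Mat" "l \<le> k"
  shows "red l (trunc k X) = trunc l X"
proof (rule ext)
  fix ij
  show "red l (trunc k X) ij = trunc l X ij"
  proof (cases "ij \<in> idx")
    case True
    then show ?thesis unfolding red_def trunc_def
      using padic_residues_eq[OF Mat_entry[OF assms(1) True] assms(2)] by simp
  next
    case False
    then show ?thesis unfolding red_def trunc_def by simp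
  qed
qed

text \<open>Completeness of the space, which is immediate in the representation by residues.\<close>

lemma limit_matrix:
  assumes Z: "\<And>l. Z l \<in> Box l" "\<And>l. red l (Z (Suc l)) = Z l"
  obtains X where "X \<in> Mat" "\<And>l. trunc l X = Z l"
proof -
  define X where "X = (\<lambda>ij\<in>idx. \<lambda>l. Z l ij)"
  have "X \<in> Mat"
    unfolding padic_matrices_def idx_def[symmetric] X_def
  proof (intro restrict_PiE_iff[THEN iffD2] ballI)
    fix ij assume ij: "ij \<in> idx"
    show "(\<lambda>l. Z l ij) \<in> carrier (padic_ring p)"
      unfolding padic_carrier_iff
    proof
      fix l
      show "Z l ij = Z (Suc l) ij mod int p ^ l"
        using fun_cong[OF Z(2)[of l], of ij] ij unfolding red_def by simp
    qed
  qed
  moreover have "trunc l X = Z l" for l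
  proof (rule ext)
    fix ij show "trunc l X ij = Z l ij"
      unfolding trunc_def X_def using Box_arb[OF Z(1), of ij l] by (cases "ij \<in> idx") simp_all
  qed
  ultimately show thesis by (rule that)
qed

lemma idx_ne: "idx \<noteq> {}" unfolding idx_def using m0 n0 by auto

lemma max_abs_le_iff:
  assumes "finite I" "I \<noteq> {}"
  shows "padic_max_abs p I x \<le> c \<longleftrightarrow> (\<forall>i\<in>I. padic_abs p (x i) \<le> c)"
  unfolding padic_max_abs_def using assms by (subst Max_le_iff) auto

lemma dist_le_iff:
  assumes X: "X \<in> Mat" and Y: "Y \<in> Mat"
  shows "padic_matrix_dist p m n X Y \<le> (1 / real p) ^ l \<longleftrightarrow> trunc l X = trunc l Y"
proof -
  interpret cring "padic_ring p" by (rule padic_cring)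
  have *: "padic_abs p (X ij \<ominus>\<^bsub>padic_ring p\<^esub> Y ij) \<le> (1 / real p) ^ l \<longleftrightarrow> X ij l = Y ij l" if ij: "ij \<in> idx" for ij
  proof -
    note c = Mat_entry[OF X ij] Mat_entry[OF Y ij]
    have "padic_abs p (X ij \<ominus>\<^bsub>padic_ring p\<^esub> Y ij) \<le> (1 / real p) ^ l \<longleftrightarrow> (X ij l - Y ij l) mod int p ^ l = 0"
      using padic_abs_le_iff[OF _ p1, of "X ij \<ominus>\<^bsub>padic_ring p\<^esub> Y ij"] c padic_minus_nth[OF c] by simp
    also have "\<dots> \<longleftrightarrow> X ij l mod int p ^ l = Y ij l mod int p ^ l"
      by (simp only: mod_eq_0_iff_dvd mod_eq_dvd_iff)
    finally show ?thesis unfolding padic_carrier_mod[OF c(1)] padic_carrier_mod[OF c(2)] .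
  qed
  have "padic_matrix_dist p m n X Y = padic_max_abs p idx (\<lambda>ij. X ij \<ominus>\<^bsub>padic_ring p\<^esub> Y ij)"
    using X Y unfolding padic_matrix_dist_def idx_def by simp
  then have "padic_matrix_dist p m n X Y \<le> (1 / real p) ^ l \<longleftrightarrow> (\<forall>ij\<in>idx. X ij l = Y ij l)"
    using max_abs_le_iff[OF finite_idx idx_ne] * by simp
  also have "\<dots> \<longleftrightarrow> trunc l X = trunc l Y"
    unfolding trunc_def by (auto simp: fun_eq_iff restrict_def)
  finally show ?thesis .
qed

lemma max_abs_cases:
  assumes "finite I" "I \<noteq> {}"
  shows "padic_max_abs p I x = 0 \<or> (\<exists>k. padic_max_abs p I x = (1 / real p) ^ k)"
proof -
  have "padic_max_abs p I x \<in> (\<lambda>i. padic_abs p (x i)) ` I"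
    unfolding padic_max_abs_def using assms by (intro Max_in) auto
  then obtain i where "padic_max_abs p I x = padic_abs p (x i)" by blast
  then show ?thesis using padic_abs_cases[of "x i" p] by metis
qed

text \<open>The bridge from the set to be measured to the counting: reduction modulo
  \<open>p ^ l\<close> commutes with sums and products, and \<open>padic_abs_le_iff\<close> turns
  the norm into divisibility.\<close>

lemma vec_mat_le_iff:
  assumes X: "X \<in> Mat"
  shows "padic_max_abs p {..<n} (\<lambda>j. padic_vec_mat_mult p m q X j \<oplus>\<^bsub>padic_ring p\<^esub> padic_of_int p (a j))
      \<le> (1 / real p) ^ l \<longleftrightarrow> strip l q a (trunc l X)"
proof -
  interpret cring "padic_ring p" by (rule padic_cring)
  have *: "padic_abs p (padic_vec_mat_mult p m q X j \<oplus>\<^bsub>padic_ring p\<^esub> padic_of_int p (a j)) \<le> (1 / real p) ^ l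
      \<longleftrightarrow> int p ^ l dvd (\<Sum>i<m. q i * trunc l X (i, j)) + a j" if j: "j < n" for j
  proof -
    have Xc: "X (i, j) \<in> carrier (padic_ring p)" if "i \<in> {..<m}" for i
      using that j by (intro Mat_entry[OF X]) (simp add: idx_def)
    have c: "padic_of_int p (q i) \<otimes>\<^bsub>padic_ring p\<^esub> X (i, j) \<in> carrier (padic_ring p)" if "i \<in> {..<m}" for i
      using Xc[OF that] by simp
    have v: "padic_vec_mat_mult p m q X j \<in> carrier (padic_ring p)"
      unfolding padic_vec_mat_mult_def using c by (intro finsum_closed) auto
    have "padic_vec_mat_mult p m q X j l = (\<Sum>i<m. (padic_of_int p (q i) \<otimes>\<^bsub>padic_ring p\<^esub> X (i, j)) l) mod int p ^ l"
      unfolding padic_vec_mat_mult_def by (rule padic_finsum_nth[OF finite_lessThan c])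
    also have "\<dots> = (\<Sum>i<m. (q i * X (i, j) l) mod int p ^ l) mod int p ^ l"
      by (simp add: padic_ring_def padic_of_int_def mod_simps)
    also have "\<dots> = (\<Sum>i<m. q i * X (i, j) l) mod int p ^ l" by (rule mod_sum_eq)
    finally have 1: "padic_vec_mat_mult p m q X j l = (\<Sum>i<m. q i * X (i, j) l) mod int p ^ l" .
    have "(padic_vec_mat_mult p m q X j \<oplus>\<^bsub>padic_ring p\<^esub> padic_of_int p (a j)) l =
        (padic_vec_mat_mult p m q X j l + a j mod int p ^ l) mod int p ^ l"
      by (simp add: padic_ring_def padic_of_int_def)
    also have "\<dots> = ((\<Sum>i<m. q i * X (i, j) l) + a j) mod int p ^ l"
      unfolding 1 by (simp add: mod_simps)
    also have "(\<Sum>i<m. q i * X (i, j) l) = (\<Sum>i<m. q i * trunc l X (i, j))"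
      using j by (intro sum.cong refl) (simp add: trunc_def idx_def)
    finally show ?thesis
      using padic_abs_le_iff[OF a_closed[OF v padic_of_int_carrier] p1] by (simp add: mod_eq_0_iff_dvd)
  qed
  show ?thesis
    unfolding strip_def using n0 by (subst max_abs_le_iff) (auto simp: *)
qed

text \<open>Compactness in Koenig form: a residue class is bad if finitely many members of the cover
  already contain the part of some \<open>S k\<close> above it. If the whole space were not bad, one could
  follow classes that are not bad down to a matrix missed by the cover.\<close>

lemma finite_subcover:
  fixes lev :: "'i \<Rightarrow> nat"
  assumes L: "strict_mono L"
    and S: "\<And>k. S k \<subseteq> Box (L k)" "\<And>k y. y \<in> S (Suc k) \<Longrightarrow> red (L k) y \<in> S k"
    and cover: "\<And>X. X \<in> Mat \<Longrightarrow> (\<And>k. trunc (L k) X \<in> S k) \<Longrightarrow> \<exists>i\<in>I. trunc (lev i) X = c i"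
  obtains k J where "finite J" "J \<subseteq> I" "\<And>y. y \<in> S k \<Longrightarrow> \<exists>i\<in>J. lev i \<le> L k \<and> red (lev i) y = c i"
proof -
  \<comment> \<open>\<open>lev i \<le> L k\<close> is required because a point of \<open>S k\<close>
    is known only modulo \<open>p ^ L k\<close>.\<close>
  define bad where "bad = (\<lambda>l D k J. finite J \<and> J \<subseteq> I \<and> l \<le> L k \<and>
    (\<forall>y\<in>S k. red l y = D \<longrightarrow> (\<exists>i\<in>J. lev i \<le> L k \<and> red (lev i) y = c i)))"
  have Lmono: "L k \<le> L k'" if "k \<le> k'" for k k' using L that by (simp add: strict_mono_less_eq)
  have S_red: "red (L k) y \<in> S k" if "k \<le> k'" "y \<in> S k'" for k k' y
    using that
  proof (induction k' arbitrary: y rule: dec_induct)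
    case base
    then show ?case using S(1) red_id by fastforce
  next
    case (step j)
    have "red (L k) (red (L j) y) \<in> S k" by (rule step.IH[OF S(2)[OF step.prems]])
    then show ?case using red_red[OF Lmono[OF step.hyps(1)]] by simp
  qed
  have bad_mono: "bad l D k' J'" if b: "bad l D k J" and k: "k \<le> k'" and J: "J \<subseteq> J'" "finite J'" "J' \<subseteq> I" for l D k J k' J'
    unfolding bad_def
  proof (intro conjI ballI impI)
    show "l \<le> L k'" using b Lmono[OF k] unfolding bad_def by linarith
    fix y assume y: "y \<in> S k'" "red l y = D"
    have l: "l \<le> L k" using b unfolding bad_def by blast
    have "red l (red (L k) y) = D" using red_red[OF l] y(2) by simp
    then obtain i where i: "i \<in> J" "lev i \<le> L k" "red (lev i) (red (L k) y) = c i"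
      using b S_red[OF k y(1)] unfolding bad_def by blast
    have "lev i \<le> L k'" using i(2) Lmono[OF k] by linarith
    moreover have "red (lev i) y = c i" using i(3) unfolding red_red[OF i(2)] .
    ultimately show "\<exists>i\<in>J'. lev i \<le> L k' \<and> red (lev i) y = c i" using i(1) J(1) by blast
  qed (use J in auto)
  have child: "\<exists>D'. D' \<in> Box (Suc l) \<and> \<not> (\<exists>k J. bad (Suc l) D' k J) \<and> red l D' = D" if nb: "\<not> (\<exists>k J. bad l D k J)" for l D
  proof (rule ccontr)
    assume n: "\<not> ?thesis"
    let ?C = "{D' \<in> Box (Suc l). red l D' = D}"
    have "\<forall>D'\<in>?C. \<exists>k J. bad (Suc l) D' k J" using n by blast
    then obtain K J where KJ: "\<And>D'. D' \<in> ?C \<Longrightarrow> bad (Suc l) D' (K D') (J D')" by metis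
    have finC: "finite ?C" by simp
    \<comment> \<open>A common stage for the finitely many children; inserting \<open>Suc l\<close>
      ensures \<open>Suc l \<le> L k\<close>.\<close>
    define k where "k = Max (insert (Suc l) (K ` ?C))"
    define U where "U = (\<Union>D'\<in>?C. J D')"
    have kge: "K D' \<le> k" if "D' \<in> ?C" for D' unfolding k_def using finC that by (intro Max_ge) auto
    have "Suc l \<le> k" unfolding k_def using finC by (intro Max_ge) auto
    also have "k \<le> L k" using L by (rule strict_mono_imp_increasing)
    finally have lk: "Suc l \<le> L k" .
    have U: "finite U" "U \<subseteq> I" unfolding U_def using finC KJ unfolding bad_def by blast+
    have "bad l D k U"
      unfolding bad_def
    proof (intro conjI ballI impI)
      show "l \<le> L k" using lk by simp
      fix y assume y: "y \<in> S k" "red l y = D"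
      define D' where "D' = red (Suc l) y"
      have D': "D' \<in> ?C" unfolding D'_def using y(2) red_red[of l "Suc l" y] by simp
      have "J D' \<subseteq> U" unfolding U_def using D' by blast
      then have "bad (Suc l) D' k U" by (rule bad_mono[OF KJ[OF D'] kge[OF D'] _ U])
      then show "\<exists>i\<in>U. lev i \<le> L k \<and> red (lev i) y = c i" using y(1) D'_def unfolding bad_def by blast
    qed (use U in auto)
    then show False using nb by blast
  qed
  have root: "\<exists>k J. bad 0 (\<lambda>ij\<in>idx. 0) k J"
  proof (rule ccontr)
    assume n: "\<not> ?thesis"
    have "\<exists>Z. \<forall>l. (Z l \<in> Box l \<and> \<not> (\<exists>k J. bad l (Z l) k J)) \<and> red l (Z (Suc l)) = Z l"
    proof (rule dependent_nat_choice)
      show "\<exists>x. x \<in> Box 0 \<and> \<not> (\<exists>k J. bad 0 x k J)" using n zero_Box by blast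
      show "\<exists>y. (y \<in> Box (Suc l) \<and> \<not> (\<exists>k J. bad (Suc l) y k J)) \<and> red l y = x"
        if "x \<in> Box l \<and> \<not> (\<exists>k J. bad l x k J)" for x l using child[of l x] that by blast
    qed
    then obtain Z where Z: "\<And>l. Z l \<in> Box l" "\<And>l k J. \<not> bad l (Z l) k J" "\<And>l. red l (Z (Suc l)) = Z l" by blast
    obtain X where X: "X \<in> Mat" "\<And>l. trunc l X = Z l" by (rule limit_matrix[OF Z(1,3)]) blast
    \<comment> \<open>If a truncation of the limit left \<open>S k\<close>, no point of
      \<open>S k\<close> would lie in the class \<open>Z (L k)\<close>, which would then be bad with
      an empty subcover.\<close>
    have "trunc (L k) X \<in> S k" for k
    proof (rule ccontr)
      assume nk: "trunc (L k) X \<notin> S k"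
      have "bad (L k) (Z (L k)) k {}"
        unfolding bad_def
      proof (intro conjI ballI impI)
        fix y assume y: "y \<in> S k" "red (L k) y = Z (L k)"
        have "red (L k) y = y" using S(1) y(1) by (intro red_id) blast
        then show "\<exists>i\<in>{}. lev i \<le> L k \<and> red (lev i) y = c i" using nk X(2) y by simp
      qed auto
      then show False using Z(2) by blast
    qed
    then obtain i where i: "i \<in> I" "trunc (lev i) X = c i" using cover[OF X(1)] by blast
    have "lev i \<le> L (lev i)" using L by (rule strict_mono_imp_increasing)
    then have "bad (lev i) (Z (lev i)) (lev i) {i}" unfolding bad_def using i X(2) by auto
    then show False using Z(2) by blast
  qed
  then obtain k J where kJ: "bad 0 (\<lambda>ij\<in>idx. 0) k J" by blast
  show thesis by (rule that[of J k]) (use kJ in \<open>auto simp: bad_def red_0\<close>)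
qed

end

section \<open>Mass distribution and the lower bound for the Hausdorff measure\<close>

context jarnik
begin

lemma below_lv:
  assumes "0 < r" "z = 0 \<or> (\<exists>k. z = (1 / real p) ^ k)"
  shows "z < r \<longleftrightarrow> z \<le> (1 / real p) ^ lv r"
proof
  assume z: "z < r"
  show "z \<le> (1 / real p) ^ lv r"
  proof (cases "z = 0")
    case False
    then obtain k where k: "z = (1 / real p) ^ k" using assms(2) by blast
    then have "lv r \<le> k" using z by (intro lv_le) simp
    then show ?thesis unfolding k using P1 by (intro power_decreasing) auto
  qed simp
next
  assume "z \<le> (1 / real p) ^ lv r"
  then show "z < r" using lv_less[OF assms(1)] by linarith
qed

lemma mball_trunc:
  assumes c: "c \<in> Mat" and r: "0 < r"
  shows "mball_of Mmet c r = {Y \<in> Mat. trunc (lv r) Y = trunc (lv r) c}"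
proof -
  have "padic_matrix_dist p m n c Y < r \<longleftrightarrow> trunc (lv r) Y = trunc (lv r) c" if Y: "Y \<in> Mat" for Y
  proof -
    have "padic_matrix_dist p m n c Y = padic_max_abs p idx (\<lambda>ij. c ij \<ominus>\<^bsub>padic_ring p\<^esub> Y ij)"
      using c Y unfolding padic_matrix_dist_def idx_def by simp
    then have "padic_matrix_dist p m n c Y < r \<longleftrightarrow> padic_matrix_dist p m n c Y \<le> (1 / real p) ^ lv r"
      using max_abs_cases[OF finite_idx idx_ne] by (intro below_lv[OF r]) simp
    also have "\<dots> \<longleftrightarrow> trunc (lv r) c = trunc (lv r) Y" by (rule dist_le_iff[OF c Y])
    finally show ?thesis by (simp only: eq_commute)
  qed
  then show ?thesis
    using c by (auto simp: mspace_padic_matrix_metric[OF prime m0 n0] mdist_padic_matrix_metric[OF prime m0 n0])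
qed

text \<open>One approximating pair for each height bound is enough, since finitely many pairs have
  bounded height.\<close>

lemma good_infinite:
  assumes X: "X \<in> Mat" and L: "\<And>k. good (Suc k) (L k) (trunc (L k) X)"
  shows "X \<in> padic_approximable p m n \<psi>"
proof -
  let ?h = "\<lambda>(a, q). max (int_max_abs n a) (int_max_abs m q)"
  let ?S = "{(a, q). a \<in> int_vectors n \<and> q \<in> int_vectors m \<and>
          padic_max_abs p {..<n}
            (\<lambda>j. padic_vec_mat_mult p m q X j \<oplus>\<^bsub>padic_ring p\<^esub> padic_of_int p (a j))
          < \<psi> (max (int_max_abs n a) (int_max_abs m q))}"
  have ex: "\<exists>x\<in>?S. Suc k \<le> ?h x" for k
  proof -
    obtain q a \<sigma> where qa: "q \<in> int_vectors m" "a \<in> int_vectors n" "Suc k \<le> ?h (a, q)" "\<sigma> \<le> L k"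
      "(1 / real p) ^ \<sigma> < \<psi> (?h (a, q))" "strip \<sigma> q a (trunc (L k) X)"
      using L[of k] unfolding good_def prod.case by blast
    have "strip \<sigma> q a (trunc \<sigma> X)"
      using qa(6) strip_red[OF order_refl, of \<sigma> q a "trunc (L k) X"] red_trunc[OF X qa(4)] by simp
    then have "padic_max_abs p {..<n} (\<lambda>j. padic_vec_mat_mult p m q X j \<oplus>\<^bsub>padic_ring p\<^esub> padic_of_int p (a j)) \<le> (1 / real p) ^ \<sigma>"
      unfolding vec_mat_le_iff[OF X] .
    then have "(a, q) \<in> ?S" using qa(1,2,5) by simp
    then show ?thesis using qa(3) by blast
  qed
  have "infinite ?S"
  proof
    assume "finite ?S"
    then have fin: "finite (?h ` ?S)" by (rule finite_imageI)
    obtain x where x: "x \<in> ?S" "Suc (Max (?h ` ?S)) \<le> ?h x" using ex by blast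
    have "?h x \<le> Max (?h ` ?S)" using fin x(1) by (intro Max_ge) auto
    then show False using x(2) by linarith
  qed
  then show ?thesis unfolding padic_approximable_def using X by blast
qed

text \<open>The mass distribution principle on one finite level. By compactness finitely many balls
  of the cover contain the support \<open>S k\<close> of one of the weights, so its total mass 1 is
  at most \<open>\<epsilon>\<close> times the sum of their \<open>f (r i)\<close>.\<close>

lemma premeasure_ge:
  assumes \<epsilon>: "0 < \<epsilon>" and div: "\<not> summable (\<lambda>t. 16 ^ (t * (m + n)) * g (\<psi> (16 ^ t)))"
  shows "\<exists>\<rho>>0. ennreal (1 / \<epsilon>) \<le> hausdorff_premeasure Mmet f \<rho> (padic_approximable p m n \<psi>)"
proof -
  obtain s1 L w where adm: "\<And>k. admissible \<epsilon> s1 (L k) (w k)" and L: "strict_mono L" and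
    step: "\<And>k y. y \<in> Box (L (Suc k)) \<Longrightarrow> 0 < w (Suc k) y \<Longrightarrow> 0 < w k (red (L k) y) \<and> good (Suc k) (L (Suc k)) y"
  proof (rule admissible_sequence[OF \<epsilon> div, of 0])
    fix s1 L w
    assume "\<And>k. admissible \<epsilon> s1 (L k) (w k)" "strict_mono L"
      "\<And>k y. y \<in> Box (L (Suc k)) \<Longrightarrow> 0 < w (Suc k) y \<Longrightarrow> 0 < w k (red (L k) y) \<and> good (Suc k) (L (Suc k)) y"
    then show thesis by (rule that[of s1 L w])
  qed
  define S where "S = (\<lambda>k. {y \<in> Box (L k). 0 < w k y})"
  \<comment> \<open>Radii up to \<open>p ^ -s1\<close> force the levels of the balls to be at least
    \<open>s1\<close>, where the mass bound holds.\<close>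
  have "ennreal (1 / \<epsilon>) \<le> hausdorff_premeasure Mmet f ((1 / real p) ^ s1) (padic_approximable p m n \<psi>)"
    unfolding hausdorff_premeasure_def
  proof (rule Inf_greatest, elim CollectE exE conjE)
    fix z and I :: "nat set" and c r
    assume z: "z = (\<Sum>\<^sub>\<infinity>i\<in>I. ennreal (f (r i)))"
      and cr: "\<forall>i\<in>I. c i \<in> mspace Mmet \<and> 0 < r i \<and> r i \<le> (1 / real p) ^ s1"
      and cov: "padic_approximable p m n \<psi> \<subseteq> (\<Union>i\<in>I. mball_of Mmet (c i) (r i))"
    have c: "c i \<in> Mat" and r: "0 < r i" "r i \<le> (1 / real p) ^ s1" if "i \<in> I" for i
      using cr that unfolding mspace_padic_matrix_metric[OF prime m0 n0] by blast+
    obtain k J where J: "finite J" "J \<subseteq> I"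
      and Jc: "\<And>y. y \<in> S k \<Longrightarrow> \<exists>i\<in>J. lv (r i) \<le> L k \<and> red (lv (r i)) y = trunc (lv (r i)) (c i)"
    proof (rule finite_subcover[OF L, of S I "\<lambda>i. lv (r i)" "\<lambda>i. trunc (lv (r i)) (c i)"])
      show "S k \<subseteq> Box (L k)" for k unfolding S_def by blast
      show "red (L k) y \<in> S k" if "y \<in> S (Suc k)" for k y using step that unfolding S_def by simp
      show "\<exists>i\<in>I. trunc (lv (r i)) X = trunc (lv (r i)) (c i)" if X: "X \<in> Mat" "\<And>k. trunc (L k) X \<in> S k" for X
      proof -
        have "good (Suc k) (L (Suc k)) (trunc (L (Suc k)) X)" for k
          using X(2)[of "Suc k"] step unfolding S_def by blast
        then have "X \<in> padic_approximable p m n \<psi>" by (rule good_infinite[OF X(1)])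
        then obtain i where i: "i \<in> I" "X \<in> mball_of Mmet (c i) (r i)" using cov by blast
        then show ?thesis using mball_trunc[OF c[OF i(1)] r(1)[OF i(1)]] by blast
      qed
    qed blast
    define J' where "J' = {i \<in> J. lv (r i) \<le> L k}"
    have J': "finite J'" "J' \<subseteq> I" unfolding J'_def using J by auto
    have w0: "\<And>y. 0 \<le> w k y" and w1: "sum (w k) (Box (L k)) = 1"
      and wm: "\<And>l E. s1 \<le> l \<Longrightarrow> l \<le> L k \<Longrightarrow> E \<in> Box l \<Longrightarrow> mass (L k) E (w k) l \<le> \<epsilon> * \<phi> l"
      using adm[of k] unfolding admissible_def by blast+
    have "1 = sum (w k) (S k)"
      unfolding w1[symmetric] S_def
    proof (rule sum.mono_neutral_right)
      show "\<forall>i\<in>Box (L k) - {y \<in> Box (L k). 0 < w k y}. w k i = 0"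
        using w0 by (auto simp: not_less intro: order_antisym)
    qed auto
    also have "\<dots> \<le> (\<Sum>y\<in>(\<Union>i\<in>J'. {y \<in> Box (L k). red (lv (r i)) y = trunc (lv (r i)) (c i)}). w k y)"
    proof (rule sum_mono2)
      show "finite (\<Union>i\<in>J'. {y \<in> Box (L k). red (lv (r i)) y = trunc (lv (r i)) (c i)})" using J' by auto
      show "S k \<subseteq> (\<Union>i\<in>J'. {y \<in> Box (L k). red (lv (r i)) y = trunc (lv (r i)) (c i)})"
      proof
        fix y assume y: "y \<in> S k"
        then have "y \<in> Box (L k)" unfolding S_def by blast
        then show "y \<in> (\<Union>i\<in>J'. {y \<in> Box (L k). red (lv (r i)) y = trunc (lv (r i)) (c i)})"
          using Jc[OF y] unfolding J'_def by blast
      qed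
    qed (rule w0)
    also have "\<dots> \<le> (\<Sum>i\<in>J'. mass (L k) (trunc (lv (r i)) (c i)) (w k) (lv (r i)))"
      unfolding mass_def using J' w0 by (intro sum_UNION_le) auto
    also have "\<dots> \<le> (\<Sum>i\<in>J'. \<epsilon> * f (r i))"
    proof (rule sum_mono)
      fix i assume i: "i \<in> J'"
      then have iI: "i \<in> I" and il: "lv (r i) \<le> L k" using J' unfolding J'_def by auto
      have lt: "(1 / real p) ^ lv (r i) < r i" by (rule lv_less[OF r(1)[OF iI]])
      have "s1 \<le> lv (r i)"
      proof (rule ccontr)
        assume "\<not> s1 \<le> lv (r i)"
        then have "(1 / real p) ^ s1 \<le> (1 / real p) ^ lv (r i)" using P1 by (intro power_decreasing) auto
        then show False using lt r(2)[OF iI] by linarith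
      qed
      then have "mass (L k) (trunc (lv (r i)) (c i)) (w k) (lv (r i)) \<le> \<epsilon> * \<phi> (lv (r i))"
        using il c[OF iI] by (intro wm) auto
      also have "\<dots> \<le> \<epsilon> * f (r i)"
        unfolding \<phi>_def using \<epsilon> lt by (intro mult_left_mono f_mono) auto
      finally show "mass (L k) (trunc (lv (r i)) (c i)) (w k) (lv (r i)) \<le> \<epsilon> * f (r i)" .
    qed
    also have "\<dots> = \<epsilon> * (\<Sum>i\<in>J'. f (r i))" by (simp only: sum_distrib_left)
    finally have "1 / \<epsilon> \<le> (\<Sum>i\<in>J'. f (r i))" using \<epsilon> by (simp add: field_simps)
    then have "ennreal (1 / \<epsilon>) \<le> ennreal (\<Sum>i\<in>J'. f (r i))" by (rule ennreal_leI)
    also have "\<dots> = (\<Sum>i\<in>J'. ennreal (f (r i)))"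
      using J' r(1) f_pos by (intro sum_ennreal[symmetric]) (auto intro!: less_imp_le)
    also have "\<dots> \<le> z"
      unfolding z using J' by (subst nonneg_infsum_complete) (auto intro!: SUP_upper)
    finally show "ennreal (1 / \<epsilon>) \<le> z" .
  qed
  then show ?thesis by (intro exI[of _ "(1 / real p) ^ s1"]) simp
qed

lemma hausdorff_measure_infinite:
  assumes div: "\<not> summable (\<lambda>t. 16 ^ (t * (m + n)) * g (\<psi> (16 ^ t)))"
  shows "hausdorff_measure Mmet f (padic_approximable p m n \<psi>) = \<infinity>"
proof -
  have le: "of_nat k \<le> hausdorff_measure Mmet f (padic_approximable p m n \<psi>)" for k
  proof -
    obtain \<rho> where \<rho>: "0 < \<rho>" "ennreal (1 / (1 / (real k + 1))) \<le> hausdorff_premeasure Mmet f \<rho> (padic_approximable p m n \<psi>)"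
      using premeasure_ge[OF _ div, of "1 / (real k + 1)"] by auto
    have "of_nat k \<le> ennreal (1 / (1 / (real k + 1)))"
      by (simp add: ennreal_of_nat_eq_real_of_nat ennreal_leI)
    also note \<rho>(2)
    also have "hausdorff_premeasure Mmet f \<rho> (padic_approximable p m n \<psi>) \<le> hausdorff_measure Mmet f (padic_approximable p m n \<psi>)"
      unfolding hausdorff_measure_eq_SUP using \<rho>(1) by (intro SUP_upper) simp
    finally show ?thesis .
  qed
  show ?thesis
  proof (rule ccontr)
    assume "\<not> ?thesis"
    then have "hausdorff_measure Mmet f (padic_approximable p m n \<psi>) < \<infinity>" by (simp add: less_top)
    then obtain k where "hausdorff_measure Mmet f (padic_approximable p m n \<psi>) < of_nat k"
      using ennreal_Ex_less_of_nat[of "hausdorff_measure Mmet f (padic_approximable p m n \<psi>)"] by auto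
    then show False using le[of k] by simp
  qed
qed

end

section \<open>The convergence case\<close>

lemma sum_lessThan_split:
  fixes h :: "nat \<Rightarrow> real"
  assumes "x \<le> y"
  shows "(\<Sum>r<y. h r) = (\<Sum>r<x. h r) + (\<Sum>r\<in>{x..<y}. h r)"
  using sum.atLeastLessThan_concat[of 0 x y h] assms by (simp add: lessThan_atLeast0)

context jarnik
begin

section \<open>Condensation of the series to the heights \<open>16 ^ t\<close>\<close>

definition condensed :: "nat \<Rightarrow> real" where "condensed t = 16 ^ (t * (m + n)) * g (\<psi> (16 ^ t))"

definition series_term :: "nat \<Rightarrow> real" where "series_term r = g (\<psi> (Suc r)) * real (Suc r) ^ (m + n - 1)"

lemma condensed_nonneg: "0 \<le> condensed t"
  unfolding condensed_def using g_pos[OF \<psi>_pos[of "16 ^ t"]] by simp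

lemma series_term_nonneg: "0 \<le> series_term r"
  unfolding series_term_def using g_pos[OF \<psi>_pos[of "Suc r"]] by simp

lemma g\<psi>_anti: "1 \<le> r \<Longrightarrow> r \<le> r' \<Longrightarrow> g (\<psi> r') \<le> g (\<psi> r)"
  using monotone_onD[OF \<psi>_anti, of r r'] by (intro g_le \<psi>_pos) auto

lemma g\<psi>_nonneg [simp]: "0 \<le> g (\<psi> (Suc r))"
  using g_pos[OF \<psi>_pos[of "Suc r"]] by simp

lemma N_Suc: "m + n = Suc (m + n - 1)"
  using m0 by simp

text \<open>The term with index \<open>r\<close> belongs to height \<open>r + 1\<close>, so the
  indices from \<open>16 ^ t\<close> to \<open>16 ^ (t + 1) - 1\<close> have heights at most
  \<open>16 ^ (t + 1)\<close>, where \<open>g\<close> of \<open>\<psi>\<close> is at least its value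
  at \<open>16 ^ (t + 1)\<close>.\<close>

lemma summable_condensed:
  assumes "summable series_term"
  shows "summable condensed"
proof -
  have block: "condensed (Suc t) \<le> 16 ^ (m + n) * (\<Sum>r\<in>{16 ^ t..<16 ^ Suc t}. series_term r)" for t
  proof -
    have "16 ^ t * (g (\<psi> (16 ^ Suc t)) * 16 ^ (t * (m + n - 1))) \<le>
        real (card {16 ^ t..<16 ^ Suc t :: nat}) * (g (\<psi> (16 ^ Suc t)) * 16 ^ (t * (m + n - 1)))"
      using g_pos[OF \<psi>_pos[of "16 ^ Suc t"]] by (intro mult_right_mono) auto
    also have "\<dots> = (\<Sum>r\<in>{16 ^ t..<16 ^ Suc t :: nat}. g (\<psi> (16 ^ Suc t)) * 16 ^ (t * (m + n - 1)))"
      by (simp only: sum_constant)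
    also have "\<dots> \<le> (\<Sum>r\<in>{16 ^ t..<16 ^ Suc t}. series_term r)"
    proof (rule sum_mono)
      fix r :: nat assume r: "r \<in> {16 ^ t..<16 ^ Suc t}"
      have "16 ^ t \<le> Suc r" using r by simp
      then have "real (16 ^ t) \<le> real (Suc r)" by (simp only: of_nat_le_iff)
      then have "(16 ^ t) ^ (m + n - 1) \<le> real (Suc r) ^ (m + n - 1)" by (intro power_mono) auto
      then show "g (\<psi> (16 ^ Suc t)) * 16 ^ (t * (m + n - 1)) \<le> series_term r"
        unfolding series_term_def power_mult using r g_pos[OF \<psi>_pos[of "16 ^ Suc t"]] by (intro mult_mono g\<psi>_anti) auto
    qed
    finally have "16 ^ (m + n) * (16 ^ t * (g (\<psi> (16 ^ Suc t)) * 16 ^ (t * (m + n - 1)))) \<le> 16 ^ (m + n) * (\<Sum>r\<in>{16 ^ t..<16 ^ Suc t}. series_term r)"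
      by (intro mult_left_mono) auto
    moreover have "16 ^ (m + n) * (16 ^ t * (g (\<psi> (16 ^ Suc t)) * 16 ^ (t * (m + n - 1)))) = condensed (Suc t)"
    proof -
      have "t + t * (m + n - 1) = t * (m + n)" using N_Suc by (metis mult_Suc_right)
      then have "Suc t * (m + n) = (m + n) + (t + t * (m + n - 1))" by simp
      then have "(16::real) ^ (Suc t * (m + n)) = 16 ^ (m + n) * (16 ^ t * 16 ^ (t * (m + n - 1)))"
        by (simp only: power_add)
      then show ?thesis unfolding condensed_def by (simp only: mult_ac)
    qed
    ultimately show ?thesis by linarith
  qed
  have "(\<Sum>t<T. condensed (Suc t)) \<le> 16 ^ (m + n) * (\<Sum>r<16 ^ T. series_term r)" for T
  proof (induction T)
    case 0
    then show ?case using series_term_nonneg by simp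
  next
    case (Suc T)
    have "(\<Sum>r<16 ^ Suc T. series_term r) = (\<Sum>r<16 ^ T. series_term r) + (\<Sum>r\<in>{16 ^ T..<16 ^ Suc T}. series_term r)"
      by (rule sum_lessThan_split) simp
    then show ?case using Suc block[of T] by (simp add: distrib_left)
  qed
  moreover have "16 ^ (m + n) * (\<Sum>r<16 ^ T. series_term r) \<le> 16 ^ (m + n) * suminf series_term" for T :: nat
    using assms series_term_nonneg by (intro mult_left_mono sum_le_suminf) auto
  ultimately have "(\<Sum>t<T. condensed (Suc t)) \<le> 16 ^ (m + n) * suminf series_term" for T
    by (meson order_trans)
  then have "summable (\<lambda>t. condensed (Suc t))"
    using condensed_nonneg by (intro summableI_nonneg_bounded) auto
  then show ?thesis by (simp only: summable_Suc_iff)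
qed

text \<open>Here the blocks are shifted by 1 so as to contain exactly the heights from
  \<open>16 ^ t\<close> to \<open>16 ^ (t + 1) - 1\<close>, since an upper bound by the value at
  \<open>16 ^ t\<close> is wanted; the shifted blocks start at index 0 and exhaust all
  indices.\<close>

lemma summable_series_term:
  assumes "summable condensed"
  shows "summable series_term"
proof -
  have block: "(\<Sum>r\<in>{16 ^ t - 1..<16 ^ Suc t - 1}. series_term r) \<le> 16 ^ (m + n) * condensed t" for t
  proof -
    have "(\<Sum>r\<in>{16 ^ t - 1..<16 ^ Suc t - 1}. series_term r) \<le>
        (\<Sum>r\<in>{16 ^ t - 1..<16 ^ Suc t - 1 :: nat}. g (\<psi> (16 ^ t)) * (16 ^ Suc t) ^ (m + n - 1))"
    proof (rule sum_mono)
      fix r :: nat assume r: "r \<in> {16 ^ t - 1..<16 ^ Suc t - 1}"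
      have "Suc r \<le> 16 ^ Suc t" using r by auto
      then have "real (Suc r) \<le> real (16 ^ Suc t)" by (simp only: of_nat_le_iff)
      then have "real (Suc r) ^ (m + n - 1) \<le> (16 ^ Suc t) ^ (m + n - 1)" by (intro power_mono) auto
      moreover have "16 ^ t \<le> Suc r" using r by auto
      ultimately show "series_term r \<le> g (\<psi> (16 ^ t)) * (16 ^ Suc t) ^ (m + n - 1)"
        unfolding series_term_def using g_pos[OF \<psi>_pos[of "16 ^ t"]] by (intro mult_mono g\<psi>_anti) auto
    qed
    also have "\<dots> = real (card {16 ^ t - 1..<16 ^ Suc t - 1 :: nat}) * (g (\<psi> (16 ^ t)) * (16 ^ Suc t) ^ (m + n - 1))"
      by (simp only: sum_constant)
    also have "\<dots> \<le> 16 ^ Suc t * (g (\<psi> (16 ^ t)) * (16 ^ Suc t) ^ (m + n - 1))"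
    proof (intro mult_right_mono)
      have "card {16 ^ t - 1..<16 ^ Suc t - 1 :: nat} \<le> 16 ^ Suc t" by simp
      then have "real (card {16 ^ t - 1..<16 ^ Suc t - 1 :: nat}) \<le> real (16 ^ Suc t)" by (simp only: of_nat_le_iff)
      then show "real (card {16 ^ t - 1..<16 ^ Suc t - 1 :: nat}) \<le> 16 ^ Suc t" by (simp only: of_nat_power of_nat_numeral)
    qed (use g_pos[OF \<psi>_pos[of "16 ^ t"]] in simp)
    also have "\<dots> = g (\<psi> (16 ^ t)) * (16 ^ Suc t) ^ (m + n)"
    proof -
      have "(x::real) ^ (m + n) = x * x ^ (m + n - 1)" for x using N_Suc by (metis power_Suc)
      then show ?thesis by (simp only: mult.left_commute)
    qed
    also have "(16 ^ Suc t) ^ (m + n) = (16::real) ^ (m + n) * 16 ^ (t * (m + n))"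
      by (simp add: power_mult power_mult_distrib)
    finally show ?thesis unfolding condensed_def by (simp only: mult_ac)
  qed
  have part: "(\<Sum>r<16 ^ T - 1. series_term r) \<le> 16 ^ (m + n) * (\<Sum>t<T. condensed t)" for T
  proof (induction T)
    case (Suc T)
    have "(\<Sum>r<16 ^ Suc T - 1. series_term r) = (\<Sum>r<16 ^ T - 1. series_term r) + (\<Sum>r\<in>{16 ^ T - 1..<16 ^ Suc T - 1}. series_term r)"
      by (rule sum_lessThan_split) (simp add: diff_le_mono)
    then show ?case using Suc block[of T] by (simp add: distrib_left)
  qed simp
  have "(\<Sum>r<T. series_term r) \<le> 16 ^ (m + n) * suminf condensed" for T
  proof -
    have "T < 2 ^ T" by (rule less_exp)
    also have "(2::nat) ^ T \<le> 16 ^ T" by (rule power_mono) auto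
    finally have "T \<le> 16 ^ T - 1" by linarith
    then have "(\<Sum>r<T. series_term r) \<le> (\<Sum>r<16 ^ T - 1. series_term r)"
      using series_term_nonneg by (intro sum_mono2) auto
    also note part[of T]
    also have "16 ^ (m + n) * (\<Sum>t<T. condensed t) \<le> 16 ^ (m + n) * suminf condensed"
      using assms condensed_nonneg by (intro mult_left_mono sum_le_suminf) auto
    finally show ?thesis .
  qed
  then show ?thesis using series_term_nonneg by (intro summableI_nonneg_bounded) auto
qed

section \<open>Covers of the strips by residue classes, and their cost\<close>

lemma column_zero_count:
  assumes i: "i < m" "\<not> int p dvd q i"
  shows "card {y \<in> {..<m} \<rightarrow>\<^sub>E {0..<int p ^ l}. int p ^ l dvd (\<Sum>i<m. q i * y i) + c} \<le> p ^ (l * (m - 1))"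
proof -
  let ?S = "{0..<int p ^ l}" and ?J = "{..<m} - {i}"
  have J: "{..<m} = insert i ?J" using i(1) by auto
  have inner: "card {w \<in> ?S. int p ^ l dvd (\<Sum>k<m. q k * (x(i := w)) k) + c} \<le> p ^ (l - l)" for x
  proof (rule card_residue_class_le[OF p0 order_refl])
    fix w w' assume "w \<in> {w \<in> ?S. int p ^ l dvd (\<Sum>k<m. q k * (x(i := w)) k) + c}"
      "w' \<in> {w \<in> ?S. int p ^ l dvd (\<Sum>k<m. q k * (x(i := w)) k) + c}"
    then have "int p ^ l dvd ((\<Sum>k<m. q k * (x(i := w)) k) + c) - ((\<Sum>k<m. q k * (x(i := w')) k) + c)"
      by (intro dvd_diff) blast+
    also have "((\<Sum>k<m. q k * (x(i := w)) k) + c) - ((\<Sum>k<m. q k * (x(i := w')) k) + c) = q i * (w - w')"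
    proof -
      have s: "(\<Sum>k<m. q k * (x(i := w)) k) = q i * w + (\<Sum>k\<in>?J. q k * x k)" for w
      proof -
        have "(\<Sum>k<m. q k * (x(i := w)) k) = q i * (x(i := w)) i + (\<Sum>k\<in>?J. q k * (x(i := w)) k)"
          using i(1) by (intro sum.remove) auto
        moreover have "(\<Sum>k\<in>?J. q k * (x(i := w)) k) = (\<Sum>k\<in>?J. q k * x k)"
          by (intro sum.cong) auto
        ultimately show ?thesis by simp
      qed
      show ?thesis unfolding s by (simp add: algebra_simps)
    qed
    finally show "int p ^ l dvd w - w'"
      using coprime_dvd_mult_right_iff[OF coprime_ppow[OF i(2)]] by blast
  qed auto
  have "card {y \<in> insert i ?J \<rightarrow>\<^sub>E ?S. int p ^ l dvd (\<Sum>i<m. q i * y i) + c}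
      = (\<Sum>x\<in>?J \<rightarrow>\<^sub>E ?S. card {w \<in> ?S. int p ^ l dvd (\<Sum>k<m. q k * (x(i := w)) k) + c})"
    by (rule card_PiE_fibre) auto
  also have "\<dots> \<le> of_nat (card (?J \<rightarrow>\<^sub>E ?S)) * p ^ (l - l)"
    by (rule sum_bounded_above) (rule inner)
  also have "card (?J \<rightarrow>\<^sub>E ?S) = p ^ (l * (m - 1))"
    using i(1) by (simp add: card_PiE power_mult nat_power_eq)
  finally show ?thesis unfolding J[symmetric] by simp
qed

text \<open>The entry of \<open>q\<close> prime to \<open>p\<close> solves for one row of the matrix
  and leaves \<open>(m - 1) * n\<close> free residues. Any index \<open>i\<close> is allowed,
  because after division by a power of \<open>p\<close> the unit may sit anywhere.\<close>

lemma strip_zero_count: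
  assumes i: "i < m" "\<not> int p dvd q i"
  shows "card {y \<in> Box l. strip l q b y} \<le> p ^ (l * ((m - 1) * n))"
proof -
  let ?S = "{0..<int p ^ l}"
  have eq: "{y \<in> Box l. strip l q b y} = {x \<in> {..<m} \<times> {..<n} \<rightarrow>\<^sub>E ?S. \<forall>j\<in>{..<n}.
      int p ^ l dvd (\<Sum>i<m. q i * (\<lambda>i\<in>{..<m}. x (i, j)) i) + b j}"
    unfolding Box_def strip_def idx_def by (rule Collect_cong) auto
  have "card {y \<in> Box l. strip l q b y} = (\<Prod>j\<in>{..<n}. card {y \<in> {..<m} \<rightarrow>\<^sub>E ?S. int p ^ l dvd (\<Sum>i<m. q i * y i) + b j})"
    unfolding eq by (rule card_PiE_columns) auto
  also have "\<dots> \<le> (\<Prod>j\<in>{..<n}. p ^ (l * (m - 1)))"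
    using column_zero_count[where q = q and i = i, OF i] by (intro prod_mono) simp
  finally show ?thesis by (simp add: power_mult)
qed

definition bounded_vectors :: "nat \<Rightarrow> nat \<Rightarrow> (nat \<Rightarrow> int) set" where
  "bounded_vectors k R = {..<k} \<rightarrow>\<^sub>E {- int R..int R}"

lemma finite_bounded_vectors [simp]: "finite (bounded_vectors k R)"
  unfolding bounded_vectors_def by (intro finite_PiE) auto

lemma card_bounded_vectors: "card (bounded_vectors k R) = (2 * R + 1) ^ k"
  unfolding bounded_vectors_def by (simp add: card_PiE nat_add_distrib nat_mult_distrib)

lemma bounded_vectorsI:
  assumes "x \<in> int_vectors k" "\<And>i. i < k \<Longrightarrow> \<bar>x i\<bar> \<le> int R"
  shows "x \<in> bounded_vectors k R"
proof -
  have "- int R \<le> x i \<and> x i \<le> int R" if "i < k" for i using assms(2)[OF that] by linarith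
  then show ?thesis using assms(1) unfolding bounded_vectors_def int_vectors_def by (simp add: PiE_iff)
qed

lemma int_max_abs_ge:
  assumes "i < k"
  shows "\<bar>x i\<bar> \<le> int (int_max_abs k x)"
proof -
  have "nat \<bar>x i\<bar> \<le> int_max_abs k x" unfolding int_max_abs_def using assms by (intro Max_ge) auto
  then show ?thesis by linarith
qed

text \<open>The level is recorded together with the class because the cost is a function of
  it.\<close>

definition cells :: "nat \<Rightarrow> (nat \<Rightarrow> int) \<times> (nat \<Rightarrow> int) \<Rightarrow> (nat \<times> (nat \<times> nat \<Rightarrow> int)) set" where
  "cells l qb = (\<lambda>y. (l, y)) ` {y \<in> Box l. strip l (fst qb) (snd qb) y}"

definition unit_vectors :: "nat \<Rightarrow> ((nat \<Rightarrow> int) \<times> (nat \<Rightarrow> int)) set" where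
  "unit_vectors R = {(q, b). q \<in> bounded_vectors m R \<and> b \<in> bounded_vectors n R \<and> (\<exists>i<m. \<not> int p dvd q i)}"

text \<open>The index \<open>k\<close> is the exponent of the power of \<open>p\<close> that has been divided out of a pair.\<close>

definition cover_block :: "nat \<Rightarrow> (nat \<times> (nat \<times> nat \<Rightarrow> int)) set" where
  "cover_block t = (\<Union>k\<in>{k. k < lv (\<psi> (16 ^ t)) \<and> p ^ k \<le> 16 ^ Suc t}.
     \<Union>qb\<in>unit_vectors (16 ^ Suc t div p ^ k). cells (lv (\<psi> (16 ^ t)) - k) qb)"

text \<open>Covering balls are open: a class of level \<open>l\<close> is the ball of radius
  \<open>p ^ -(l - 1)\<close>, not \<open>p ^ -l\<close>, which shifts the argument of
  \<open>\<phi>\<close> by 1.\<close>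

definition cost :: "nat \<times> (nat \<times> nat \<Rightarrow> int) \<Rightarrow> real" where "cost c = \<phi> (fst c - 1)"

lemma cost_nonneg: "0 \<le> cost c" unfolding cost_def by simp

lemma finite_cells [simp]: "finite (cells l qb)"
  unfolding cells_def by simp

lemma unit_vectors_subset: "unit_vectors R \<subseteq> bounded_vectors m R \<times> bounded_vectors n R"
  unfolding unit_vectors_def by auto

lemma finite_unit_vectors [simp]: "finite (unit_vectors R)"
  by (rule finite_subset[OF unit_vectors_subset]) simp

lemma finite_cover_block [simp]: "finite (cover_block t)"
  unfolding cover_block_def by (intro finite_UN_I) auto

lemma card_unit_vectors: "card (unit_vectors R) \<le> (2 * R + 1) ^ (m + n)"
  using card_mono[OF _ unit_vectors_subset, of R] by (simp add: card_cartesian_product card_bounded_vectors power_add)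

lemma \<phi>_pred: "\<phi> (l - 1) \<le> pp (m * n) * \<phi> l"
proof (cases l)
  case 0
  have "1 * \<phi> 0 \<le> pp (m * n) * \<phi> 0" by (intro mult_right_mono pp_ge1) simp
  then show ?thesis using 0 by simp
next
  case (Suc k)
  have "\<phi> k * pp (k * (m * n)) \<le> \<phi> (Suc k) * pp (Suc k * (m * n))" by (rule \<phi>_density_mono) simp
  also have "\<dots> = (pp (m * n) * \<phi> (Suc k)) * pp (k * (m * n))" unfolding mult_Suc power_add by simp
  finally have "\<phi> k \<le> pp (m * n) * \<phi> (Suc k)" by (rule mult_right_le_imp_le) simp
  then show ?thesis using Suc by simp
qed

lemma cells_cost:
  assumes "qb \<in> unit_vectors R"
  shows "sum cost (cells l qb) \<le> pp (m * n) * g ((1 / real p) ^ l)"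
proof -
  obtain q b where qb: "qb = (q, b)" by fastforce
  obtain i where i: "i < m" "\<not> int p dvd q i" using assms unfolding qb unit_vectors_def by blast
  have "sum cost (cells l qb) = real (card {y \<in> Box l. strip l q b y}) * \<phi> (l - 1)"
    unfolding cells_def qb by (subst sum.reindex) (auto simp: inj_on_def cost_def)
  also have "\<dots> \<le> pp (l * ((m - 1) * n)) * (pp (m * n) * \<phi> l)"
  proof (intro mult_mono \<phi>_pred)
    show "real (card {y \<in> Box l. strip l q b y}) \<le> pp (l * ((m - 1) * n))"
      using strip_zero_count[where q = q and i = i and b = b and l = l, OF i] by (simp only: of_nat_le_iff flip: of_nat_power)
  qed simp_all
  also have "\<dots> = pp (m * n) * g ((1 / real p) ^ l)" unfolding g_inv_pow by (simp only: mult_ac)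
  finally show ?thesis .
qed

text \<open>The 2 bounds the geometric series over \<open>k\<close>, \<open>pp (m * n)\<close> pays
  for the radius \<open>p ^ -(l - 1)\<close> in place of \<open>p ^ -l\<close>, and
  \<open>48 = 3 * 16\<close> comes from bounding \<open>2 * x + 1\<close> by \<open>3 * y\<close>,
  where \<open>y = 16 ^ (t + 1) / p ^ k\<close> and \<open>x\<close> is its integer part.\<close>

definition cover_const :: real where "cover_const = 2 * pp (m * n) * 48 ^ (m + n)"

lemma cover_const_pos: "0 < cover_const" unfolding cover_const_def by simp

lemma sum_inverse_powers_le: "(\<Sum>k\<in>K. (1 / real p) ^ k) \<le> 2" if "finite K"
proof -
  have "(1 / real p) ^ k \<le> (1 / 2) ^ k" for k
    using prime_ge_2_nat[OF prime] by (intro power_mono) (auto simp: field_simps)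
  then have "(\<Sum>k\<in>K. (1 / real p) ^ k) \<le> (\<Sum>k\<in>K. (1 / 2) ^ k)" by (intro sum_mono)
  also have "\<dots> \<le> (\<Sum>k. (1 / 2 :: real) ^ k)" using that by (intro sum_le_suminf) (auto intro: summable_geometric)
  also have "\<dots> = 2" by (subst suminf_geometric) auto
  finally show ?thesis .
qed

text \<open>Dividing \<open>p ^ k\<close> out of the pairs lowers the bound for their number by the
  factor \<open>p ^ (k * (m + n))\<close>, while the strips become wider by \<open>p ^ k\<close>,
  which raises \<open>g\<close> at most by \<open>p ^ (k * n)\<close>. The net gain
  \<open>p ^ (k * m)\<close> leaves a convergent geometric series in \<open>k\<close>.\<close>

lemma cover_block_cost: "sum cost (cover_block t) \<le> cover_const * condensed t"
proof -
  let ?\<sigma> = "lv (\<psi> (16 ^ t))" and ?R = "16 ^ Suc t :: nat"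
  let ?K = "{k. k < ?\<sigma> \<and> p ^ k \<le> ?R}"
  have g0: "0 < g (\<psi> (16 ^ t))" by (intro g_pos \<psi>_pos) simp
  have one: "sum cost (\<Union>qb\<in>unit_vectors (?R div p ^ k). cells (?\<sigma> - k) qb)
      \<le> pp (m * n) * 48 ^ (m + n) * condensed t * (1 / real p) ^ k" if k: "k \<in> ?K" for k
  proof -
    have "sum cost (\<Union>qb\<in>unit_vectors (?R div p ^ k). cells (?\<sigma> - k) qb) \<le>
        (\<Sum>qb\<in>unit_vectors (?R div p ^ k). sum cost (cells (?\<sigma> - k) qb))"
      by (rule sum_UNION_le) (simp_all add: cost_nonneg)
    also have "\<dots> \<le> (\<Sum>qb\<in>unit_vectors (?R div p ^ k). pp (m * n) * (pp (k * n) * g (\<psi> (16 ^ t))))"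
    proof (rule sum_mono)
      fix qb assume qb: "qb \<in> unit_vectors (?R div p ^ k)"
      have "(1 / real p) ^ (?\<sigma> - k) = pp k * (1 / real p) ^ ?\<sigma>"
      proof -
        have "(1 / real p) ^ ?\<sigma> = (1 / real p) ^ (?\<sigma> - k) * (1 / real p) ^ k"
          using k by (simp flip: power_add)
        then show ?thesis using P0 by (simp add: power_one_over)
      qed
      then have "g ((1 / real p) ^ (?\<sigma> - k)) \<le> pp k ^ n * g ((1 / real p) ^ ?\<sigma>)"
        using g_scale[OF inv_pow_pos pp_ge1, of k ?\<sigma>] by simp
      also have "\<dots> \<le> pp k ^ n * g (\<psi> (16 ^ t))"
        using lv_less[OF \<psi>_pos[of "16 ^ t"]] by (intro mult_left_mono g_le) auto
      finally have "pp (m * n) * g ((1 / real p) ^ (?\<sigma> - k)) \<le> pp (m * n) * (pp (k * n) * g (\<psi> (16 ^ t)))"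
        unfolding power_mult by (intro mult_left_mono) auto
      then show "sum cost (cells (?\<sigma> - k) qb) \<le> pp (m * n) * (pp (k * n) * g (\<psi> (16 ^ t)))"
        using cells_cost[OF qb, of "?\<sigma> - k"] by linarith
    qed
    also have "\<dots> = real (card (unit_vectors (?R div p ^ k))) * (pp (m * n) * (pp (k * n) * g (\<psi> (16 ^ t))))" by simp
    also have "\<dots> \<le> (3 * (real ?R / pp k)) ^ (m + n) * (pp (m * n) * (pp (k * n) * g (\<psi> (16 ^ t))))"
    proof (rule mult_right_mono)
      have "real (?R div p ^ k) \<le> real ?R / real (p ^ k)" by (rule of_nat_div_le_of_nat)
      moreover have "1 \<le> real ?R / real (p ^ k)"
      proof -
        have "real (p ^ k) \<le> real ?R" using k by (simp only: of_nat_le_iff mem_Collect_eq)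
        then show ?thesis using p0 by (simp add: le_divide_eq)
      qed
      ultimately have "2 * real (?R div p ^ k) + 1 \<le> 3 * (real ?R / real (p ^ k))" by linarith
      then have "real (2 * (?R div p ^ k) + 1) \<le> 3 * (real ?R / pp k)"
        by (simp only: of_nat_add of_nat_mult of_nat_numeral of_nat_1 of_nat_power)
      then have "real (2 * (?R div p ^ k) + 1) ^ (m + n) \<le> (3 * (real ?R / pp k)) ^ (m + n)" by (intro power_mono) auto
      moreover have "real (card (unit_vectors (?R div p ^ k))) \<le> real (2 * (?R div p ^ k) + 1) ^ (m + n)"
        using card_unit_vectors[of "?R div p ^ k"] by (simp only: of_nat_le_iff flip: of_nat_power)
      ultimately show "real (card (unit_vectors (?R div p ^ k))) \<le> (3 * (real ?R / pp k)) ^ (m + n)" by linarith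
    qed (use g0 in simp)
    also have "\<dots> = pp (m * n) * 48 ^ (m + n) * condensed t * (1 / pp (k * m))"
    proof -
      have "3 * (real ?R / pp k) = 48 * 16 ^ t / pp k" by simp
      then have "(3 * (real ?R / pp k)) ^ (m + n) = 48 ^ (m + n) * 16 ^ (t * (m + n)) / (pp (k * m) * pp (k * n))"
        by (simp only: power_divide power_mult_distrib power_mult power_add times_divide_times_eq mult_ac)
      then show ?thesis unfolding condensed_def using p0 m0 by simp
    qed
    also have "\<dots> \<le> pp (m * n) * 48 ^ (m + n) * condensed t * (1 / real p) ^ k"
    proof (rule mult_left_mono)
      have "pp k \<le> pp (k * m)" using P1 m0 by (intro power_increasing) auto
      then show "1 / pp (k * m) \<le> (1 / real p) ^ k" unfolding inv_pow by (intro divide_left_mono) auto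
    qed (use condensed_nonneg in simp)
    finally show ?thesis .
  qed
  have "sum cost (cover_block t) \<le> (\<Sum>k\<in>?K. sum cost (\<Union>qb\<in>unit_vectors (?R div p ^ k). cells (?\<sigma> - k) qb))"
    unfolding cover_block_def by (rule sum_UNION_le) (simp_all add: cost_nonneg)
  also have "\<dots> \<le> (\<Sum>k\<in>?K. pp (m * n) * 48 ^ (m + n) * condensed t * (1 / real p) ^ k)"
    by (rule sum_mono) (rule one)
  also have "\<dots> = pp (m * n) * 48 ^ (m + n) * condensed t * (\<Sum>k\<in>?K. (1 / real p) ^ k)"
    by (simp only: sum_distrib_left)
  also have "\<dots> \<le> pp (m * n) * 48 ^ (m + n) * condensed t * 2"
    using condensed_nonneg by (intro mult_left_mono sum_inverse_powers_le) auto
  finally show ?thesis unfolding cover_const_def by (simp add: mult_ac)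
qed

end

lemma ennreal_infsum_le:
  fixes h :: "'a \<Rightarrow> ennreal"
  assumes "\<And>F. finite F \<Longrightarrow> F \<subseteq> A \<Longrightarrow> sum h F \<le> B"
  shows "infsum h A \<le> B"
  by (subst nonneg_infsum_complete) (use assms in \<open>auto intro!: SUP_least\<close>)

context padic_grid
begin

definition lift :: "(nat \<times> nat \<Rightarrow> int) \<Rightarrow> nat \<times> nat \<Rightarrow> nat \<Rightarrow> int" where
  "lift y = (\<lambda>ij\<in>idx. padic_of_int p (y ij))"

lemma lift_Mat: "lift y \<in> Mat"
  unfolding padic_matrices_def idx_def[symmetric] lift_def
  by (intro restrict_PiE_iff[THEN iffD2] ballI padic_of_int_carrier)

lemma trunc_lift:
  assumes "y \<in> Box l"
  shows "trunc l (lift y) = y"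
proof (rule ext)
  fix ij show "trunc l (lift y) ij = y ij"
    unfolding trunc_def lift_def padic_of_int_def
    using Box_mod[OF assms] Box_arb[OF assms] by (cases "ij \<in> idx") simp_all
qed

lemma strip_scaled:
  assumes "strip (k + l) (\<lambda>i. int p ^ k * q i) (\<lambda>j. int p ^ k * b j) x"
  shows "strip l q b x"
  unfolding strip_def
proof (intro allI impI)
  fix j assume "j < n"
  then have "int p ^ (k + l) dvd (\<Sum>i<m. int p ^ k * q i * x (i, j)) + int p ^ k * b j"
    using assms unfolding strip_def by blast
  also have "(\<Sum>i<m. int p ^ k * q i * x (i, j)) + int p ^ k * b j = int p ^ k * ((\<Sum>i<m. q i * x (i, j)) + b j)"
    by (simp add: distrib_left sum_distrib_left mult.assoc)
  finally show "int p ^ l dvd (\<Sum>i<m. q i * x (i, j)) + b j"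
    using p0 by (simp add: power_add)
qed

lemma strip_ext:
  assumes "\<And>i. i < m \<Longrightarrow> q i = q' i" "\<And>j. j < n \<Longrightarrow> b j = b' j"
  shows "strip l q b x \<longleftrightarrow> strip l q' b' x"
  unfolding strip_def using assms by (metis (no_types, lifting) lessThan_iff sum.cong)

lemma obtain_unit_part:
  assumes "i < m" "\<not> int p ^ \<sigma> dvd q i"
  obtains k where "k < \<sigma>" "\<And>i. i < m \<Longrightarrow> int p ^ k dvd q i" "\<exists>i<m. \<not> int p ^ Suc k dvd q i"
proof -
  let ?P = "\<lambda>j. \<exists>i<m. \<not> int p ^ j dvd q i"
  have P: "?P \<sigma>" using assms by blast
  have "?P (LEAST j. ?P j)" using P by (rule LeastI)
  then obtain k where k: "(LEAST j. ?P j) = Suc k" by (cases "LEAST j. ?P j") auto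
  have "\<not> ?P k" using not_less_Least[of k ?P] k by simp
  moreover have "?P (Suc k)" using LeastI[of ?P, OF P] unfolding k .
  moreover have "Suc k \<le> \<sigma>" using Least_le[of ?P, OF P] unfolding k .
  ultimately show thesis using that[of k] by auto
qed

end

section \<open>Approximable matrices lie in the tails of the covers\<close>

context jarnik
begin

text \<open>Since \<open>f r / r ^ (m * n)\<close> decreases, \<open>g x \<ge> f 1 * x ^ n\<close>
  for \<open>x \<le> 1\<close>, so the terms of a convergent condensed series force
  \<open>16 ^ t * \<psi> (16 ^ t)\<close> to 0. The minimum with 1 is taken because smallness of
  \<open>\<psi>\<close> is not known beforehand.\<close>

lemma \<psi>_power_tendsto_0:
  assumes "summable condensed"
  shows "(\<lambda>t. real (16 ^ Suc t) * \<psi> (16 ^ t)) \<longlonglongrightarrow> 0"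
proof -
  let ?z = "\<lambda>t. 16 ^ t * min 1 (\<psi> (16 ^ t))"
  have \<psi>t: "0 < \<psi> (16 ^ t)" for t by (rule \<psi>_pos) simp
  have v0: "condensed \<longlonglongrightarrow> 0" using assms by (rule summable_LIMSEQ_zero)
  have f1: "0 < f 1" by (rule f_pos) simp
  have g_ge: "f 1 * min 1 x ^ n \<le> g x" if x: "0 < x" for x
  proof (cases "x \<le> 1")
    case True
    have "f 1 / 1 ^ (m * n) \<le> f x / x ^ (m * n)" by (rule f_div_le[OF x True])
    then have "f 1 \<le> g x / x ^ n"
      unfolding mn_split power_add g_def by (simp add: divide_divide_eq_left)
    then have "f 1 * x ^ n \<le> g x" using x by (simp add: pos_le_divide_eq)
    then show ?thesis using True by simp
  next
    case False
    then have "g 1 \<le> g x" by (intro g_le) auto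
    then show ?thesis using False unfolding g_def by simp
  qed
  have "f 1 * ?z t ^ n \<le> condensed t" for t
  proof -
    have "f 1 * ?z t ^ n = 16 ^ (t * n) * (f 1 * min 1 (\<psi> (16 ^ t)) ^ n)"
      by (simp add: power_mult_distrib power_mult)
    also have "\<dots> \<le> 16 ^ (t * (m + n)) * g (\<psi> (16 ^ t))"
      using f1 \<psi>t[of t] by (intro mult_mono g_ge power_increasing) auto
    finally show ?thesis unfolding condensed_def .
  qed
  then have "norm (?z t ^ n) \<le> condensed t / f 1" for t
    using f1 \<psi>t[of t] by (simp add: pos_le_divide_eq mult.commute)
  then have "eventually (\<lambda>t. norm (?z t ^ n) \<le> condensed t / f 1) sequentially"
    by (intro always_eventually allI)
  moreover have "(\<lambda>t. condensed t / f 1) \<longlonglongrightarrow> 0" using tendsto_divide[OF v0 tendsto_const, of "f 1"] f1 by simp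
  ultimately have zn: "(\<lambda>t. ?z t ^ n) \<longlonglongrightarrow> 0" by (rule Lim_null_comparison)
  have z_nonneg: "0 \<le> ?z t" for t using \<psi>t[of t] by simp
  have z0: "?z \<longlonglongrightarrow> 0"
  proof (rule order_tendstoI)
    fix e :: real assume "e < 0"
    then have "e < ?z t" for t using z_nonneg[of t] by linarith
    then show "eventually (\<lambda>t. e < ?z t) sequentially" by (intro always_eventually allI)
  next
    fix e :: real assume e: "0 < e"
    then have "0 < e ^ n" by simp
    with zn have "eventually (\<lambda>t. ?z t ^ n < e ^ n) sequentially" by (rule order_tendstoD(2))
    then show "eventually (\<lambda>t. ?z t < e) sequentially"
    proof eventually_elim
      case (elim t)
      show ?case by (rule power_less_imp_less_base[OF elim less_imp_le[OF e]])
    qed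
  qed
  \<comment> \<open>As \<open>16 ^ t \<ge> 1\<close>, a product below 1 means that the minimum is
    \<open>\<psi> (16 ^ t)\<close>.\<close>
  have "eventually (\<lambda>t. ?z t < 1) sequentially" using z0 by (rule order_tendstoD) simp
  then have "eventually (\<lambda>t. 16 * ?z t = real (16 ^ Suc t) * \<psi> (16 ^ t)) sequentially"
  proof eventually_elim
    case (elim t)
    have "\<psi> (16 ^ t) < 1"
    proof (rule ccontr)
      assume "\<not> \<psi> (16 ^ t) < 1"
      then have "?z t = 16 ^ t" by simp
      moreover have "(1::real) \<le> 16 ^ t" by simp
      ultimately show False using elim by linarith
    qed
    then show ?case by simp
  qed
  moreover have "(\<lambda>t. 16 * ?z t) \<longlonglongrightarrow> 0" using tendsto_mult_left[OF z0, of 16] by simp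
  ultimately show ?thesis by (rule Lim_transform_eventually[rotated])
qed

text \<open>Smallness of \<open>\<psi>\<close> gives \<open>16 ^ (t + 1) < p ^ \<sigma>\<close>, so
  an entry divisible by \<open>p ^ \<sigma>\<close> is 0. If this happened to all entries of
  \<open>q\<close>, the strip condition would make \<open>p ^ \<sigma>\<close> divide
  \<open>b\<close>, so that \<open>b\<close> would vanish too, against the positive height. Hence
  the exact power \<open>p ^ k\<close> of \<open>p\<close> in \<open>q\<close> has
  \<open>k < \<sigma>\<close>, and division by it leads to \<open>unit_vectors\<close>.\<close>

lemma approximable_in_cover_block:
  assumes X: "X \<in> Mat" and b: "b \<in> int_vectors n" and q: "q \<in> int_vectors m"
    and h: "16 ^ t \<le> max (int_max_abs n b) (int_max_abs m q)" "max (int_max_abs n b) (int_max_abs m q) < 16 ^ Suc t"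
    and small: "real (16 ^ Suc t) * \<psi> (16 ^ t) < 1"
    and app: "padic_max_abs p {..<n} (\<lambda>j. padic_vec_mat_mult p m q X j \<oplus>\<^bsub>padic_ring p\<^esub> padic_of_int p (b j))
      < \<psi> (max (int_max_abs n b) (int_max_abs m q))"
  shows "\<exists>(l, y)\<in>cover_block t. trunc l X = y"
proof -
  let ?h = "max (int_max_abs n b) (int_max_abs m q)" and ?R = "16 ^ Suc t :: nat"
  let ?\<sigma> = "lv (\<psi> (16 ^ t))"
  have \<psi>t: "0 < \<psi> (16 ^ t)" by (rule \<psi>_pos) simp
  have "(1::nat) \<le> 16 ^ t" by simp
  then have h1: "1 \<le> ?h" using h(1) by linarith
  have "\<psi> ?h \<le> \<psi> (16 ^ t)" using monotone_onD[OF \<psi>_anti, of "16 ^ t" ?h] h(1) h1 by simp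
  then have "padic_max_abs p {..<n} (\<lambda>j. padic_vec_mat_mult p m q X j \<oplus>\<^bsub>padic_ring p\<^esub> padic_of_int p (b j)) < \<psi> (16 ^ t)"
    using app by linarith
  then have "padic_max_abs p {..<n} (\<lambda>j. padic_vec_mat_mult p m q X j \<oplus>\<^bsub>padic_ring p\<^esub> padic_of_int p (b j)) \<le> (1 / real p) ^ ?\<sigma>"
    using below_lv[OF \<psi>t max_abs_cases[of "{..<n}"]] n0 by blast
  then have st: "strip ?\<sigma> q b (trunc ?\<sigma> X)" unfolding vec_mat_le_iff[OF X] .
  have R\<sigma>: "int ?R < int p ^ ?\<sigma>"
  proof -
    have "real ?R * (1 / pp ?\<sigma>) \<le> real ?R * \<psi> (16 ^ t)"
      using lv_less[OF \<psi>t] unfolding inv_pow by (intro mult_left_mono) auto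
    then have "real ?R * (1 / pp ?\<sigma>) < 1" using small by linarith
    then have "real ?R < pp ?\<sigma>" by (simp add: divide_less_eq)
    then have "?R < p ^ ?\<sigma>" by (simp only: of_nat_less_iff flip: of_nat_power)
    then show ?thesis by (simp only: of_nat_less_iff flip: of_nat_power)
  qed
  have qR: "\<bar>q i\<bar> < int ?R" if "i < m" for i using int_max_abs_ge[OF that, of q] h(2) by linarith
  have bR: "\<bar>b j\<bar> < int ?R" if "j < n" for j using int_max_abs_ge[OF that, of b] h(2) by linarith
  have zero: "x = 0" if "int p ^ ?\<sigma> dvd x" "\<bar>x\<bar> < int ?R" for x
    using dvd_imp_le_int[OF _ that(1)] that(2) R\<sigma> by fastforce
  have "\<exists>i<m. \<not> int p ^ ?\<sigma> dvd q i"
  proof (rule ccontr)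
    assume "\<not> ?thesis"
    then have q0: "q i = 0" if "i < m" for i using zero qR that by blast
    have b0: "b j = 0" if j: "j < n" for j
    proof -
      have "int p ^ ?\<sigma> dvd (\<Sum>i<m. q i * trunc ?\<sigma> X (i, j)) + b j" using st j unfolding strip_def by blast
      then have "int p ^ ?\<sigma> dvd b j" using q0 by simp
      then show ?thesis using zero bR[OF j] by blast
    qed
    have "int_max_abs m q \<le> 0" unfolding int_max_abs_def using q0 m0 by (subst Max_le_iff) auto
    moreover have "int_max_abs n b \<le> 0" unfolding int_max_abs_def using b0 n0 by (subst Max_le_iff) auto
    ultimately show False using h1 by simp
  qed
  then obtain i0 where "i0 < m" "\<not> int p ^ ?\<sigma> dvd q i0" by blast
  then obtain k where k: "k < ?\<sigma>" "\<And>i. i < m \<Longrightarrow> int p ^ k dvd q i" "\<exists>i<m. \<not> int p ^ Suc k dvd q i"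
    by (rule obtain_unit_part) blast
  have kb: "int p ^ k dvd b j" if j: "j < n" for j
  proof -
    have "strip k q b (trunc ?\<sigma> X)" using strip_antimono[OF st] k(1) by simp
    then have "int p ^ k dvd (\<Sum>i<m. q i * trunc ?\<sigma> X (i, j)) + b j" using j unfolding strip_def by blast
    moreover have "int p ^ k dvd (\<Sum>i<m. q i * trunc ?\<sigma> X (i, j))" using k(2) by (intro dvd_sum dvd_mult2) auto
    ultimately show ?thesis by (simp add: dvd_add_right_iff)
  qed
  define q' where "q' = (\<lambda>i\<in>{..<m}. q i div int p ^ k)"
  define b' where "b' = (\<lambda>j\<in>{..<n}. b j div int p ^ k)"
  have q': "q i = int p ^ k * q' i" if "i < m" for i using k(2)[OF that] that unfolding q'_def by simp
  have b': "b j = int p ^ k * b' j" if "j < n" for j using kb[OF that] that unfolding b'_def by simp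
  have pk: "0 < int p ^ k" using p0 by simp
  have bound: "\<bar>x\<bar> \<le> int (?R div p ^ k)" if "\<bar>int p ^ k * x\<bar> < int ?R" for x
  proof -
    have "int p ^ k * \<bar>x\<bar> \<le> int ?R" using that pk by (simp add: abs_mult)
    then have "int p ^ k * \<bar>x\<bar> div int p ^ k \<le> int ?R div int p ^ k" using pk by (intro zdiv_mono1) auto
    then have "\<bar>x\<bar> \<le> int ?R div int p ^ k" using pk by simp
    then show ?thesis by (simp only: of_nat_power zdiv_int)
  qed
  obtain i1 where i1: "i1 < m" "\<not> int p ^ Suc k dvd q i1" using k(3) by blast
  have unit: "\<not> int p dvd q' i1" using i1(2) unfolding q'[OF i1(1)] power_Suc by (simp add: mult.commute)
  have "q' \<in> bounded_vectors m (?R div p ^ k)"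
  proof (rule bounded_vectorsI)
    show "q' \<in> int_vectors m" unfolding q'_def int_vectors_def by simp
    show "\<bar>q' i\<bar> \<le> int (?R div p ^ k)" if "i < m" for i using bound qR[OF that] unfolding q'[OF that] by blast
  qed
  moreover have "b' \<in> bounded_vectors n (?R div p ^ k)"
  proof (rule bounded_vectorsI)
    show "b' \<in> int_vectors n" unfolding b'_def int_vectors_def by simp
    show "\<bar>b' j\<bar> \<le> int (?R div p ^ k)" if "j < n" for j using bound bR[OF that] unfolding b'[OF that] by blast
  qed
  ultimately have U: "(q', b') \<in> unit_vectors (?R div p ^ k)"
    unfolding unit_vectors_def using unit i1(1) by blast
  have pkR: "p ^ k \<le> ?R"
  proof -
    have "q i1 \<noteq> 0" using i1(2) by auto
    then have "\<bar>int p ^ k\<bar> \<le> \<bar>q i1\<bar>" using dvd_imp_le_int[OF _ k(2)[OF i1(1)]] by blast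
    then have "int p ^ k < int ?R" using qR[OF i1(1)] pk by linarith
    then have "p ^ k < ?R" by (simp only: of_nat_less_iff flip: of_nat_power)
    then show ?thesis by simp
  qed
  let ?l = "?\<sigma> - k"
  have "strip (k + ?l) (\<lambda>i. int p ^ k * q' i) (\<lambda>j. int p ^ k * b' j) (trunc ?\<sigma> X)"
    using st strip_ext[of q "\<lambda>i. int p ^ k * q' i" b "\<lambda>j. int p ^ k * b' j"] q' b' k(1) by simp
  then have "strip ?l q' b' (trunc ?\<sigma> X)" by (rule strip_scaled)
  then have "strip ?l q' b' (trunc ?l X)"
    using strip_red[OF order_refl, of ?l q' b' "trunc ?\<sigma> X"] red_trunc[OF X, of ?l ?\<sigma>] by simp
  then have "(?l, trunc ?l X) \<in> cells ?l (q', b')" unfolding cells_def using X by simp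
  then have "(?l, trunc ?l X) \<in> cover_block t"
    unfolding cover_block_def using U pkR k(1) by blast
  then show ?thesis by blast
qed

lemma lv_inv_pow:
  assumes "1 \<le> l"
  shows "lv ((1 / real p) ^ (l - 1)) = l"
proof (rule antisym)
  have "(1 / real p) ^ l < (1 / real p) ^ (l - 1)"
    using assms P1 by (intro power_strict_decreasing) auto
  then show "lv ((1 / real p) ^ (l - 1)) \<le> l" by (rule lv_le)
  show "l \<le> lv ((1 / real p) ^ (l - 1))"
  proof (rule ccontr)
    assume "\<not> ?thesis"
    then have "(1 / real p) ^ (l - 1) \<le> (1 / real p) ^ lv ((1 / real p) ^ (l - 1))"
      using P1 by (intro power_decreasing) auto
    then show False using lv_less[OF inv_pow_pos, of "l - 1"] by linarith
  qed
qed

text \<open>Turns a countable set of cells into a cover of the kind the premeasure asks for, indexed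
  by natural numbers and with integer matrices as centres.\<close>

lemma premeasure_le_cells:
  assumes ct: "countable \<C>" and \<C>: "\<And>l y. (l, y) \<in> \<C> \<Longrightarrow> 1 \<le> l \<and> y \<in> Box l \<and> (1 / real p) ^ (l - 1) \<le> \<rho>"
    and F: "F \<subseteq> Mat" "\<And>X. X \<in> F \<Longrightarrow> \<exists>(l, y)\<in>\<C>. trunc l X = y"
  shows "hausdorff_premeasure Mmet f \<rho> F \<le> (\<Sum>\<^sub>\<infinity>c\<in>\<C>. ennreal (cost c))"
proof -
  let ?I = "to_nat_on \<C> ` \<C>"
  define c where "c = (\<lambda>i. lift (snd (from_nat_into \<C> i)))"
  define r where "r = (\<lambda>i. (1 / real p) ^ (fst (from_nat_into \<C> i) - 1))"
  have inv: "from_nat_into \<C> (to_nat_on \<C> x) = x" if "x \<in> \<C>" for x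
    using ct that by (rule from_nat_into_to_nat_on)
  have "(\<Sum>\<^sub>\<infinity>i\<in>?I. ennreal (f (r i))) = (\<Sum>\<^sub>\<infinity>x\<in>\<C>. ennreal (f (r (to_nat_on \<C> x))))"
    using infsum_reindex[OF inj_on_to_nat_on[OF ct], of "\<lambda>i. ennreal (f (r i))"] by (simp add: o_def)
  also have "\<dots> = (\<Sum>\<^sub>\<infinity>x\<in>\<C>. ennreal (cost x))"
    by (rule infsum_cong) (simp add: r_def inv cost_def \<phi>_def)
  finally have eq: "(\<Sum>\<^sub>\<infinity>x\<in>\<C>. ennreal (cost x)) = (\<Sum>\<^sub>\<infinity>i\<in>?I. ennreal (f (r i)))" ..
  show ?thesis
    unfolding hausdorff_premeasure_def eq
  proof (rule Inf_lower, intro CollectI exI conjI ballI)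
    show "(\<Sum>\<^sub>\<infinity>i\<in>?I. ennreal (f (r i))) = (\<Sum>\<^sub>\<infinity>i\<in>?I. ennreal (f (r i)))" ..
    fix i assume "i \<in> ?I"
    then obtain l y where ly: "(l, y) \<in> \<C>" "i = to_nat_on \<C> (l, y)" by auto
    show "c i \<in> mspace Mmet" unfolding mspace_padic_matrix_metric[OF prime m0 n0] c_def by (rule lift_Mat)
    show "0 < r i" unfolding r_def by simp
    show "r i \<le> \<rho>" unfolding r_def ly(2) inv[OF ly(1)] using \<C>[OF ly(1)] by simp
  next
    show "F \<subseteq> (\<Union>i\<in>?I. mball_of Mmet (c i) (r i))"
    proof
      fix X assume X: "X \<in> F"
      then obtain l y where ly: "(l, y) \<in> \<C>" "trunc l X = y" using F(2)[OF X] by blast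
      let ?i = "to_nat_on \<C> (l, y)"
      have l: "1 \<le> l" "y \<in> Box l" using \<C>[OF ly(1)] by blast+
      have ci: "c ?i = lift y" "r ?i = (1 / real p) ^ (l - 1)" unfolding c_def r_def inv[OF ly(1)] by simp_all
      have "X \<in> mball_of Mmet (c ?i) (r ?i)"
        unfolding ci mball_trunc[OF lift_Mat inv_pow_pos] lv_inv_pow[OF l(1)] trunc_lift[OF l(2)]
        using X F(1) ly(2) by blast
      then show "X \<in> (\<Union>i\<in>?I. mball_of Mmet (c i) (r i))" using ly(1) by blast
    qed
  qed
qed

lemma finite_bounded_pairs:
  "finite {(b, q). b \<in> int_vectors n \<and> q \<in> int_vectors m \<and> max (int_max_abs n b) (int_max_abs m q) < R}"
proof (rule finite_subset)
  show "{(b, q). b \<in> int_vectors n \<and> q \<in> int_vectors m \<and> max (int_max_abs n b) (int_max_abs m q) < R}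
      \<subseteq> bounded_vectors n R \<times> bounded_vectors m R"
  proof clarify
    fix b q assume b: "b \<in> int_vectors n" and q: "q \<in> int_vectors m" and h: "max (int_max_abs n b) (int_max_abs m q) < R"
    have "\<bar>b j\<bar> \<le> int R" if "j < n" for j using int_max_abs_ge[OF that, of b] h by linarith
    moreover have "\<bar>q i\<bar> \<le> int R" if "i < m" for i using int_max_abs_ge[OF that, of q] h by linarith
    ultimately show "b \<in> bounded_vectors n R \<and> q \<in> bounded_vectors m R" using b q by (simp add: bounded_vectorsI)
  qed
qed simp

text \<open>The cells of all blocks from \<open>t0\<close> on cover the set, since infinitely many
  pairs have unbounded height, and their cost is bounded by a tail of a convergent series.\<close>

lemma premeasure_zero:
  assumes sm: "summable condensed" and \<rho>: "0 < \<rho>"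
  shows "hausdorff_premeasure Mmet f \<rho> (padic_approximable p m n \<psi>) = 0"
proof -
  let ?W = "padic_approximable p m n \<psi>"
  have le: "hausdorff_premeasure Mmet f \<rho> ?W \<le> ennreal e" if e: "0 < e" for e
  proof -
    have "0 < e / cover_const" using e cover_const_pos by simp
    then obtain T where T: "\<And>t. T \<le> t \<Longrightarrow> norm (\<Sum>i. condensed (i + t)) < e / cover_const"
      using suminf_exist_split[OF _ sm, of "e / cover_const"] by blast
    \<comment> \<open>The bound 1 serves \<open>approximable_in_cover_block\<close>. The bound
      \<open>\<rho> / p\<close> keeps the radii at most \<open>\<rho>\<close>, because
      \<open>p ^ -(l - 1) = p * p ^ k * p ^ -\<sigma>\<close> is at most
      \<open>p * 16 ^ (t + 1) * \<psi> (16 ^ t)\<close>.\<close>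
    have "eventually (\<lambda>t. real (16 ^ Suc t) * \<psi> (16 ^ t) < min 1 (\<rho> / real p)) sequentially"
      using \<psi>_power_tendsto_0[OF sm] \<rho> P0 by (intro order_tendstoD(2)) auto
    then obtain T' where T': "\<And>t. T' \<le> t \<Longrightarrow> real (16 ^ Suc t) * \<psi> (16 ^ t) < min 1 (\<rho> / real p)"
      unfolding eventually_sequentially by blast
    define t0 where "t0 = max T T'"
    define \<C> where "\<C> = (\<Union>t\<in>{t0..}. cover_block t)"
    have "hausdorff_premeasure Mmet f \<rho> ?W \<le> (\<Sum>\<^sub>\<infinity>c\<in>\<C>. ennreal (cost c))"
    proof (rule premeasure_le_cells)
      show "countable \<C>" unfolding \<C>_def by (intro countable_UN) (auto intro: countable_finite)
      show "?W \<subseteq> Mat" unfolding padic_approximable_def by blast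
      show "1 \<le> l \<and> y \<in> Box l \<and> (1 / real p) ^ (l - 1) \<le> \<rho>" if lyC: "(l, y) \<in> \<C>" for l y
      proof -
        obtain t k qb where t: "t0 \<le> t" and k: "k < lv (\<psi> (16 ^ t))" "p ^ k \<le> 16 ^ Suc t"
          and ly: "(l, y) \<in> cells (lv (\<psi> (16 ^ t)) - k) qb"
          using lyC unfolding \<C>_def cover_block_def by blast
        let ?\<sigma> = "lv (\<psi> (16 ^ t))"
        have l: "l = ?\<sigma> - k" "y \<in> Box l" using ly unfolding cells_def by auto
        have \<psi>t: "0 < \<psi> (16 ^ t)" by (rule \<psi>_pos) simp
        have "(1 / real p) ^ (l - 1) = real p * pp k * (1 / real p) ^ ?\<sigma>"
        proof -
          have "?\<sigma> = (l - 1) + (k + 1)" using k(1) l(1) by simp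
          then have "(1 / real p) ^ ?\<sigma> = (1 / real p) ^ (l - 1) * ((1 / real p) ^ k * (1 / real p))"
            by (simp only: power_add power_one_right)
          then show ?thesis using P0 by (simp add: power_one_over p0[THEN gr_implies_not0])
        qed
        also have "\<dots> \<le> real p * real (16 ^ Suc t) * \<psi> (16 ^ t)"
        proof (intro mult_mono)
          show "pp k \<le> real (16 ^ Suc t)" using k(2) by (simp only: of_nat_le_iff flip: of_nat_power)
          show "(1 / real p) ^ ?\<sigma> \<le> \<psi> (16 ^ t)" using lv_less[OF \<psi>t] by simp
        qed (use \<psi>t in simp_all)
        also have "\<dots> \<le> real p * (\<rho> / real p)"
          unfolding mult.assoc using T'[of t] t unfolding t0_def by (intro mult_left_mono) auto
        also have "\<dots> = \<rho>" using P0 by simp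
        finally show ?thesis using l k(1) by simp
      qed
      show "\<exists>(l, y)\<in>\<C>. trunc l X = y" if X: "X \<in> ?W" for X
      proof -
        let ?S = "{(a, q). a \<in> int_vectors n \<and> q \<in> int_vectors m \<and>
          padic_max_abs p {..<n}
            (\<lambda>j. padic_vec_mat_mult p m q X j \<oplus>\<^bsub>padic_ring p\<^esub> padic_of_int p (a j))
          < \<psi> (max (int_max_abs n a) (int_max_abs m q))}"
        have XM: "X \<in> Mat" and inf: "infinite ?S" using X unfolding padic_approximable_def by blast+
        obtain b q where bq: "(b, q) \<in> ?S" "16 ^ t0 \<le> max (int_max_abs n b) (int_max_abs m q)"
        proof (rule ccontr)
          assume "\<not> thesis"
          then have "?S \<subseteq> {(b, q). b \<in> int_vectors n \<and> q \<in> int_vectors m \<and> max (int_max_abs n b) (int_max_abs m q) < 16 ^ t0}"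
            using that not_le by blast
          then show False using inf finite_subset[OF _ finite_bounded_pairs] by blast
        qed
        let ?h = "max (int_max_abs n b) (int_max_abs m q)"
        have "(1::nat) \<le> 16 ^ t0" by simp
        then have "1 \<le> ?h" using bq(2) by linarith
        then obtain t where t: "16 ^ t \<le> ?h" "?h < 16 ^ (t + 1)" using ex_power_ivl1[of 16 ?h] by auto
        have "t0 < t + 1"
        proof (rule power_less_imp_less_exp[of "16::nat"])
          show "(16::nat) ^ t0 < 16 ^ (t + 1)" using bq(2) t(2) by linarith
        qed simp
        then have t0: "t0 \<le> t" by simp
        have "\<exists>(l, y)\<in>cover_block t. trunc l X = y"
        proof (rule approximable_in_cover_block[OF XM])
          show "b \<in> int_vectors n" "q \<in> int_vectors m" using bq(1) by blast+
          show "real (16 ^ Suc t) * \<psi> (16 ^ t) < 1" using T'[of t] t0 unfolding t0_def by simp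
          show "?h < 16 ^ Suc t" using t(2) by simp
          show "padic_max_abs p {..<n} (\<lambda>j. padic_vec_mat_mult p m q X j \<oplus>\<^bsub>padic_ring p\<^esub> padic_of_int p (b j)) < \<psi> ?h"
            using bq(1) by blast
        qed (rule t(1))
        then show ?thesis using t0 unfolding \<C>_def by blast
      qed
    qed
    also have "\<dots> \<le> ennreal e"
    proof (rule ennreal_infsum_le)
      \<comment> \<open>Finite partial sums suffice, and a finite set of cells lies in the blocks up
        to some \<open>M\<close>.\<close>
      fix F assume F: "finite F" "F \<subseteq> \<C>"
      have "\<exists>\<tau>. \<forall>x\<in>F. t0 \<le> \<tau> x \<and> x \<in> cover_block (\<tau> x)"
        using F(2) unfolding \<C>_def by (intro bchoice) auto
      then obtain \<tau> where \<tau>: "\<And>x. x \<in> F \<Longrightarrow> t0 \<le> \<tau> x \<and> x \<in> cover_block (\<tau> x)" by blast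
      define M where "M = Max (insert 0 (\<tau> ` F))"
      have M: "\<tau> x \<le> M" if "x \<in> F" for x unfolding M_def using F(1) that by (intro Max_ge) auto
      have "sum cost F \<le> sum cost (\<Union>t\<in>{t0..M}. cover_block t)"
      proof (rule sum_mono2)
        show "F \<subseteq> (\<Union>t\<in>{t0..M}. cover_block t)"
        proof
          fix x assume "x \<in> F"
          then have "\<tau> x \<in> {t0..M}" "x \<in> cover_block (\<tau> x)" using \<tau> M by auto
          then show "x \<in> (\<Union>t\<in>{t0..M}. cover_block t)" by (rule UN_I)
        qed
      qed (simp_all add: cost_nonneg)
      also have "\<dots> \<le> (\<Sum>t\<in>{t0..M}. sum cost (cover_block t))"
        by (rule sum_UNION_le) (simp_all add: cost_nonneg)
      also have "\<dots> \<le> (\<Sum>t\<in>{t0..M}. cover_const * condensed t)" by (intro sum_mono cover_block_cost)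
      also have "\<dots> = cover_const * (\<Sum>t\<in>{t0..M}. condensed t)" by (simp only: sum_distrib_left)
      also have "(\<Sum>t\<in>{t0..M}. condensed t) \<le> (\<Sum>i. condensed (i + t0))"
      proof -
        have "(\<Sum>t\<in>{t0..M}. condensed t) = (\<Sum>i\<in>{..<Suc M - t0}. condensed (i + t0))"
        proof (rule sum.reindex_bij_witness[where i = "\<lambda>i. i + t0" and j = "\<lambda>t. t - t0"])
        qed auto
        also have "\<dots> \<le> (\<Sum>i. condensed (i + t0))"
          using sm condensed_nonneg by (intro sum_le_suminf) (auto simp: summable_iff_shift)
        finally show ?thesis .
      qed
      also have "(\<Sum>i. condensed (i + t0)) \<le> e / cover_const" using T[of t0] unfolding t0_def by simp
      finally have "sum cost F \<le> e" using cover_const_pos by simp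
      moreover have "(\<Sum>x\<in>F. ennreal (cost x)) = ennreal (sum cost F)"
        by (intro sum_ennreal cost_nonneg)
      ultimately show "(\<Sum>x\<in>F. ennreal (cost x)) \<le> ennreal e" by (simp add: ennreal_leI)
    qed
    finally show ?thesis .
  qed
  have "hausdorff_premeasure Mmet f \<rho> ?W \<le> 0"
    by (rule ennreal_le_epsilon) (use le in simp)
  then show ?thesis by simp
qed

lemma hausdorff_measure_zero:
  assumes "summable condensed"
  shows "hausdorff_measure Mmet f (padic_approximable p m n \<psi>) = 0"
  unfolding hausdorff_measure_eq_SUP using premeasure_zero[OF assms] by simp

end

theorem theorem16:
  fixes p m n :: nat and \<psi> :: "nat \<Rightarrow> real" and f :: "real \<Rightarrow> real"
  assumes "prime p" and "1 \<le> m" and "1 \<le> n"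
    and "\<And>r. 1 \<le> r \<Longrightarrow> 0 < \<psi> r"
    and "antimono_on {1..} \<psi>"
    and "dimension_function f"
    and "filterlim (\<lambda>r. f r / r ^ (m * n)) at_top (at_right 0)"
    and "antimono_on {0<..} (\<lambda>r. f r / r ^ (m * n))"
    and "mono_on {0<..} (\<lambda>r. f r / r ^ ((m - 1) * n))"
  shows "((\<Sum>r. ennreal (f (\<psi> (Suc r)) / \<psi> (Suc r) ^ ((m - 1) * n) * real (Suc r) ^ (m + n - 1))) < \<infinity>
            \<longrightarrow> hausdorff_measure (padic_matrix_metric p m n) f (padic_approximable p m n \<psi>) = 0)
       \<and> ((\<Sum>r. ennreal (f (\<psi> (Suc r)) / \<psi> (Suc r) ^ ((m - 1) * n) * real (Suc r) ^ (m + n - 1))) = \<infinity>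
            \<longrightarrow> hausdorff_measure (padic_matrix_metric p m n) f (padic_approximable p m n \<psi>) = \<infinity>)"
proof -
  interpret jarnik p m n \<psi> f
    using assms by unfold_locales auto
  have eq: "f (\<psi> (Suc r)) / \<psi> (Suc r) ^ ((m - 1) * n) * real (Suc r) ^ (m + n - 1) = series_term r" for r
    unfolding series_term_def g_def ..
  show ?thesis
    unfolding eq
  proof (intro conjI impI)
    assume "(\<Sum>r. ennreal (series_term r)) < \<infinity>"
    then have "summable series_term" by (intro summable_suminf_not_top[OF series_term_nonneg]) simp
    then show "hausdorff_measure (padic_matrix_metric p m n) f (padic_approximable p m n \<psi>) = 0"
      by (intro hausdorff_measure_zero summable_condensed)
  next
    assume inf: "(\<Sum>r. ennreal (series_term r)) = \<infinity>"
    have "\<not> summable condensed"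
    proof
      assume "summable condensed"
      then have "summable series_term" by (rule summable_series_term)
      then have "(\<Sum>r. ennreal (series_term r)) = ennreal (suminf series_term)"
        using series_term_nonneg by (intro suminf_ennreal_eq) (auto intro: summable_sums)
      then show False using inf by simp
    qed
    then show "hausdorff_measure (padic_matrix_metric p m n) f (padic_approximable p m n \<psi>) = \<infinity>"
      by (intro hausdorff_measure_infinite) (simp add: condensed_def[abs_def])
  qed
qed

end
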